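(* There exists an absolute constant $c>0$ such that the following holds. Let $d\ge 1$ and $p\ge 1$ be integers, let $q>p$ be real and let $b\ge 0$. If $\mu$ and $\nu$ are Borel probability measures on $\mathbb{R}^d$ with $\int_{\mathbb{R}^d}|x|^q\,d\mu(x)\le b^q$ and $\int_{\mathbb{R}^d}|x|^q\,d\nu(x)\le b^q$, then $$\zeta_p(\mu,\nu)\;\le\;(cd)^p\,b^{p(1-\beta)}\,\sup_{|\theta|=1}\zeta_p(\mu_\theta,\nu_\theta)^{\beta},\qquad \beta=\frac{2}{2+\frac{dq}{p(q-p)}}.$$
   Context: $|x|$ is the Euclidean norm on $\mathbb{R}^d$. For $\theta\in\mathbb{R}^d$ with $|\theta|=1$, $\mu_\theta$ denotes the image (pushforward) of $\mu$ under the linear map $x\mapsto\langle x,\theta\rangle$ from $\mathbb{R}^d$ to $\mathbb{R}$; similarly $\nu_\theta$. For an integer $p\ge1$ and probability measures $\mu,\nu$ on $\mathbb{R}^d$ (any dimension $d\ge1$, in particular $d=1$) with finite $p$-th absolute moments, the Zolotarev distance of order $p$ is $$\zeta_p(\mu,\nu)=\sup\Big|\int_{\mathbb{R}^d}u\,d\mu-\int_{\mathbb{R}^d}u\,d\nu\Big|\in[0,\infty],$$ where the supremum is over all $p$ times differentiable (or equivalently, $C^\infty$-smooth) functions $u:\mathbb{R}^d\to\mathbb{R}$ all of whose partial derivatives of order $p$ are bounded by $1$ in absolute value. The value may be $+\infty$; it is finite exactly when $\mu$ and $\nu$ have equal mixed moments up to order $p-1$. "Absolute constant" means a constant independent of $d,p,q,b,\mu,\nu$.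 *)

theory Defs
  imports "HOL-Probability.Probability"
begin

text \<open>
  The constant in the theorem does not depend on the dimension, so the dimension \<open>d\<close> has to be
  a natural number quantified inside the statement and cannot be a type. A point of
  \<open>\<real>\<^sup>d\<close> is therefore a function on \<open>{..<d}\<close>, extended by \<open>undefined\<close>
  outside \<open>{..<d}\<close>, and the Borel sigma-algebra of \<open>\<real>\<^sup>d\<close> is the finite
  product of the Borel sigma-algebra of \<open>\<real>\<close>. The real line is \<open>\<real>\<^sup>1\<close>.
\<close>

definition Rd :: "nat \<Rightarrow> (nat \<Rightarrow> real) set" where
  "Rd d = ({..<d} \<rightarrow>\<^sub>E UNIV)"

definition borel_Rd :: "nat \<Rightarrow> (nat \<Rightarrow> real) measure" where
  "borel_Rd d = (\<Pi>\<^sub>M i\<in>{..<d}. borel)"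

definition enorm :: "nat \<Rightarrow> (nat \<Rightarrow> real) \<Rightarrow> real" where
  "enorm d x = L2_set x {..<d}"

definition usphere :: "nat \<Rightarrow> (nat \<Rightarrow> real) set" where
  "usphere d = {\<theta> \<in> Rd d. enorm d \<theta> = 1}"

definition einner :: "nat \<Rightarrow> (nat \<Rightarrow> real) \<Rightarrow> (nat \<Rightarrow> real) \<Rightarrow> real" where
  "einner d x y = (\<Sum>i<d. x i * y i)"

definition marginal :: "nat \<Rightarrow> (nat \<Rightarrow> real) \<Rightarrow> (nat \<Rightarrow> real) measure \<Rightarrow> (nat \<Rightarrow> real) measure" where
  "marginal d \<theta> \<mu> = distr \<mu> (borel_Rd 1) (\<lambda>x. \<lambda>i\<in>{..<1}. einner d x \<theta>)"

text \<open>
  Total (Frechet) differentiability at \<open>x\<close>, where \<open>g\<close> is the gradient. The filter comes from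
  the product topology on functions, which induces on \<^term>\<open>Rd d\<close> the Euclidean topology.
\<close>

definition differentiable_Rd :: "nat \<Rightarrow> ((nat \<Rightarrow> real) \<Rightarrow> real) \<Rightarrow> (nat \<Rightarrow> real) \<Rightarrow> bool" where
  "differentiable_Rd d f x \<longleftrightarrow>
     (\<exists>g. ((\<lambda>y. (f y - f x - einner d g (\<lambda>i. y i - x i)) / enorm d (\<lambda>i. y i - x i)) \<longlongrightarrow> 0)
        (at x within Rd d))"

definition partial_deriv :: "nat \<Rightarrow> ((nat \<Rightarrow> real) \<Rightarrow> real) \<Rightarrow> (nat \<Rightarrow> real) \<Rightarrow> real" where
  "partial_deriv i f x = deriv (\<lambda>t. f (x(i := t))) (x i)"

text \<open>
  The derivative map of \<open>f\<close> is \<open>k\<close> times differentiable iff its components, the first partial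
  derivatives, are; hence the recursion. Continuity of the derivatives of top order is not required.
\<close>

primrec times_differentiable :: "nat \<Rightarrow> nat \<Rightarrow> ((nat \<Rightarrow> real) \<Rightarrow> real) \<Rightarrow> bool" where
  "times_differentiable d 0 f \<longleftrightarrow> True"
| "times_differentiable d (Suc k) f \<longleftrightarrow>
     (\<forall>x\<in>Rd d. differentiable_Rd d f x) \<and> (\<forall>i<d. times_differentiable d k (partial_deriv i f))"

text \<open>A list of \<open>p\<close> directions stands for a partial derivative of order \<open>p\<close>.\<close>

definition zolotarev_class :: "nat \<Rightarrow> nat \<Rightarrow> ((nat \<Rightarrow> real) \<Rightarrow> real) set" where
  "zolotarev_class d p =
     {u. times_differentiable d p u \<and>
         (\<forall>is. length is = p \<and> set is \<subseteq> {..<d} \<longrightarrow>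
            (\<forall>x\<in>Rd d. \<bar>foldr partial_deriv is u x\<bar> \<le> 1))}"

text \<open>
  For measures with finite moments of order \<open>p\<close>, which is the intended use, all integrals
  below exist, because a function in the class grows at most like \<open>1 + enorm d x ^ p\<close>.
\<close>

definition zolotarev :: "nat \<Rightarrow> nat \<Rightarrow> (nat \<Rightarrow> real) measure \<Rightarrow> (nat \<Rightarrow> real) measure \<Rightarrow> ennreal" where
  "zolotarev d p \<mu> \<nu> =
     (SUP u\<in>zolotarev_class d p. ennreal \<bar>(\<integral>x. u x \<partial>\<mu>) - (\<integral>x. u x \<partial>\<nu>)\<bar>)"

definition ennpowr :: "ennreal \<Rightarrow> real \<Rightarrow> ennreal" where
  \<comment> \<open>Intended for positive exponents, for which \<open>\<infinity>\<close> to any power is \<open>\<infinity>\<close>.\<close>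
  "ennpowr a r = (if a = \<infinity> then \<infinity> else ennreal (enn2real a powr r))"

end

theory Submission
  imports Defs
begin

text \<open>
  Let \<open>Z\<close> bound the distances of the one-dimensional marginals. Testing with cosines shows
  that the characteristic functions of \<open>\<mu>\<close> and \<open>\<nu>\<close> differ at \<open>\<xi>\<close> by at most
  \<open>2 Z |\<xi>|\<^sup>p\<close>, and testing with powers shows, by polarization, that mixed moments of order less
  than \<open>p\<close> agree. So a test function \<open>u\<close> may be replaced by its Taylor remainder \<open>V\<close> at \<open>0\<close>.
  Multiplying \<open>V\<close> by a radial cutoff at radius \<open>R\<close> and extending it with period \<open>8 R\<close> gives a
  function \<open>f\<close> whose \<open>p\<close>-th derivative has operator norm at most \<open>(54 \<surd>d)\<^sup>p\<close>; the moment of order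
  \<open>q\<close> controls \<open>V - f\<close>. By Jackson's inequality \<open>f\<close> is approximated by a trigonometric polynomial
  of degree at most \<open>n\<close> in each variable up to \<open>(C d R / n)\<^sup>p\<close>, and by Parseval and
  Cauchy-Schwarz the integral of that polynomial against \<open>\<mu> - \<nu>\<close> is at most
  \<open>(C d)\<^sup>p (2 n + 1)\<^bsup>d/2\<^esup> Z\<close>, up to a factor \<open>2 \<surd>d\<close>. It remains to balance the three errors in \<open>R\<close> and \<open>n\<close>.

  All Fourier analysis is done on a finite lattice in the torus; the mesh tends to zero at the end.
\<close>

section \<open>Bounds on iterated directional derivatives\<close>

text \<open>The obstacle is the constant: neither a factor \<open>C ^ d\<close> nor a further power
  of \<open>d\<close> fits into \<open>(c * d) ^ p\<close>. One factor \<open>sqrt d ^ p\<close> is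
  spent at once, since partial derivatives bounded by 1 only give a \<open>p\<close>-th derivative
  of operator norm \<open>sqrt d ^ p\<close>. The number of frequencies then puts a factor
  \<open>(C * sqrt d) ^ (p + d / 2)\<close> in front of \<open>Z\<close>. It is tolerable because
  \<open>Z\<close> is finally raised to the power \<open>\<beta>\<close> and
  \<open>p / \<beta> \<ge> p + d / 2\<close>: the second and last factor
  \<open>(C * sqrt d) ^ p\<close>, standing in front of \<open>Z powr \<beta>\<close>, pays for all
  of it. The \<open>sqrt d\<close> in Jackson's inequality is hidden in the choice of
  \<open>n\<close>, which is proportional to \<open>sqrt d\<close>. The lattice turns inversion,
  Parseval and the Fourier coefficients of the kernel into finite algebra. All bounds that survive
  are uniform in the mesh, so the limit costs nothing.\<close>

lemma enorm_nonneg [simp]: "0 \<le> enorm d x"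
  by (simp add: enorm_def)

lemma enorm_sq: "(enorm d x)\<^sup>2 = (\<Sum>i<d. (x i)\<^sup>2)"
  by (simp add: enorm_def L2_set_def sum_nonneg)

lemma abs_einner_le: "\<bar>einner d x y\<bar> \<le> enorm d x * enorm d y"
proof -
  have "\<bar>einner d x y\<bar> \<le> (\<Sum>i<d. \<bar>x i\<bar> * \<bar>y i\<bar>)"
    unfolding einner_def by (rule order_trans[OF sum_abs]) (simp add: abs_mult)
  also have "\<dots> \<le> enorm d x * enorm d y"
    unfolding enorm_def by (rule L2_set_mult_ineq)
  finally show ?thesis .
qed

lemma abs_le_enorm: "i < d \<Longrightarrow> \<bar>x i\<bar> \<le> enorm d x"
proof -
  assume "i < d"
  then have "(x i)\<^sup>2 \<le> (enorm d x)\<^sup>2"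
    unfolding enorm_sq by (intro member_le_sum) auto
  then show ?thesis by (metis abs_le_square_iff abs_of_nonneg enorm_nonneg)
qed

lemma sum_abs_le_enorm: "(\<Sum>i<d. \<bar>x i\<bar>) \<le> sqrt (real d) * enorm d x"
proof -
  have "(\<Sum>i<d. \<bar>x i\<bar> * \<bar>1\<bar>) \<le> L2_set x {..<d} * L2_set (\<lambda>_. 1) {..<d}"
    by (rule L2_set_mult_ineq)
  then show ?thesis by (simp add: enorm_def L2_set_def mult.commute)
qed

lemma enorm_le_sum_abs: "enorm d x \<le> (\<Sum>i<d. \<bar>x i\<bar>)"
  unfolding enorm_def by (rule L2_set_le_sum_abs)

lemma enorm_scale: "enorm d (\<lambda>i. c * x i) = \<bar>c\<bar> * enorm d x"
proof -
  have "(\<Sum>i<d. (c * x i)\<^sup>2) = c\<^sup>2 * (\<Sum>i<d. (x i)\<^sup>2)"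
    by (simp add: power_mult_distrib sum_distrib_left)
  then show ?thesis by (simp add: enorm_def L2_set_def real_sqrt_mult)
qed

lemma enorm_cong: "(\<And>i. i < d \<Longrightarrow> x i = y i) \<Longrightarrow> enorm d x = enorm d y"
  unfolding enorm_def by (rule L2_set_cong) auto

definition along :: "(nat \<Rightarrow> real) \<Rightarrow> (nat \<Rightarrow> real) \<Rightarrow> real \<Rightarrow> nat \<Rightarrow> real" where
  "along x v s = (\<lambda>i. x i + s * v i)"

lemma along_0 [simp]: "along x v 0 = x"
  by (simp add: along_def)

lemma along_along: "along (along x v s) v t = along x v (t + s)"
  by (simp add: along_def fun_eq_iff algebra_simps)

text \<open>Moving the base point along \<open>v\<close> only shifts the parameter, so a derivative
  at 0 for every base point is a derivative everywhere. Derivatives can therefore always be stated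
  at 0.\<close>

lemma DERIV_along:
  assumes "\<And>x. ((\<lambda>s. f (along x v s)) has_real_derivative g x) (at 0)"
  shows "((\<lambda>s. f (along x v s)) has_real_derivative g (along x v s)) (at s)"
proof -
  have "((\<lambda>t. f (along x v (t + s))) has_real_derivative g (along x v s)) (at 0)"
    using assms[of "along x v s"] by (simp add: along_along)
  then show ?thesis
    using DERIV_shift[of "\<lambda>t. f (along x v t)" "g (along x v s)" 0 s] by simp
qed

text \<open>
  Here \<open>a j x\<close> bounds the \<open>j\<close>-th derivative of \<open>f\<close> at \<open>x\<close> as a multilinear form, in operator norm
  for the Euclidean norm. Bounds on the partial derivatives alone would cost additional powers of \<open>d\<close>
  for the truncated function, which the constant \<open>(c d)\<^sup>p\<close> does not leave room for.
\<close>

primrec dbound :: "nat \<Rightarrow> nat \<Rightarrow> (nat \<Rightarrow> (nat \<Rightarrow> real) \<Rightarrow> real) \<Rightarrow> ((nat \<Rightarrow> real) \<Rightarrow> real) \<Rightarrow> bool" where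
  "dbound d 0 a f \<longleftrightarrow> (\<forall>x. \<bar>f x\<bar> \<le> a 0 x)"
| "dbound d (Suc n) a f \<longleftrightarrow> (\<forall>x. \<bar>f x\<bar> \<le> a 0 x) \<and>
     (\<forall>v. \<exists>g. (\<forall>x. ((\<lambda>s. f (along x v s)) has_real_derivative g x) (at 0)) \<and>
        dbound d n (\<lambda>j x. enorm d v * a (Suc j) x) g)"

lemma dbound_SucD:
  "dbound d (Suc n) a f \<Longrightarrow> \<exists>g. (\<forall>x. ((\<lambda>s. f (along x v s)) has_real_derivative g x) (at 0)) \<and>
     dbound d n (\<lambda>j x. enorm d v * a (Suc j) x) g"
  by simp

lemma dbound_abs_le: "dbound d n a f \<Longrightarrow> \<bar>f x\<bar> \<le> a 0 x"
  by (cases n) auto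

lemma dbound_mono:
  assumes "dbound d n a f" and "\<And>j x. j \<le> n \<Longrightarrow> a j x \<le> b j x"
  shows "dbound d n b f"
  using assms
proof (induction n arbitrary: a b f)
  case 0
  then show ?case by (auto intro: order_trans)
next
  case (Suc n)
  show ?case unfolding dbound.simps
  proof (intro conjI allI)
    fix x show "\<bar>f x\<bar> \<le> b 0 x"
      using Suc.prems dbound_abs_le by (meson le0 order_trans)
  next
    fix v
    obtain g where g: "\<forall>x. ((\<lambda>s. f (along x v s)) has_real_derivative g x) (at 0)"
      "dbound d n (\<lambda>j x. enorm d v * a (Suc j) x) g"
      using dbound_SucD[OF Suc.prems(1), of v] by blast
    have "dbound d n (\<lambda>j x. enorm d v * b (Suc j) x) g"
      by (rule Suc.IH[OF g(2)]) (auto intro!: mult_left_mono Suc.prems)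
    with g(1) show "\<exists>g. (\<forall>x. ((\<lambda>s. f (along x v s)) has_real_derivative g x) (at 0)) \<and>
        dbound d n (\<lambda>j x. enorm d v * b (Suc j) x) g" by auto
  qed
qed

lemma dbound_lower: "dbound d (Suc n) a f \<Longrightarrow> dbound d n a f"
proof (induction n arbitrary: a f)
  case (Suc n)
  show ?case unfolding dbound.simps(2)[of d n]
  proof (intro conjI allI)
    fix x show "\<bar>f x\<bar> \<le> a 0 x" using Suc.prems by simp
  next
    fix v
    obtain g where "\<forall>x. ((\<lambda>s. f (along x v s)) has_real_derivative g x) (at 0)"
      "dbound d (Suc n) (\<lambda>j x. enorm d v * a (Suc j) x) g"
      using Suc.prems unfolding dbound.simps(2)[of d "Suc n"] by blast
    then show "\<exists>g. (\<forall>x. ((\<lambda>s. f (along x v s)) has_real_derivative g x) (at 0)) \<and>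
        dbound d n (\<lambda>j x. enorm d v * a (Suc j) x) g"
      using Suc.IH by blast
  qed
qed auto

lemma dbound_add:
  assumes "dbound d n a f" and "dbound d n b g"
  shows "dbound d n (\<lambda>j x. a j x + b j x) (\<lambda>x. f x + g x)"
  using assms
proof (induction n arbitrary: a b f g)
  case 0
  then show ?case by (auto intro!: order_trans[OF abs_triangle_ineq] add_mono)
next
  case (Suc n)
  show ?case unfolding dbound.simps
  proof (intro conjI allI)
    fix x show "\<bar>f x + g x\<bar> \<le> a 0 x + b 0 x"
      using Suc.prems by (auto intro!: order_trans[OF abs_triangle_ineq] add_mono)
  next
    fix v
    obtain f' where f': "\<forall>x. ((\<lambda>s. f (along x v s)) has_real_derivative f' x) (at 0)"
      "dbound d n (\<lambda>j x. enorm d v * a (Suc j) x) f'" using dbound_SucD[OF Suc.prems(1), of v] by blast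
    obtain g' where g': "\<forall>x. ((\<lambda>s. g (along x v s)) has_real_derivative g' x) (at 0)"
      "dbound d n (\<lambda>j x. enorm d v * b (Suc j) x) g'" using dbound_SucD[OF Suc.prems(2), of v] by blast
    have "dbound d n (\<lambda>j x. enorm d v * (a (Suc j) x + b (Suc j) x)) (\<lambda>x. f' x + g' x)"
      using Suc.IH[OF f'(2) g'(2)] by (simp add: distrib_left)
    then show "\<exists>h. (\<forall>x. ((\<lambda>s. f (along x v s) + g (along x v s)) has_real_derivative h x) (at 0)) \<and>
        dbound d n (\<lambda>j x. enorm d v * (a (Suc j) x + b (Suc j) x)) h"
      using f'(1) g'(1) by (intro exI[of _ "\<lambda>x. f' x + g' x"] conjI allI DERIV_add) auto
  qed
qed

section \<open>Leibniz rule for derivative bounds\<close>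

definition bconv :: "(nat \<Rightarrow> real) \<Rightarrow> (nat \<Rightarrow> real) \<Rightarrow> nat \<Rightarrow> real" where
  "bconv a b j = (\<Sum>l\<le>j. real (j choose l) * a l * b (j - l))"

text \<open>Pascal's rule: differentiating a product once shifts one of the two sequences of bounds,
  and the two resulting convolutions add up to the next term.\<close>

lemma bconv_Suc: "bconv (\<lambda>j. a (Suc j)) b j + bconv a (\<lambda>j. b (Suc j)) j = bconv a b (Suc j)"
proof -
  have "bconv a b (Suc j) = a 0 * b (Suc j) + (\<Sum>l\<le>j. real (Suc j choose Suc l) * a (Suc l) * b (j - l))"
    unfolding bconv_def by (subst sum.atMost_Suc_shift) simp
  also have "(\<Sum>l\<le>j. real (Suc j choose Suc l) * a (Suc l) * b (j - l)) =
      bconv (\<lambda>j. a (Suc j)) b j + (\<Sum>l\<le>j. real (j choose Suc l) * a (Suc l) * b (j - l))"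
    unfolding bconv_def by (simp add: sum.distrib[symmetric] algebra_simps)
  also have "a 0 * b (Suc j) + (bconv (\<lambda>j. a (Suc j)) b j +
      (\<Sum>l\<le>j. real (j choose Suc l) * a (Suc l) * b (j - l))) =
      bconv (\<lambda>j. a (Suc j)) b j + (\<Sum>l\<le>Suc j. real (j choose l) * a l * b (Suc j - l))"
    by (subst sum.atMost_Suc_shift) simp
  also have "(\<Sum>l\<le>Suc j. real (j choose l) * a l * b (Suc j - l)) = bconv a (\<lambda>j. b (Suc j)) j"
    unfolding bconv_def by (simp add: Suc_diff_le)
  finally show ?thesis by simp
qed

text \<open>One derivative in an arbitrary direction \<open>v\<close> leaves two products, to which
  the induction hypothesis applies with shifted bounds; \<open>bconv_Suc\<close> merges them. Since
  only one direction is treated at a time, no sum over coordinates and no power of \<open>d\<close>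
  arises.\<close>

lemma dbound_mult:
  assumes "dbound d n a f" and "dbound d n b g"
  shows "dbound d n (\<lambda>j x. bconv (\<lambda>j. a j x) (\<lambda>j. b j x) j) (\<lambda>x. f x * g x)"
  using assms
proof (induction n arbitrary: a b f g)
  case 0
  have "0 \<le> a 0 x" for x using 0(1) abs_ge_zero order_trans by (simp, blast)
  with 0 show ?case by (auto simp: bconv_def abs_mult intro!: mult_mono)
next
  case (Suc n)
  show ?case unfolding dbound.simps
  proof (intro conjI allI)
    fix x
    have "0 \<le> a 0 x" using dbound_abs_le[OF Suc.prems(1), of x] by linarith
    then show "\<bar>f x * g x\<bar> \<le> bconv (\<lambda>j. a j x) (\<lambda>j. b j x) 0"
      using Suc.prems by (auto simp: bconv_def abs_mult intro!: mult_mono)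
  next
    fix v
    obtain f' where f': "\<forall>x. ((\<lambda>s. f (along x v s)) has_real_derivative f' x) (at 0)"
      "dbound d n (\<lambda>j x. enorm d v * a (Suc j) x) f'" using dbound_SucD[OF Suc.prems(1), of v] by blast
    obtain g' where g': "\<forall>x. ((\<lambda>s. g (along x v s)) has_real_derivative g' x) (at 0)"
      "dbound d n (\<lambda>j x. enorm d v * b (Suc j) x) g'" using dbound_SucD[OF Suc.prems(2), of v] by blast
    have "dbound d n (\<lambda>j x. enorm d v * bconv (\<lambda>j. a j x) (\<lambda>j. b j x) (Suc j))
            (\<lambda>x. f' x * g x + f x * g' x)"
    proof (rule dbound_mono[OF dbound_add[OF Suc.IH[OF f'(2) dbound_lower[OF Suc.prems(2)]]
              Suc.IH[OF dbound_lower[OF Suc.prems(1)] g'(2)]]])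
      fix j x
      have "bconv (\<lambda>j. enorm d v * a (Suc j) x) (\<lambda>j. b j x) j =
          enorm d v * bconv (\<lambda>j. a (Suc j) x) (\<lambda>j. b j x) j"
        and "bconv (\<lambda>j. a j x) (\<lambda>j. enorm d v * b (Suc j) x) j =
          enorm d v * bconv (\<lambda>j. a j x) (\<lambda>j. b (Suc j) x) j"
        unfolding bconv_def by (simp_all add: sum_distrib_left mult_ac)
      then show "bconv (\<lambda>j. enorm d v * a (Suc j) x) (\<lambda>j. b j x) j +
          bconv (\<lambda>j. a j x) (\<lambda>j. enorm d v * b (Suc j) x) j
          \<le> enorm d v * bconv (\<lambda>j. a j x) (\<lambda>j. b j x) (Suc j)"
        by (simp add: bconv_Suc[of "\<lambda>j. a j x" "\<lambda>j. b j x", symmetric] distrib_left)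
    qed
    moreover have "((\<lambda>s. f (along x v s) * g (along x v s)) has_real_derivative
        f' x * g x + f x * g' x) (at 0)" for x
      using DERIV_mult[OF spec[OF f'(1), of x] spec[OF g'(1), of x]] by (simp add: algebra_simps)
    ultimately show "\<exists>h. (\<forall>x. ((\<lambda>s. f (along x v s) * g (along x v s)) has_real_derivative h x) (at 0)) \<and>
        dbound d n (\<lambda>j x. enorm d v * bconv (\<lambda>j. a j x) (\<lambda>j. b j x) (Suc j)) h"
      by (intro exI[of _ "\<lambda>x. f' x * g x + f x * g' x"]) simp
  qed
qed

lemma dbound_const: "dbound d n (\<lambda>j x. if j = 0 then \<bar>c\<bar> else 0) (\<lambda>x. c)"
proof -
  have z: "dbound d n (\<lambda>j x. 0) (\<lambda>x. 0)" for n
  proof (induction n)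
    case (Suc n)
    show ?case unfolding dbound.simps
      by (intro conjI allI exI[of _ "\<lambda>x. 0"]) (auto simp: Suc)
  qed auto
  show ?thesis
  proof (cases n)
    case (Suc k)
    show ?thesis unfolding Suc dbound.simps
      by (intro conjI allI exI[of _ "\<lambda>x. 0"]) (auto simp: z)
  qed auto
qed

section \<open>Derivative bounds for radial cutoffs\<close>

lemma einner_along: "einner d (along x v s) y = einner d x y + s * einner d v y"
  by (simp add: einner_def along_def sum.distrib sum_distrib_left algebra_simps)

lemma dbound_einner:
  "dbound d n (\<lambda>j x. if j = 0 then enorm d x * enorm d y else if j = 1 then enorm d y else 0)
     (\<lambda>x. einner d x y)"
proof (cases n)
  case (Suc k)
  show ?thesis unfolding Suc dbound.simps
  proof (intro conjI allI)
    fix v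
    have "dbound d k (\<lambda>j x. enorm d v * (if Suc j = 0 then enorm d x * enorm d y
        else if Suc j = 1 then enorm d y else 0)) (\<lambda>x. einner d v y)"
      by (rule dbound_mono[OF dbound_const]) (auto simp: abs_einner_le)
    moreover have "((\<lambda>s. einner d (along x v s) y) has_real_derivative einner d v y) (at 0)" for x
      unfolding einner_along by (auto intro!: derivative_eq_intros)
    ultimately show "\<exists>g. (\<forall>x. ((\<lambda>s. einner d (along x v s) y) has_real_derivative g x) (at 0)) \<and>
        dbound d k (\<lambda>j x. enorm d v * (if Suc j = 0 then enorm d x * enorm d y
          else if Suc j = 1 then enorm d y else 0)) g"
      by (intro exI[of _ "\<lambda>x. einner d v y"]) simp
  qed (simp add: abs_einner_le)
qed (simp add: abs_einner_le)

text \<open>The derivative of \<open>G m (|x|^2)\<close> along \<open>v\<close> is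
  \<open>2 * <x, v> * G (Suc m) (|x|^2)\<close>, again a radial function times a linear one, so the
  induction runs over all \<open>m\<close> at once. In the Leibniz rule the linear factor leaves
  just two terms, and \<open>E\<close> is chosen so that each derivative costs one factor
  \<open>E\<close>.\<close>

lemma dbound_radial:
  fixes G :: "nat \<Rightarrow> real \<Rightarrow> real"
  assumes G: "\<And>m t. m < p \<Longrightarrow> (G m has_real_derivative G (Suc m) t) (at t)"
    and bd: "\<And>m t. m \<le> p \<Longrightarrow> \<bar>G m t\<bar> \<le> B ^ m"
    and supp: "\<And>m t. m \<le> p \<Longrightarrow> s\<^sup>2 < t \<Longrightarrow> G m t = 0"
    and s: "0 < s" and B: "0 \<le> B" and E: "E = 2 * B * s + real p / s"
    and nm: "n + m \<le> p"
  shows "dbound d n (\<lambda>j x. if enorm d x \<le> s then B ^ m * E ^ j else 0) (\<lambda>x. G m ((enorm d x)\<^sup>2))"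
proof -
  have val: "\<bar>G m ((enorm d x)\<^sup>2)\<bar> \<le> (if enorm d x \<le> s then B ^ m * E ^ 0 else 0)"
    if "m \<le> p" for m x
    using bd[OF that] supp[OF that, of "(enorm d x)\<^sup>2"] s power_strict_mono[of s "enorm d x" 2]
    by (auto simp: not_le)
  from nm show ?thesis
  proof (induction n arbitrary: m)
    case 0
    then show ?case using val by simp
  next
    case (Suc n)
    show ?case unfolding dbound.simps
    proof (intro conjI allI)
      fix x show "\<bar>G m ((enorm d x)\<^sup>2)\<bar> \<le> (if enorm d x \<le> s then B ^ m * E ^ 0 else 0)"
        using val Suc.prems by simp
    next
      fix v :: "nat \<Rightarrow> real"
      let ?v2 = "\<lambda>i. 2 * v i"
      let ?g = "\<lambda>x. einner d x ?v2 * G (Suc m) ((enorm d x)\<^sup>2)"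
      have E0: "0 \<le> E" using s B by (simp add: E)
      have der: "((\<lambda>r. G m ((enorm d (along x v r))\<^sup>2)) has_real_derivative ?g x) (at 0)" for x
      proof -
        have "((\<lambda>r. (enorm d (along x v r))\<^sup>2) has_real_derivative einner d x ?v2) (at 0)"
        proof -
          have "((\<lambda>r. \<Sum>i<d. (x i + r * v i)\<^sup>2) has_real_derivative (\<Sum>i<d. x i * (2 * v i))) (at 0)"
          proof (rule DERIV_sum)
            fix i
            show "((\<lambda>r. (x i + r * v i)\<^sup>2) has_real_derivative x i * (2 * v i)) (at 0)"
              by (auto intro!: derivative_eq_intros)
          qed
          then show ?thesis by (simp add: enorm_sq along_def einner_def)
        qed
        moreover have "(G m has_real_derivative G (Suc m) ((enorm d x)\<^sup>2)) (at ((enorm d (along x v 0))\<^sup>2))"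
          using G[of m "(enorm d x)\<^sup>2"] Suc.prems by simp
        ultimately show ?thesis
          using DERIV_chain2[of "G m" "G (Suc m) ((enorm d x)\<^sup>2)" "\<lambda>r. (enorm d (along x v r))\<^sup>2" 0]
          by (simp add: mult.commute)
      qed
      have "dbound d n (\<lambda>j x. enorm d v * (if enorm d x \<le> s then B ^ m * E ^ Suc j else 0)) ?g"
      proof -
        have ih: "dbound d n (\<lambda>j x. if enorm d x \<le> s then B ^ Suc m * E ^ j else 0)
            (\<lambda>x. G (Suc m) ((enorm d x)\<^sup>2))"
          by (rule Suc.IH) (use Suc.prems in simp)
        have dm: "dbound d n (\<lambda>j x. bconv (\<lambda>j. if j = 0 then enorm d x * enorm d ?v2 else if j = 1 then enorm d ?v2 else 0)
          (\<lambda>j. if enorm d x \<le> s then B ^ Suc m * E ^ j else 0) j) ?g"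
          by (rule dbound_mult[OF dbound_einner ih])
        show ?thesis
        proof (rule dbound_mono[OF dm])
        fix j x assume j: "j \<le> n"
        let ?a = "\<lambda>j::nat. if j = 0 then enorm d x * enorm d ?v2 else if j = 1 then enorm d ?v2 else 0"
        let ?b = "\<lambda>j::nat. if enorm d x \<le> s then B ^ Suc m * E ^ j else 0"
        have "bconv ?a ?b j = (\<Sum>l\<in>{..j} \<inter> {0,1}. real (j choose l) * ?a l * ?b (j - l))"
          unfolding bconv_def by (intro sum.mono_neutral_right) auto
        also have "\<dots> = enorm d ?v2 * (enorm d x * ?b j + real j * ?b (j - 1))"
        proof (cases j)
          case (Suc i)
          then have "{..j} \<inter> {0,1} = {0,1}" by auto
          then show ?thesis using Suc by (simp add: distrib_left mult_ac)
        qed simp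
        also have "\<dots> \<le> enorm d v * (if enorm d x \<le> s then B ^ m * E ^ Suc j else 0)"
        proof (cases "enorm d x \<le> s")
          case True
          have "enorm d x * E ^ j \<le> s * E ^ j" using True E0 by (intro mult_right_mono) auto
          \<comment> \<open>The two summands of \<open>E\<close> answer the two terms:
            \<open>2 * B * s\<close> covers the first because \<open>|x| \<le> s\<close>, and
            \<open>p / s\<close> covers the second because \<open>(p / s) * E \<ge> (p / s) * (2 * B
            * s) = 2 * B * p \<ge> 2 * B * j\<close>.\<close>
          have key: "2 * B * (enorm d x * E ^ j + real j * E ^ (j - 1)) \<le> E ^ Suc j"
          proof (cases j)
            case 0
            have "2 * B * enorm d x \<le> 2 * B * s" using True B by (intro mult_left_mono) auto
            moreover have "0 \<le> real p / s" using s by simp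
            ultimately have "2 * B * enorm d x \<le> E" unfolding E by linarith
            then show ?thesis using 0 by simp
          next
            case (Suc i)
            have "real p / s * (2 * B * s) \<le> real p / s * E"
              using s by (intro mult_left_mono) (auto simp: E)
            moreover have "real p / s * (2 * B * s) = 2 * B * real p" using s by simp
            ultimately have "2 * B * real p \<le> real p / s * E" by linarith
            moreover have "2 * B * real j \<le> 2 * B * real p"
              using B j Suc.prems by (intro mult_left_mono) auto
            moreover have "2 * B * (enorm d x * E) \<le> 2 * B * (s * E)"
              using True B E0 by (intro mult_left_mono mult_right_mono) auto
            moreover have "E * E = 2 * B * (s * E) + real p / s * E"
            proof -
              have "E * E = (2 * B * s + real p / s) * E" using E by simp
              then show ?thesis by (simp only: distrib_right mult.assoc)
            qed
            ultimately have "2 * B * (enorm d x * E + real j) \<le> E * E"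
              unfolding distrib_left by linarith
            then have "E ^ i * (2 * B * (enorm d x * E + real j)) \<le> E ^ i * (E * E)"
              using E0 by (intro mult_left_mono) auto
            then show ?thesis using Suc by (simp add: algebra_simps)
          qed
          have 1: "B ^ m * (2 * B * (enorm d x * E ^ j + real j * E ^ (j - 1))) \<le> B ^ m * E ^ Suc j"
            by (rule mult_left_mono[OF key]) (use B in simp)
          have "enorm d v * (B ^ m * (2 * B * (enorm d x * E ^ j + real j * E ^ (j - 1))))
              \<le> enorm d v * (B ^ m * E ^ Suc j)"
            by (rule mult_left_mono[OF 1]) simp
          moreover have v2: "enorm d ?v2 = 2 * enorm d v"
            using enorm_scale[of d 2 v] by simp
          ultimately show ?thesis using True unfolding v2 by (simp add: algebra_simps)
        qed (auto)
        finally show "bconv ?a ?b j \<le> enorm d v * (if enorm d x \<le> s then B ^ m * E ^ Suc j else 0)" .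
        qed
      qed
      with der show "\<exists>g. (\<forall>x. ((\<lambda>r. G m ((enorm d (along x v r))\<^sup>2)) has_real_derivative g x) (at 0)) \<and>
        dbound d n (\<lambda>j x. enorm d v * (if enorm d x \<le> s then B ^ m * E ^ Suc j else 0)) g"
        by (intro exI[of _ ?g]) simp
    qed
  qed
qed

section \<open>Truncation, periodization and differences\<close>

text \<open>
  A step smoothed by \<open>n\<close> averages over windows of length \<open>w\<close>. With \<open>w = 1 / p\<close> the bounds
  \<open>(2 p)\<^sup>m\<close> are absorbed by the factorials of Taylor's formula; a cutoff that does not depend on
  \<open>p\<close> would give constants worse than \<open>c\<^sup>p\<close>.
\<close>

definition smooth_step :: "real \<Rightarrow> nat \<Rightarrow> (nat \<Rightarrow> real \<Rightarrow> real) \<Rightarrow> bool" where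
  "smooth_step w n G \<longleftrightarrow>
    (\<forall>m<n. \<forall>t. (G m has_real_derivative G (Suc m) t) (at t)) \<and>
    (\<forall>m\<le>n. \<forall>t. \<bar>G m t\<bar> \<le> (2 / w) ^ m) \<and> (\<forall>m\<le>n. \<forall>t\<ge>3. G m t = 0) \<and>
    (\<forall>t\<le>2 - real n * w. G 0 t = 1) \<and> (\<forall>t. 0 \<le> G 0 t \<and> G 0 t \<le> 1) \<and> continuous_on UNIV (G 0)"

text \<open>Start from the ramp that falls from 1 at 2 to 0 at 3. The mean of \<open>G 0\<close>
  over \<open>[t, t + w]\<close> is a difference quotient of an antiderivative, so each averaging
  gains one derivative and a factor \<open>2 / w\<close>. By the mean value theorem the mean is a
  value of \<open>G 0\<close> further right: range and zero set are kept, and the plateau loses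
  \<open>w\<close> at its right end.\<close>

lemma smooth_step_exists:
  assumes w: "0 < w"
  shows "\<exists>G. smooth_step w n G"
proof (induction n)
  case 0
  have "smooth_step w 0 (\<lambda>m t. max 0 (min 1 (3 - t)))"
    unfolding smooth_step_def by (auto intro!: continuous_intros)
  then show ?case by blast
next
  case (Suc n)
  then obtain G where G: "smooth_step w n G" by blast
  have G1: "\<And>m t. m < n \<Longrightarrow> (G m has_real_derivative G (Suc m) t) (at t)"
    and G2: "\<And>m t. m \<le> n \<Longrightarrow> \<bar>G m t\<bar> \<le> (2 / w) ^ m"
    and G3: "\<And>m t. m \<le> n \<Longrightarrow> t \<ge> 3 \<Longrightarrow> G m t = 0"
    and G4: "\<And>t. t \<le> 2 - real n * w \<Longrightarrow> G 0 t = 1"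
    and G5: "\<And>t. 0 \<le> G 0 t" "\<And>t. G 0 t \<le> 1"
    and G6: "continuous_on UNIV (G 0)"
    using G unfolding smooth_step_def by simp_all
  have "\<exists>H. \<forall>x. -\<infinity> < ereal x \<longrightarrow> ereal x < \<infinity> \<longrightarrow> (H has_vector_derivative G 0 x) (at x)"
    by (rule einterval_antiderivative)
      (use G6 in \<open>auto simp: continuous_on_eq_continuous_at\<close>)
  then obtain H where H: "\<And>x. (H has_real_derivative G 0 x) (at x)"
    by (auto simp: has_real_derivative_iff_has_vector_derivative)
  define h where "h t = (H (t + w) - H t) / w" for t
  define G' where "G' m t = (case m of 0 \<Rightarrow> h t | Suc k \<Rightarrow> (G k (t + w) - G k t) / w)" for m t
  have mvt: "\<exists>z>t. z < t + w \<and> h t = G 0 z" for t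
  proof -
    obtain z where "t < z" "z < t + w" "H (t + w) - H t = (t + w - t) * G 0 z"
      using MVT2[of t "t + w" H "G 0"] H w by auto
    then show ?thesis using w by (auto simp: h_def intro!: exI[of _ z])
  qed
  have shift: "((\<lambda>t. F (t + w)) has_real_derivative F' (t + w)) (at t)"
    if "\<And>t. (F has_real_derivative F' t) (at t)" for F F' and t :: real
    using that[of "t + w"] by (simp add: DERIV_shift)
  have d0: "(h has_real_derivative (G 0 (t + w) - G 0 t) / w) (at t)" for t
    unfolding h_def by (rule DERIV_cdivide[OF DERIV_diff[OF shift[OF H] H]])
  have "smooth_step w (Suc n) G'"
    unfolding smooth_step_def
  proof (intro conjI allI impI)
    fix m t assume m: "m < Suc n"
    show "(G' m has_real_derivative G' (Suc m) t) (at t)"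
    proof (cases m)
      case 0 have "G' 0 = h" "G' (Suc 0) t = (G 0 (t + w) - G 0 t) / w" by (auto simp: G'_def)
      then show ?thesis using d0[of t] 0 by simp
    next
      case (Suc k)
      then have Gk: "\<And>t. (G k has_real_derivative G (Suc k) t) (at t)" using m G1 by auto
      show ?thesis unfolding G'_def Suc nat.case
        by (rule DERIV_cdivide[OF DERIV_diff[OF shift[OF Gk] Gk]])
    qed
  next
    fix m t assume m: "m \<le> Suc n"
    show "\<bar>G' m t\<bar> \<le> (2 / w) ^ m"
    proof (cases m)
      case 0
      then show ?thesis using mvt[of t] G5 by (auto simp: G'_def)
    next
      case (Suc k)
      then have "\<bar>G k (t + w) - G k t\<bar> \<le> (2 / w) ^ k + (2 / w) ^ k"
        using m G2[of k t] G2[of k "t + w"] by linarith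
      then have "\<bar>G k (t + w) - G k t\<bar> / w \<le> ((2 / w) ^ k + (2 / w) ^ k) / w"
        using w by (intro divide_right_mono) auto
      then show ?thesis using w Suc by (simp add: G'_def)
    qed
  next
    fix m t assume m: "m \<le> Suc n" and t: "t \<ge> (3::real)"
    show "G' m t = 0"
    proof (cases m)
      case 0
      obtain z where "z > t" "h t = G 0 z" using mvt[of t] by auto
      then show ?thesis using 0 t G3[of 0 z] by (simp add: G'_def)
    next
      case (Suc k)
      then show ?thesis using m t w G3[of k t] G3[of k "t + w"] by (simp add: G'_def)
    qed
  next
    fix t assume t: "t \<le> 2 - real (Suc n) * w"
    obtain z where z: "z < t + w" "h t = G 0 z" using mvt[of t] by auto
    then have "z \<le> 2 - real n * w" using t by (simp add: algebra_simps)
    then show "G' 0 t = 1" using z G4 by (simp add: G'_def)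
  next
    fix t show "0 \<le> G' 0 t" "G' 0 t \<le> 1" using mvt[of t] G5 by (auto simp: G'_def)
  next
    have "continuous_on UNIV h"
      using d0 by (auto intro!: DERIV_continuous_on intro: has_field_derivative_at_within)
    then show "continuous_on UNIV (G' 0)" by (simp add: G'_def[abs_def])
  qed
  then show ?case by blast
qed

section \<open>Periodization\<close>

definition wrap :: "nat \<Rightarrow> real \<Rightarrow> (nat \<Rightarrow> real) \<Rightarrow> nat \<Rightarrow> real" where
  "wrap d L x = (\<lambda>i. if i < d then x i - L * of_int (round (x i / L)) else x i)"

text \<open>\<open>wrap\<close> jumps where a coordinate crosses an odd multiple of
  \<open>L / 2\<close>, but \<open>round\<close> centres the cell at the origin, so such points are
  far from the support. Half of the gap between \<open>s\<close> and \<open>L / 2\<close> is a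
  margin: within it both sides evaluate \<open>f\<close> outside the ball of radius
  \<open>s\<close>, hence both vanish.\<close>

lemma wrap_locally:
  assumes van: "\<And>x. s < enorm d x \<Longrightarrow> f x = 0" and s: "0 < s" "2 * s < L"
  shows "eventually (\<lambda>r. f (wrap d L (along x v r)) = f (along (wrap d L x) v r)) (nhds 0)"
proof -
  define \<delta> where "\<delta> = (L / 2 - s) / 2"
  have \<delta>: "0 < \<delta>" and L: "0 < L" using s by (auto simp: \<delta>_def)
  have "eventually (\<lambda>r. \<forall>i\<in>{..<d}. \<bar>r * v i\<bar> < \<delta>) (nhds 0)"
  proof (rule eventually_ball_finite)
    show "\<forall>i\<in>{..<d}. eventually (\<lambda>r. \<bar>r * v i\<bar> < \<delta>) (nhds 0)"
    proof
      fix i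
      have "((\<lambda>r. \<bar>r * v i\<bar>) \<longlongrightarrow> \<bar>0 * v i\<bar>) (nhds 0)"
        by (intro tendsto_intros filterlim_ident)
      then show "eventually (\<lambda>r. \<bar>r * v i\<bar> < \<delta>) (nhds 0)"
        using \<delta> by (intro order_tendstoD) auto
    qed
  qed simp
  then show ?thesis
  proof eventually_elim
    case (elim r)
    define y where "y = along x v r"
    have yx: "\<bar>y i - x i\<bar> < \<delta>" if "i < d" for i using elim that by (simp add: y_def along_def)
    show ?case
    proof (cases "\<forall>i<d. round (y i / L) = round (x i / L)")
      case True
      then have "wrap d L y = along (wrap d L x) v r"
        unfolding wrap_def along_def y_def fun_eq_iff by auto
      then show ?thesis by (simp add: y_def)
    next
      case False
      then obtain i where i: "i < d" "round (y i / L) \<noteq> round (x i / L)" by auto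
      have r1: "\<bar>x i / L - of_int (round (x i / L))\<bar> \<le> 1/2" for i
        using of_int_round_abs_le[of "x i / L"] by linarith
      have "\<not> \<bar>y i / L - of_int (round (x i / L))\<bar> < 1/2"
        using round_unique'[of "y i / L" "round (x i / L)"] i by auto
      then have "1/2 * L \<le> \<bar>y i / L - of_int (round (x i / L))\<bar> * L"
        using L by (intro mult_right_mono) auto
      also have "\<dots> = \<bar>(y i / L - of_int (round (x i / L))) * L\<bar>" using L by (simp add: abs_mult)
      also have "(y i / L - of_int (round (x i / L))) * L = along (wrap d L x) v r i"
        using i L by (simp add: y_def along_def wrap_def field_simps)
      finally have "s < enorm d (along (wrap d L x) v r)"
        using abs_le_enorm[OF i(1), of "along (wrap d L x) v r"] s by linarith
      moreover have "s < enorm d (wrap d L y)"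
      proof -
        have "\<bar>y i / L - x i / L\<bar> < \<delta> / L"
          using yx[OF i(1)] L by (simp add: diff_divide_distrib[symmetric] divide_strict_right_mono)
        moreover have "\<bar>real_of_int (round (y i / L)) - of_int (round (x i / L))\<bar> \<ge> 1"
          using i(2) by linarith
        ultimately have "1/2 - \<delta> / L \<le> \<bar>y i / L - of_int (round (y i / L))\<bar>"
          using r1[of i] by linarith
        then have "(1/2 - \<delta> / L) * L \<le> \<bar>y i / L - of_int (round (y i / L))\<bar> * L"
          using L by (intro mult_right_mono) auto
        also have "\<dots> = \<bar>(y i / L - of_int (round (y i / L))) * L\<bar>" using L by (simp add: abs_mult)
        also have "(y i / L - of_int (round (y i / L))) * L = wrap d L y i"
          using i L by (simp add: wrap_def field_simps)
        finally have "L / 2 - \<delta> \<le> \<bar>wrap d L y i\<bar>" using L by (simp add: algebra_simps)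
        then show ?thesis
          using abs_le_enorm[OF i(1), of "wrap d L y"] s \<delta>_def by (simp add: field_simps)
      qed
      ultimately show ?thesis using van by (simp add: y_def)
    qed
  qed
qed

text \<open>Vanishing is asked of the bounds \<open>a\<close>, not merely of \<open>f\<close>, so
  that it passes to the derivatives in the induction and \<open>wrap_locally\<close> applies to each
  of them.\<close>

lemma dbound_wrap:
  fixes s L :: real and a :: "nat \<Rightarrow> (nat \<Rightarrow> real) \<Rightarrow> real"
  assumes "dbound d n a f" and "\<forall>j\<le>n. \<forall>x. s < enorm d x \<longrightarrow> a j x = 0" and s: "0 < s" "2 * s < L"
  shows "dbound d n (\<lambda>j x. a j (wrap d L x)) (\<lambda>x. f (wrap d L x))"
  using assms(1,2)
proof (induction n arbitrary: a f)
  case 0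
  have "\<bar>f (wrap d L x)\<bar> \<le> a 0 (wrap d L x)" for x
    using dbound_abs_le[OF "0.prems"(1)] .
  then show ?case by simp
next
  case (Suc n)
  have van: "f x = 0" if "s < enorm d x" for x
    using dbound_abs_le[OF Suc.prems(1), of x] Suc.prems(2) that by auto
  show ?case unfolding dbound.simps
  proof (intro conjI allI)
    fix v
    obtain g where g: "\<forall>x. ((\<lambda>s. f (along x v s)) has_real_derivative g x) (at 0)"
      "dbound d n (\<lambda>j x. enorm d v * a (Suc j) x) g"
      using dbound_SucD[OF Suc.prems(1), of v] by blast
    have "dbound d n (\<lambda>j x. enorm d v * a (Suc j) (wrap d L x)) (\<lambda>x. g (wrap d L x))"
    proof (rule Suc.IH[OF g(2)])
      show "\<forall>j\<le>n. \<forall>x. s < enorm d x \<longrightarrow> enorm d v * a (Suc j) x = 0"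
        using Suc.prems(2) by auto
    qed
    moreover have "((\<lambda>r. f (wrap d L (along x v r))) has_real_derivative g (wrap d L x)) (at 0)" for x
    proof -
      have ev: "eventually (\<lambda>r. f (wrap d L (along x v r)) = f (along (wrap d L x) v r)) (nhds 0)"
        by (rule wrap_locally[where s = s and f = f, OF van s])
      show ?thesis by (subst DERIV_cong_ev[OF refl ev refl]) (use g(1) in blast)
    qed
    ultimately show "\<exists>g. (\<forall>x. ((\<lambda>r. f (wrap d L (along x v r))) has_real_derivative g x) (at 0)) \<and>
        dbound d n (\<lambda>j x. enorm d v * a (Suc j) (wrap d L x)) g"
      by (intro exI[of _ "\<lambda>x. g (wrap d L x)"]) simp
  qed (rule dbound_abs_le[OF Suc.prems(1)])
qed

section \<open>Iterated differences and the residual of a convolution\<close>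

primrec fdiff :: "(nat \<Rightarrow> real) list \<Rightarrow> ((nat \<Rightarrow> real) \<Rightarrow> real) \<Rightarrow> (nat \<Rightarrow> real) \<Rightarrow> real" where
  "fdiff [] f x = f x"
| "fdiff (t # ts) f x = fdiff ts f (along x t 1) - fdiff ts f x"

lemma along_commute: "along (along x u r) v s = along (along x v s) u r"
  by (simp add: along_def fun_eq_iff)

lemma fdiff_shift: "fdiff ts (\<lambda>x. f (along x v r)) x = fdiff ts f (along x v r)"
  by (induction ts arbitrary: x) (simp_all add: along_commute)

lemma fdiff_diff: "fdiff ts (\<lambda>x. f x - g x) x = fdiff ts f x - fdiff ts g x"
  by (induction ts arbitrary: x) simp_all

lemma fdiff_sum: "fdiff ts (\<lambda>x. \<Sum>t\<in>S. c t * h t x) x = (\<Sum>t\<in>S. c t * fdiff ts (h t) x)"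
  by (induction ts arbitrary: x) (simp_all add: sum_subtractf right_diff_distrib)

lemma DERIV_fdiff:
  assumes "\<And>x. ((\<lambda>s. f (along x v s)) has_real_derivative g x) (at 0)"
  shows "((\<lambda>s. fdiff ts f (along x v s)) has_real_derivative fdiff ts g x) (at 0)"
proof (induction ts arbitrary: x)
  case (Cons t ts)
  show ?case using DERIV_diff[OF Cons[of "along x t 1"] Cons[of x]]
    by (simp add: along_commute[of x v _ t 1])
qed (simp add: assms)

text \<open>By the mean value theorem each difference is a derivative along its step at an
  intermediate point. Derivative and remaining differences commute, so every step uses up one order
  of \<open>dbound\<close> and contributes its length, without any combinatorial constant.\<close>

lemma fdiff_bound:
  assumes "dbound d (length ts) a f" and "\<And>x. a (length ts) x \<le> A"
  shows "\<bar>fdiff ts f x\<bar> \<le> A * prod_list (map (enorm d) ts)"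
  using assms
proof (induction ts arbitrary: a f A x)
  case Nil
  then show ?case by (auto intro: order_trans)
next
  case (Cons t ts)
  have c: "dbound d (Suc (length ts)) a f"
    using Cons.prems(1) by (simp only: length_Cons)
  obtain g where g: "\<forall>x. ((\<lambda>s. f (along x t s)) has_real_derivative g x) (at 0)"
    "dbound d (length ts) (\<lambda>j x. enorm d t * a (Suc j) x) g"
    using dbound_SucD[OF c, of t] by blast
  have b: "\<bar>fdiff ts g x\<bar> \<le> enorm d t * A * prod_list (map (enorm d) ts)" for x
    using Cons.prems(2) by (intro Cons.IH[OF g(2)]) (auto intro!: mult_left_mono)
  have D: "((\<lambda>s. fdiff ts f (along x t s)) has_real_derivative fdiff ts g (along x t s)) (at s)" for s
  proof -
    have "((\<lambda>s. fdiff ts f (along x t s)) has_real_derivative fdiff ts g x) (at 0)" for x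
      by (rule DERIV_fdiff) (use g(1) in blast)
    then show ?thesis by (rule DERIV_along)
  qed
  obtain z where "fdiff ts f (along x t 1) - fdiff ts f (along x t 0) = (1 - 0) * fdiff ts g (along x t z)"
    using MVT2[of 0 1 "\<lambda>s. fdiff ts f (along x t s)" "\<lambda>s. fdiff ts g (along x t s)"] D by auto
  then show ?case using b[of "along x t z"] by (simp add: mult_ac)
qed

text \<open>For weights of total mass 1 this is the identity minus convolution with the weights. It
  is written as a sum of backward differences so that its powers are controlled by iterated
  differences.\<close>

definition residual_op :: "'t set \<Rightarrow> ('t \<Rightarrow> real) \<Rightarrow> ('t \<Rightarrow> nat \<Rightarrow> real) \<Rightarrow>
    ((nat \<Rightarrow> real) \<Rightarrow> real) \<Rightarrow> (nat \<Rightarrow> real) \<Rightarrow> real" where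
  "residual_op S K \<tau> f x = (\<Sum>t\<in>S. K t * (f x - f (along x (\<tau> t) (-1))))"

text \<open>One application turns the hypothesis on differences of order \<open>n + 1\<close> of
  \<open>f\<close> into that of order \<open>n\<close> for the image, with \<open>A\<close>
  multiplied by the first moment of the weights. Hence the induction generalizes over
  \<open>f\<close> and \<open>A\<close>.\<close>

lemma residual_op_pow_bound:
  assumes K: "\<And>t. t \<in> S \<Longrightarrow> 0 \<le> K t"
    and f: "\<And>ts x. length ts = n \<Longrightarrow> \<bar>fdiff ts f x\<bar> \<le> A * prod_list (map (enorm d) ts)"
  shows "\<bar>(residual_op S K \<tau> ^^ n) f x\<bar> \<le> A * (\<Sum>t\<in>S. K t * enorm d (\<tau> t)) ^ n"
  using f
proof (induction n arbitrary: f A)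
  case 0
  show ?case using 0[of "[]" x] by simp
next
  case (Suc n)
  have "\<bar>fdiff ts (residual_op S K \<tau> f) x\<bar>
      \<le> (A * (\<Sum>t\<in>S. K t * enorm d (\<tau> t))) * prod_list (map (enorm d) ts)"
    if "length ts = n" for ts x
  proof -
    have n: "enorm d (\<lambda>i. - \<tau> t i) = enorm d (\<tau> t)" for t
      using enorm_scale[of d "-1" "\<tau> t"] by simp
    have a: "along x (\<tau> t) (-1) = along x (\<lambda>i. - \<tau> t i) 1" for x t
      by (simp add: along_def)
    have "fdiff ts (residual_op S K \<tau> f) x = (\<Sum>t\<in>S. K t * - fdiff ((\<lambda>i. - \<tau> t i) # ts) f x)"
      unfolding residual_op_def by (simp add: fdiff_sum fdiff_diff fdiff_shift a)
    also have "\<bar>\<dots>\<bar> \<le> (\<Sum>t\<in>S. K t * (A * (enorm d (\<tau> t) * prod_list (map (enorm d) ts))))"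
    proof (rule order_trans[OF sum_abs sum_mono])
      fix t assume t: "t \<in> S"
      have "\<bar>fdiff ((\<lambda>i. - \<tau> t i) # ts) f x\<bar> \<le> A * (enorm d (\<tau> t) * prod_list (map (enorm d) ts))"
        using Suc.prems[of "(\<lambda>i. - \<tau> t i) # ts" x] that by (simp add: n)
      then have "K t * \<bar>fdiff ((\<lambda>i. - \<tau> t i) # ts) f x\<bar> \<le>
          K t * (A * (enorm d (\<tau> t) * prod_list (map (enorm d) ts)))"
        using K[OF t] by (rule mult_left_mono)
      moreover have "\<bar>K t * - fdiff ((\<lambda>i. - \<tau> t i) # ts) f x\<bar> =
          K t * \<bar>fdiff ((\<lambda>i. - \<tau> t i) # ts) f x\<bar>"
        using K[OF t] by (metis abs_mult abs_minus_cancel abs_of_nonneg)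
      ultimately show "\<bar>K t * - fdiff ((\<lambda>i. - \<tau> t i) # ts) f x\<bar> \<le>
          K t * (A * (enorm d (\<tau> t) * prod_list (map (enorm d) ts)))" by linarith
    qed
    also have "\<dots> = (A * (\<Sum>t\<in>S. K t * enorm d (\<tau> t))) * prod_list (map (enorm d) ts)"
    proof -
      have "(\<Sum>t\<in>S. K t * (A * (enorm d (\<tau> t) * prod_list (map (enorm d) ts)))) =
          (\<Sum>t\<in>S. K t * enorm d (\<tau> t) * (A * prod_list (map (enorm d) ts)))"
        by (intro sum.cong refl) (simp only: mult_ac)
      also have "\<dots> = (\<Sum>t\<in>S. K t * enorm d (\<tau> t)) * (A * prod_list (map (enorm d) ts))"
        by (rule sum_distrib_right[symmetric])
      also have "\<dots> = A * (\<Sum>t\<in>S. K t * enorm d (\<tau> t)) * prod_list (map (enorm d) ts)"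
        by (rule mult.left_commute[THEN trans]) (rule mult.assoc[symmetric])
      finally show ?thesis .
    qed
    finally show ?thesis .
  qed
  from Suc.IH[OF this] have "\<bar>(residual_op S K \<tau> ^^ n) (residual_op S K \<tau> f) x\<bar> \<le>
      A * (\<Sum>t\<in>S. K t * enorm d (\<tau> t)) * (\<Sum>t\<in>S. K t * enorm d (\<tau> t)) ^ n" .
  then show ?case by (simp only: funpow_Suc_right o_apply power_Suc mult.assoc)
qed

section \<open>Finite Fourier transform\<close>

text \<open>Jordan's inequality, from the concavity of the sine on this interval.\<close>

lemma sin_ge_chord:
  assumes "0 \<le> x" "x \<le> pi / 2"
  shows "2 * x / pi \<le> sin x"
proof -
  have "convex_on {0..pi/2} (\<lambda>x. - sin x)"
  proof (rule f''_ge0_imp_convex)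
    fix x :: real assume "x \<in> {0..pi/2}"
    then show "((\<lambda>x. - sin x) has_real_derivative - cos x) (at x)"
      "((\<lambda>x. - cos x) has_real_derivative sin x) (at x)" "0 \<le> sin x"
      using pi_gt_zero by (auto intro!: derivative_eq_intros sin_ge_zero)
  qed simp
  from convex_onD[OF this, of "2 * x / pi" 0 "pi / 2"] show ?thesis
    using assms pi_gt_zero by (simp add: field_simps)
qed

lemma abs_sin_ge_chord:
  assumes "\<bar>x\<bar> \<le> pi / 2"
  shows "2 * \<bar>x\<bar> / pi \<le> \<bar>sin x\<bar>"
proof (cases "0 \<le> x")
  case True
  then show ?thesis using sin_ge_chord[of x] assms by simp
next
  case False
  then show ?thesis using sin_ge_chord[of "-x"] assms by simp
qed

lemma cos_half_angle: "1 - cos x = 2 * (sin (x / 2))\<^sup>2" for x :: real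
  using cos_double_sin[of "x / 2"] by simp

lemma norm_cis_minus_1: "norm (cis x - 1) = 2 * \<bar>sin (x / 2)\<bar>"
proof -
  have "(norm (cis x - 1))\<^sup>2 = (cos x - 1)\<^sup>2 + (sin x)\<^sup>2"
    by (simp add: cmod_power2)
  also have "\<dots> = 2 * (1 - cos x)"
    using sin_cos_squared_add[of x] by (simp add: power2_diff)
  also have "\<dots> = (2 * \<bar>sin (x / 2)\<bar>)\<^sup>2"
    by (simp add: cos_half_angle power_mult_distrib)
  finally show ?thesis by (rule power2_eq_imp_eq) auto
qed

lemma norm_cis_minus_1_ge:
  assumes "\<bar>x\<bar> \<le> pi"
  shows "2 * \<bar>x\<bar> / pi \<le> norm (cis x - 1)"
  using abs_sin_ge_chord[of "x / 2"] assms by (simp add: norm_cis_minus_1 field_simps)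

lemma one_minus_cos_ge:
  assumes "\<bar>x\<bar> \<le> pi"
  shows "2 * x\<^sup>2 / pi\<^sup>2 \<le> 1 - cos x"
proof -
  have "(2 * \<bar>x / 2\<bar> / pi)\<^sup>2 \<le> \<bar>sin (x / 2)\<bar>\<^sup>2"
    using abs_sin_ge_chord[of "x / 2"] assms by (intro power_mono) auto
  then show ?thesis by (simp add: cos_half_angle power_divide)
qed

lemma one_minus_cos_le: "1 - cos x \<le> x\<^sup>2 / 2" for x :: real
proof -
  have "(sin (x / 2))\<^sup>2 \<le> (x / 2)\<^sup>2"
    by (rule abs_le_square_iff[THEN iffD1, OF abs_sin_x_le_abs_x])
  then show ?thesis by (simp add: cos_half_angle power_divide)
qed

text \<open>Powers of the primitive root of unity of order \<open>2 * m\<close>. The even order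
  allows representatives \<open>- m, ..., m - 1\<close>, so that the phases stay within
  \<open>[- pi, pi]\<close>, where the chord bounds hold.\<close>

definition rou :: "nat \<Rightarrow> int \<Rightarrow> complex" where
  "rou m \<kappa> = cis (2 * pi * of_int \<kappa> / real (2 * m))"

lemma rou_add: "rou m (a + b) = rou m a * rou m b"
  by (simp add: rou_def cis_mult add_divide_distrib algebra_simps)

lemma rou_0 [simp]: "rou m 0 = 1"
  by (simp add: rou_def)

lemma cnj_rou: "cnj (rou m a) = rou m (- a)"
  by (simp add: rou_def cis_cnj)

lemma norm_rou [simp]: "norm (rou m a) = 1"
  by (simp add: rou_def)

lemma rou_eq_1_iff:
  assumes "m > 0"
  shows "rou m a = 1 \<longleftrightarrow> 2 * int m dvd a"
proof
  assume "2 * int m dvd a"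
  then obtain n where "a = 2 * int m * n" by auto
  then have "2 * pi * of_int a / real (2 * m) = 2 * pi * of_int n"
    using assms by simp
  then show "rou m a = 1" by (simp only: rou_def cis_multiple_2pi Ints_of_int)
next
  assume "rou m a = 1"
  then have "cos (2 * pi * of_int a / real (2 * m)) = 1"
    by (simp add: rou_def complex_eq_iff)
  then obtain n :: int where "2 * pi * of_int a / real (2 * m) = of_int n * 2 * pi"
    using cos_one_2pi_int by blast
  then have "real_of_int a = of_int (n * (2 * int m))"
    using assms by (simp add: field_simps)
  then have "a = n * (2 * int m)" by (simp only: of_int_eq_iff)
  then show "2 * int m dvd a" by simp
qed

lemma rou_mult_nat: "rou m (int r * a) = rou m a ^ r"
  by (induction r) (simp_all add: rou_add distrib_right)

abbreviation "residues_set m \<equiv> {- int m ..< int m}"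

text \<open>After a shift of the summation range the sum is geometric with ratio
  \<open>rou m \<kappa>\<close>, a root of unity of order dividing \<open>2 * m\<close>.\<close>

lemma sum_rou:
  assumes m: "m > 0"
  shows "(\<Sum>s\<in>residues_set m. rou m (\<kappa> * s)) = (if 2 * int m dvd \<kappa> then of_nat (2 * m) else 0)"
proof -
  have "bij_betw (\<lambda>r. int r - int m) {..<2*m} (residues_set m)"
    by (rule bij_betwI[where g = "\<lambda>s. nat (s + int m)"]) auto
  then have "(\<Sum>s\<in>residues_set m. rou m (\<kappa> * s)) = (\<Sum>r<2*m. rou m (\<kappa> * (int r - int m)))"
    by (simp add: sum.reindex_bij_betw[symmetric])
  also have "\<dots> = (\<Sum>r<2*m. rou m \<kappa> ^ r * rou m (- \<kappa> * int m))"
  proof (rule sum.cong[OF refl])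
    fix r
    have "\<kappa> * (int r - int m) = int r * \<kappa> + (- \<kappa> * int m)" by (simp add: algebra_simps)
    then show "rou m (\<kappa> * (int r - int m)) = rou m \<kappa> ^ r * rou m (- \<kappa> * int m)"
      by (simp only: rou_add rou_mult_nat)
  qed
  also have "\<dots> = (\<Sum>r<2*m. rou m \<kappa> ^ r) * rou m (- \<kappa> * int m)"
    by (simp add: sum_distrib_right)
  also have "\<dots> = (if 2 * int m dvd \<kappa> then of_nat (2 * m) else 0)"
  proof (cases "2 * int m dvd \<kappa>")
    case True
    moreover have "rou m (- \<kappa> * int m) = 1"
      using True m by (subst rou_eq_1_iff) auto
    ultimately show ?thesis using rou_eq_1_iff[OF m, of \<kappa>] by simp
  next
    case False
    then have "rou m \<kappa> \<noteq> 1" using rou_eq_1_iff[OF m] by simp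
    moreover have "rou m \<kappa> ^ (2 * m) = 1"
      using rou_mult_nat[of m "2 * m" \<kappa>] rou_eq_1_iff[OF m, of "int (2 * m) * \<kappa>"] by simp
    ultimately show ?thesis using False by (simp add: geometric_sum)
  qed
  finally show ?thesis .
qed

section \<open>Characters of the discrete torus\<close>

definition character :: "nat \<Rightarrow> nat \<Rightarrow> (nat \<Rightarrow> int) \<Rightarrow> (nat \<Rightarrow> int) \<Rightarrow> complex" where
  "character d m k z = (\<Prod>i<d. rou m (k i * z i))"

definition zbox :: "nat \<Rightarrow> nat \<Rightarrow> (nat \<Rightarrow> int) set" where
  "zbox d m = PiE {..<d} (\<lambda>_. residues_set m)"

lemma finite_zbox [simp]: "finite (zbox d m)"
  unfolding zbox_def by (intro finite_PiE) auto

lemma card_zbox: "card (zbox d m) = (2 * m) ^ d"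
  unfolding zbox_def by (subst card_PiE) (auto simp: nat_mult_distrib)

lemma character_add: "character d m k (\<lambda>i. x i + y i) = character d m k x * character d m k y"
  by (simp add: character_def distrib_left rou_add prod.distrib)

lemma character_commute: "character d m k z = character d m z k"
  by (simp add: character_def mult.commute)

lemma cnj_character: "cnj (character d m k z) = character d m k (\<lambda>i. - z i)"
  by (simp add: character_def cnj_rou)

lemma norm_character [simp]: "norm (character d m k z) = 1"
  by (simp add: character_def prod_norm[symmetric])

lemma sum_character:
  assumes m: "m > 0"
  shows "(\<Sum>k\<in>zbox d m. character d m k z) =
    (if \<forall>i<d. 2 * int m dvd z i then of_nat ((2 * m) ^ d) else 0)"
proof -
  have "(\<Sum>k\<in>zbox d m. character d m k z) = (\<Prod>i<d. \<Sum>\<kappa>\<in>residues_set m. rou m (z i * \<kappa>))"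
    unfolding zbox_def character_def by (subst prod_sum_PiE) (auto simp: mult.commute)
  also have "\<dots> = (\<Prod>i<d. if 2 * int m dvd z i then of_nat (2 * m) else 0)"
    by (simp only: sum_rou[OF m])
  also have "\<dots> = (if \<forall>i<d. 2 * int m dvd z i then of_nat ((2 * m) ^ d) else 0)"
    by auto
  finally show ?thesis .
qed

lemma residues_eq: "a \<in> residues_set m \<Longrightarrow> b \<in> residues_set m \<Longrightarrow> 2 * int m dvd a - b \<Longrightarrow> a = b"
proof -
  assume "a \<in> residues_set m" "b \<in> residues_set m" and d: "2 * int m dvd a - b"
  then have "\<bar>a - b\<bar> < 2 * int m" by auto
  with d have "a - b = 0" using dvd_imp_le_int[of "a - b" "2 * int m"] by linarith
  then show ?thesis by simp
qed

lemma zbox_eq: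
  assumes "x \<in> zbox d m" "y \<in> zbox d m" "\<forall>i<d. 2 * int m dvd x i - y i"
  shows "x = y"
proof -
  have "x i = y i" if "i < d" for i
    using assms that by (intro residues_eq[of _ m]) (auto simp: zbox_def PiE_iff)
  then show ?thesis using assms unfolding zbox_def by (intro PiE_ext) auto
qed

definition reduce :: "nat \<Rightarrow> nat \<Rightarrow> (nat \<Rightarrow> int) \<Rightarrow> nat \<Rightarrow> int" where
  "reduce d m z = (\<lambda>i\<in>{..<d}. (z i + int m) mod (2 * int m) - int m)"

lemma reduce_in_zbox: "m > 0 \<Longrightarrow> reduce d m z \<in> zbox d m"
  by (auto simp: reduce_def zbox_def)

lemma reduce_cong: "i < d \<Longrightarrow> 2 * int m dvd z i - reduce d m z i"
proof -
  assume "i < d"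
  then have "z i - reduce d m z i = (z i + int m) - (z i + int m) mod (2 * int m)"
    by (simp add: reduce_def)
  then show ?thesis by (metis dvd_minus_mod)
qed

section \<open>Inversion and Parseval's identity\<close>

definition dft :: "nat \<Rightarrow> nat \<Rightarrow> ((nat \<Rightarrow> int) \<Rightarrow> complex) \<Rightarrow> (nat \<Rightarrow> int) \<Rightarrow> complex" where
  "dft d m F k = (\<Sum>y\<in>zbox d m. F y * character d m k (\<lambda>i. - y i)) / of_nat ((2 * m) ^ d)"

lemma dft_inversion:
  assumes m: "m > 0" and per: "\<And>z z'. (\<forall>i<d. 2 * int m dvd z i - z' i) \<Longrightarrow> F z = F z'"
  shows "F z = (\<Sum>k\<in>zbox d m. dft d m F k * character d m k z)"
proof -
  have eq: "character d m k (\<lambda>i. - y i) * character d m k z = character d m k (\<lambda>i. z i - y i)" for k y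
    using character_add[of d m k "\<lambda>i. - y i" z] by (simp add: add.commute)
  have "(\<Sum>k\<in>zbox d m. dft d m F k * character d m k z) =
      (\<Sum>k\<in>zbox d m. \<Sum>y\<in>zbox d m. F y * character d m k (\<lambda>i. z i - y i)) / of_nat ((2 * m) ^ d)"
    unfolding dft_def by (simp add: sum_divide_distrib sum_distrib_right mult.assoc eq)
  also have "(\<Sum>k\<in>zbox d m. \<Sum>y\<in>zbox d m. F y * character d m k (\<lambda>i. z i - y i)) =
      (\<Sum>y\<in>zbox d m. F y * (\<Sum>k\<in>zbox d m. character d m k (\<lambda>i. z i - y i)))"
    by (subst sum.swap) (simp add: sum_distrib_left)
  also have "\<dots> = (\<Sum>y\<in>zbox d m. if y = reduce d m z then F z * of_nat ((2 * m) ^ d) else 0)"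
  proof (rule sum.cong[OF refl])
    fix y assume y: "y \<in> zbox d m"
    have red: "\<forall>i<d. 2 * int m dvd z i - reduce d m z i" using reduce_cong by simp
    show "F y * (\<Sum>k\<in>zbox d m. character d m k (\<lambda>i. z i - y i)) =
        (if y = reduce d m z then F z * of_nat ((2 * m) ^ d) else 0)"
    proof (cases "\<forall>i<d. 2 * int m dvd z i - y i")
      case True
      have "\<forall>i<d. 2 * int m dvd y i - reduce d m z i"
      proof (intro allI impI)
        fix i assume i: "i < d"
        have "2 * int m dvd (z i - reduce d m z i) - (z i - y i)"
          by (rule dvd_diff) (use True red i in blast)+
        then show "2 * int m dvd y i - reduce d m z i" by (simp add: algebra_simps)
      qed
      then have "y = reduce d m z" by (rule zbox_eq[OF y reduce_in_zbox[OF m]])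
      moreover have "F z = F y" by (rule per[OF True])
      ultimately show ?thesis using True by (simp add: sum_character[OF m])
    next
      case False
      have "y \<noteq> reduce d m z"
      proof
        assume "y = reduce d m z"
        then show False using False red by simp
      qed
      then show ?thesis using False by (auto simp: sum_character[OF m])
    qed
  qed
  also have "\<dots> = F z * of_nat ((2 * m) ^ d)"
    using reduce_in_zbox[OF m] by (simp add: sum.delta)
  finally show ?thesis using m by simp
qed

lemma dft_parseval:
  assumes m: "m > 0"
  shows "(\<Sum>z\<in>zbox d m. (norm (\<Sum>k\<in>zbox d m. b k * character d m k z))\<^sup>2) =
    real ((2 * m) ^ d) * (\<Sum>k\<in>zbox d m. (norm (b k))\<^sup>2)"
proof -
  have "complex_of_real (\<Sum>z\<in>zbox d m. (norm (\<Sum>k\<in>zbox d m. b k * character d m k z))\<^sup>2) =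
      (\<Sum>z\<in>zbox d m. \<Sum>k\<in>zbox d m. \<Sum>l\<in>zbox d m. b k * cnj (b l) * character d m z (\<lambda>i. k i - l i))"
    unfolding of_real_sum complex_norm_square
  proof (rule sum.cong[OF refl])
    fix z
    have "character d m k z * cnj (character d m l z) = character d m z (\<lambda>i. k i - l i)" for k l
      using character_add[of d m z k "\<lambda>i. - l i"] cnj_character[of d m z l]
      by (simp add: character_commute)
    then show "(\<Sum>k\<in>zbox d m. b k * character d m k z) * cnj (\<Sum>k\<in>zbox d m. b k * character d m k z) =
        (\<Sum>k\<in>zbox d m. \<Sum>l\<in>zbox d m. b k * cnj (b l) * character d m z (\<lambda>i. k i - l i))"
      unfolding cnj_sum sum_product by (intro sum.cong refl) (simp add: mult_ac)
  qed
  also have "\<dots> = (\<Sum>k\<in>zbox d m. \<Sum>z\<in>zbox d m. \<Sum>l\<in>zbox d m. b k * cnj (b l) * character d m z (\<lambda>i. k i - l i))"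
    by (rule sum.swap)
  also have "\<dots> = (\<Sum>k\<in>zbox d m. \<Sum>l\<in>zbox d m. b k * cnj (b l) *
      (\<Sum>z\<in>zbox d m. character d m z (\<lambda>i. k i - l i)))"
    by (rule sum.cong[OF refl], subst sum.swap) (simp add: sum_distrib_left)
  also have "\<dots> = (\<Sum>k\<in>zbox d m. \<Sum>l\<in>zbox d m. if l = k then b k * cnj (b k) * of_nat ((2 * m) ^ d) else 0)"
  proof (rule sum.cong[OF refl], rule sum.cong[OF refl])
    fix k l assume "k \<in> zbox d m" "l \<in> zbox d m"
    then have "(\<forall>i<d. 2 * int m dvd k i - l i) \<longleftrightarrow> l = k" using zbox_eq by auto
    then show "b k * cnj (b l) * (\<Sum>z\<in>zbox d m. character d m z (\<lambda>i. k i - l i)) =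
        (if l = k then b k * cnj (b k) * of_nat ((2 * m) ^ d) else 0)"
      by (simp add: sum_character[OF m])
  qed
  also have "\<dots> = complex_of_real (real ((2 * m) ^ d) * (\<Sum>k\<in>zbox d m. (norm (b k))\<^sup>2))"
    unfolding of_real_mult of_real_sum complex_norm_square
    by (simp add: sum.delta sum_distrib_left mult.commute)
  finally show ?thesis by (simp only: of_real_eq_iff)
qed

section \<open>Jackson approximation on a lattice\<close>

text \<open>
  With these coefficients the first Fourier coefficient of the kernel is \<open>cos (\<pi> / (n + 1))\<close>, so its second
  moment is of order \<open>n\<^sup>-\<^sup>2\<close>; for the Fejer kernel it is only of order \<open>1 / n\<close>.
\<close>

definition jcoef :: "nat \<Rightarrow> nat \<Rightarrow> real" where
  "jcoef n j = sin (real j * pi / real (n + 1))"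

definition jnorm :: "nat \<Rightarrow> real" where
  "jnorm n = (\<Sum>j\<le>n. (jcoef n j)\<^sup>2)"

lemma jnorm_pos:
  assumes "n \<ge> 1"
  shows "jnorm n > 0"
proof -
  have "0 < jcoef n 1"
    unfolding jcoef_def using assms pi_gt_zero by (intro sin_gt_zero) (auto simp: field_simps)
  then have "0 < (jcoef n 1)\<^sup>2" by simp
  also have "\<dots> \<le> jnorm n"
    unfolding jnorm_def using assms by (intro member_le_sum) auto
  finally show ?thesis .
qed

text \<open>The coefficients form the eigenvector of a path graph for its largest eigenvalue:
  \<open>c j + c (j + 2) = 2 * cos (pi / (n + 1)) * c (j + 1)\<close>, with
  \<open>c 0 = c (n + 1) = 0\<close>. Multiplying by \<open>c (j + 1)\<close> and summing produces
  the autocorrelation twice, as the boundary terms vanish.\<close>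

lemma jcoef_autocorrelation:
  "(\<Sum>j<n. jcoef n j * jcoef n (Suc j)) = cos (pi / real (n + 1)) * jnorm n"
proof -
  let ?c = "jcoef n" and ?\<alpha> = "pi / real (n + 1)"
  have rec: "?c j * ?c (Suc j) + ?c (Suc j) * ?c (Suc (Suc j)) = 2 * cos ?\<alpha> * (?c (Suc j))\<^sup>2" for j
  proof -
    have "?c j + ?c (Suc (Suc j)) = 2 * cos ?\<alpha> * ?c (Suc j)"
    proof -
      have e: "real j * pi / real (n+1) = real (Suc j) * pi / real (n+1) - ?\<alpha>"
        "real (Suc (Suc j)) * pi / real (n+1) = real (Suc j) * pi / real (n+1) + ?\<alpha>"
        by (simp_all add: add_divide_distrib[symmetric] diff_divide_distrib[symmetric] algebra_simps)
      show ?thesis unfolding jcoef_def e sin_add sin_diff by simp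
    qed
    then have "?c (Suc j) * (?c j + ?c (Suc (Suc j))) = ?c (Suc j) * (2 * cos ?\<alpha> * ?c (Suc j))" by simp
    then show ?thesis by (simp add: algebra_simps power2_eq_square)
  qed
  have c0: "?c 0 = 0" and cn: "?c (Suc n) = 0"
    by (simp_all add: jcoef_def)
  have j: "jnorm n = (\<Sum>j<n. (?c (Suc j))\<^sup>2)"
    unfolding jnorm_def lessThan_Suc_atMost[symmetric] by (subst sum.lessThan_Suc_shift) (simp add: c0)
  have "2 * cos ?\<alpha> * jnorm n = (\<Sum>j<n. ?c j * ?c (Suc j)) + (\<Sum>j<n. ?c (Suc j) * ?c (Suc (Suc j)))"
    unfolding j sum_distrib_left sum.distrib[symmetric] rec ..
  also have "(\<Sum>j<n. ?c (Suc j) * ?c (Suc (Suc j))) = (\<Sum>j<Suc n. ?c j * ?c (Suc j))"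
    by (subst sum.lessThan_Suc_shift) (simp add: c0)
  also have "\<dots> = (\<Sum>j<n. ?c j * ?c (Suc j))" by (simp add: cn)
  finally show ?thesis by simp
qed

definition jpoly :: "nat \<Rightarrow> nat \<Rightarrow> int \<Rightarrow> complex" where
  "jpoly n m s = (\<Sum>j\<le>n. of_real (jcoef n j) * rou m (int j * s))"

text \<open>The squared modulus makes the kernel nonnegative and keeps its frequencies between
  \<open>- n\<close> and \<open>n\<close>. The denominator gives total mass 1 as soon as
  \<open>n < m\<close>.\<close>

definition jkernel :: "nat \<Rightarrow> nat \<Rightarrow> int \<Rightarrow> real" where
  "jkernel n m s = (norm (jpoly n m s))\<^sup>2 / (real (2 * m) * jnorm n)"

lemma jkernel_nonneg: "0 \<le> jkernel n m s"
  unfolding jkernel_def jnorm_def by (intro divide_nonneg_nonneg mult_nonneg_nonneg sum_nonneg) auto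

text \<open>Expanding the square, the sum over \<open>s\<close> keeps only the pairs with
  \<open>j - l + \<kappa>\<close> divisible by \<open>2 * m\<close>: the coefficients are
  autocorrelations of \<open>jcoef\<close> up to aliasing. The lemmas below exclude aliasing by
  \<open>|j - l + \<kappa>| < 2 * m\<close>.\<close>

lemma jkernel_fourier:
  assumes m: "m > 0" and n: "n \<ge> 1"
  shows "(\<Sum>s\<in>residues_set m. of_real (jkernel n m s) * rou m (\<kappa> * s)) =
    (\<Sum>j\<le>n. \<Sum>l\<le>n. if 2 * int m dvd int j - int l + \<kappa>
       then of_real (jcoef n j * jcoef n l) else 0) / of_real (jnorm n)"
proof -
  have "(\<Sum>s\<in>residues_set m. of_real ((norm (jpoly n m s))\<^sup>2) * rou m (\<kappa> * s)) =
     (\<Sum>s\<in>residues_set m. \<Sum>j\<le>n. \<Sum>l\<le>n. of_real (jcoef n j * jcoef n l) * rou m ((int j - int l + \<kappa>) * s))"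
  proof (rule sum.cong[OF refl])
    fix s
    have e: "rou m (int j * s) * cnj (rou m (int l * s)) * rou m (\<kappa> * s) = rou m ((int j - int l + \<kappa>) * s)" for j l
      by (simp add: cnj_rou rou_add[symmetric] algebra_simps)
    have "of_real ((norm (jpoly n m s))\<^sup>2) * rou m (\<kappa> * s) =
      (\<Sum>j\<le>n. \<Sum>l\<le>n. of_real (jcoef n j * jcoef n l) *
        (rou m (int j * s) * cnj (rou m (int l * s)) * rou m (\<kappa> * s)))"
      unfolding complex_norm_square jpoly_def cnj_sum sum_product
      unfolding sum_distrib_right
      by (intro sum.cong[OF refl]) simp
    then show "of_real ((norm (jpoly n m s))\<^sup>2) * rou m (\<kappa> * s) =
      (\<Sum>j\<le>n. \<Sum>l\<le>n. of_real (jcoef n j * jcoef n l) * rou m ((int j - int l + \<kappa>) * s))"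
      unfolding e .
  qed
  also have "\<dots> = (\<Sum>j\<le>n. \<Sum>s\<in>residues_set m. \<Sum>l\<le>n. of_real (jcoef n j * jcoef n l) * rou m ((int j - int l + \<kappa>) * s))"
    by (rule sum.swap)
  also have "\<dots> = (\<Sum>j\<le>n. \<Sum>l\<le>n. of_real (jcoef n j * jcoef n l) * (\<Sum>s\<in>residues_set m. rou m ((int j - int l + \<kappa>) * s)))"
    by (rule sum.cong[OF refl], subst sum.swap) (simp only: sum_distrib_left)
  also have "\<dots> = (\<Sum>j\<le>n. \<Sum>l\<le>n. (if 2 * int m dvd int j - int l + \<kappa>
       then of_real (jcoef n j * jcoef n l) else 0) * of_nat (2 * m))"
    unfolding sum_rou[OF m] by (intro sum.cong[OF refl]) simp
  also have "\<dots> = (\<Sum>j\<le>n. \<Sum>l\<le>n. if 2 * int m dvd int j - int l + \<kappa>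
       then of_real (jcoef n j * jcoef n l) else 0) * of_nat (2 * m)"
    unfolding sum_distrib_right ..
  finally have eq: "(\<Sum>s\<in>residues_set m. of_real ((norm (jpoly n m s))\<^sup>2) * rou m (\<kappa> * s)) =
      (\<Sum>j\<le>n. \<Sum>l\<le>n. if 2 * int m dvd int j - int l + \<kappa>
       then of_real (jcoef n j * jcoef n l) else 0) * complex_of_nat (2 * m)" .
  have "(\<Sum>s\<in>residues_set m. of_real (jkernel n m s) * rou m (\<kappa> * s)) =
      (\<Sum>s\<in>residues_set m. of_real ((norm (jpoly n m s))\<^sup>2) * rou m (\<kappa> * s)) / (complex_of_nat (2 * m) * of_real (jnorm n))"
    unfolding jkernel_def sum_divide_distrib by (intro sum.cong[OF refl]) simp
  then show ?thesis unfolding eq using m by simp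
qed

lemma small_dvd_eq_0: "2 * int m dvd a \<Longrightarrow> \<bar>a\<bar> < 2 * int m \<Longrightarrow> a = 0"
  using dvd_imp_le_int[of a "2 * int m"] by linarith

lemma jkernel_sum:
  assumes n: "1 \<le> n" and m: "n < m"
  shows "(\<Sum>s\<in>residues_set m. jkernel n m s) = 1"
proof -
  have "complex_of_real (\<Sum>s\<in>residues_set m. jkernel n m s) =
     (\<Sum>s\<in>residues_set m. of_real (jkernel n m s) * rou m (0 * s))" by simp
  also have "\<dots> = (\<Sum>j\<le>n. \<Sum>l\<le>n. if 2 * int m dvd int j - int l + 0
       then of_real (jcoef n j * jcoef n l) else 0) / of_real (jnorm n)"
    by (rule jkernel_fourier) (use m n in auto)
  also have "(\<Sum>j\<le>n. \<Sum>l\<le>n. if 2 * int m dvd int j - int l + 0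
       then complex_of_real (jcoef n j * jcoef n l) else 0) =
      (\<Sum>j\<le>n. \<Sum>l\<le>n. if l = j then of_real ((jcoef n j)\<^sup>2) else 0)"
  proof (rule sum.cong[OF refl], rule sum.cong[OF refl])
    fix j l assume "j \<in> {..n}" "l \<in> {..n}"
    then have "2 * int m dvd int j - int l + 0 \<longleftrightarrow> l = j"
      using small_dvd_eq_0[of m "int j - int l"] m by auto
    then show "(if 2 * int m dvd int j - int l + 0 then complex_of_real (jcoef n j * jcoef n l) else 0) =
        (if l = j then of_real ((jcoef n j)\<^sup>2) else 0)" by (auto simp: power2_eq_square)
  qed
  also have "\<dots> = of_real (jnorm n)" by (simp add: jnorm_def)
  finally have "complex_of_real (\<Sum>s\<in>residues_set m. jkernel n m s) = of_real 1"
    using jnorm_pos[OF n] by (simp del: of_real_sum)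
  then show ?thesis by (simp only: of_real_eq_iff)
qed

lemma jkernel_cos:
  assumes n: "1 \<le> n" and m: "n < m"
  shows "(\<Sum>s\<in>residues_set m. jkernel n m s * cos (2 * pi * of_int s / real (2 * m))) = cos (pi / real (n + 1))"
proof -
  have "(\<Sum>s\<in>residues_set m. of_real (jkernel n m s) * rou m (1 * s)) =
     (\<Sum>j\<le>n. \<Sum>l\<le>n. if 2 * int m dvd int j - int l + 1
       then of_real (jcoef n j * jcoef n l) else 0) / of_real (jnorm n)"
    by (rule jkernel_fourier) (use m n in auto)
  also have "(\<Sum>j\<le>n. \<Sum>l\<le>n. if 2 * int m dvd int j - int l + 1
       then complex_of_real (jcoef n j * jcoef n l) else 0) =
      (\<Sum>j\<le>n. \<Sum>l\<le>n. if l = Suc j then of_real (jcoef n j * jcoef n (Suc j)) else 0)"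
  proof (rule sum.cong[OF refl], rule sum.cong[OF refl])
    fix j l assume "j \<in> {..n}" "l \<in> {..n}"
    moreover from this have "\<bar>int j - int l + 1\<bar> < 2 * int m"
      unfolding abs_less_iff using m n by auto
    ultimately have "2 * int m dvd int j - int l + 1 \<longleftrightarrow> l = Suc j"
      using small_dvd_eq_0[of m "int j - int l + 1"] by auto
    then show "(if 2 * int m dvd int j - int l + 1 then complex_of_real (jcoef n j * jcoef n l) else 0) =
        (if l = Suc j then of_real (jcoef n j * jcoef n (Suc j)) else 0)" by auto
  qed
  also have "\<dots> = (\<Sum>j<n. of_real (jcoef n j * jcoef n (Suc j)))"
  proof -
    have "(\<Sum>j\<le>n. \<Sum>l\<le>n. if l = Suc j then complex_of_real (jcoef n j * jcoef n (Suc j)) else 0) =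
        (\<Sum>j\<le>n. if j < n then of_real (jcoef n j * jcoef n (Suc j)) else 0)"
      by (rule sum.cong[OF refl]) (auto simp: sum.delta)
    also have "\<dots> = (\<Sum>j<n. of_real (jcoef n j * jcoef n (Suc j)))"
      by (rule sum.mono_neutral_cong_right) auto
    finally show ?thesis .
  qed
  also have "\<dots> = of_real (cos (pi / real (n + 1)) * jnorm n)"
    by (simp only: of_real_sum[symmetric] jcoef_autocorrelation)
  finally have "(\<Sum>s\<in>residues_set m. of_real (jkernel n m s) * rou m (1 * s)) = of_real (cos (pi / real (n + 1)))"
    using jnorm_pos[OF n] by (simp flip: of_real_divide)
  then have "Re (\<Sum>s\<in>residues_set m. of_real (jkernel n m s) * rou m (1 * s)) = cos (pi / real (n + 1))"
    by (simp only: Re_complex_of_real)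
  then show ?thesis by (simp add: Re_sum rou_def)
qed

lemma jkernel_vanish:
  assumes n: "1 \<le> n" and m: "n < m" and \<kappa>: "\<kappa> \<in> residues_set m" "int n < \<bar>\<kappa>\<bar>"
  shows "(\<Sum>s\<in>residues_set m. of_real (jkernel n m s) * rou m (\<kappa> * s)) = 0"
proof -
  have "\<not> 2 * int m dvd int j - int l + \<kappa>" if "j \<le> n" "l \<le> n" for j l
  proof -
    have "\<bar>int j - int l + \<kappa>\<bar> < 2 * int m"
      unfolding abs_less_iff using m \<kappa> that by auto
    moreover have "int j - int l + \<kappa> \<noteq> 0" using \<kappa> that by auto
    ultimately show ?thesis using small_dvd_eq_0 by blast
  qed
  then show ?thesis by (subst jkernel_fourier) (use m n in auto)
qed

text \<open>On \<open>[- pi, pi]\<close> the square is dominated by \<open>1 - cos\<close>, whose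
  mean is known exactly: it is \<open>1 - cos (pi / (n + 1))\<close>, of order
  \<open>1 / n^2\<close>.\<close>

lemma jkernel_second_moment:
  assumes n: "1 \<le> n" and m: "n < m"
  shows "(\<Sum>s\<in>residues_set m. jkernel n m s * (real_of_int s)\<^sup>2) \<le> (pi * real m / (2 * real (n + 1)))\<^sup>2"
proof -
  have "(\<Sum>s\<in>residues_set m. jkernel n m s * (2 * (2 * pi * of_int s / real (2 * m))\<^sup>2 / pi\<^sup>2)) \<le>
     (\<Sum>s\<in>residues_set m. jkernel n m s * (1 - cos (2 * pi * of_int s / real (2 * m))))"
  proof (intro sum_mono mult_left_mono jkernel_nonneg one_minus_cos_ge)
    fix s assume "s \<in> residues_set m"
    then have "\<bar>real_of_int s\<bar> \<le> real m" by auto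
    then have "pi * \<bar>real_of_int s\<bar> / real m \<le> pi"
      using m n by (simp add: field_simps)
    then show "\<bar>2 * pi * of_int s / real (2 * m)\<bar> \<le> pi" by (simp add: abs_mult)
  qed
  also have "\<dots> = 1 - cos (pi / real (n + 1))"
    by (simp only: right_diff_distrib sum_subtractf mult_1_right jkernel_sum[OF n m] jkernel_cos[OF n m])
  also have "\<dots> \<le> (pi / real (n + 1))\<^sup>2 / 2" by (rule one_minus_cos_le)
  also have "(\<Sum>s\<in>residues_set m. jkernel n m s * (2 * (2 * pi * of_int s / real (2 * m))\<^sup>2 / pi\<^sup>2)) =
     (2 / (real m)\<^sup>2) * (\<Sum>s\<in>residues_set m. jkernel n m s * (real_of_int s)\<^sup>2)"
    unfolding sum_distrib_left by (intro sum.cong refl) (simp add: power_divide power_mult_distrib)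
  finally have "(\<Sum>s\<in>residues_set m. jkernel n m s * (real_of_int s)\<^sup>2) \<le> (real m)\<^sup>2 * ((pi / real (n + 1))\<^sup>2 / 4)"
    using m by (simp add: field_simps)
  moreover have "(pi * M / (2 * r))\<^sup>2 = M\<^sup>2 * ((pi / r)\<^sup>2 / 4)" for M r :: real
    by (simp add: power_divide power_mult_distrib mult.commute)
  ultimately show ?thesis by (simp only:)
qed

section \<open>Product kernel in several variables\<close>

definition mkernel :: "nat \<Rightarrow> nat \<Rightarrow> nat \<Rightarrow> (nat \<Rightarrow> int) \<Rightarrow> real" where
  "mkernel d n m s = (\<Prod>i<d. jkernel n m (s i))"

lemma mkernel_nonneg: "0 \<le> mkernel d n m s"
  unfolding mkernel_def by (intro prod_nonneg) (auto intro: jkernel_nonneg)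

lemma mkernel_sum:
  assumes "1 \<le> n" "n < m"
  shows "(\<Sum>s\<in>zbox d m. mkernel d n m s) = 1"
  unfolding mkernel_def zbox_def
  by (subst prod_sum_PiE[symmetric]) (auto simp: jkernel_sum[OF assms])

text \<open>The sum over the box factorizes, and every coordinate other than \<open>i\<close>
  contributes the total mass 1.\<close>

lemma mkernel_second_moment:
  assumes "1 \<le> n" "n < m" and i: "i < d"
  shows "(\<Sum>s\<in>zbox d m. mkernel d n m s * (real_of_int (s i))\<^sup>2) \<le> (pi * real m / (2 * real (n + 1)))\<^sup>2"
proof -
  have "(\<Sum>s\<in>zbox d m. mkernel d n m s * (real_of_int (s i))\<^sup>2) =
      (\<Sum>s\<in>zbox d m. \<Prod>j<d. jkernel n m (s j) * (if j = i then (real_of_int (s j))\<^sup>2 else 1))"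
    unfolding mkernel_def prod.distrib using i by (intro sum.cong refl) (simp add: prod.delta)
  also have "\<dots> = (\<Prod>j<d. \<Sum>s\<in>residues_set m. jkernel n m s * (if j = i then (real_of_int s)\<^sup>2 else 1))"
    unfolding zbox_def by (subst prod_sum_PiE) auto
  also have "\<dots> = (\<Prod>j<d. if j = i then (\<Sum>s\<in>residues_set m. jkernel n m s * (real_of_int s)\<^sup>2) else 1)"
    by (rule prod.cong[OF refl]) (auto simp: jkernel_sum[OF assms(1,2)])
  also have "\<dots> = (\<Sum>s\<in>residues_set m. jkernel n m s * (real_of_int s)\<^sup>2)"
    using i by (simp add: prod.delta)
  finally show ?thesis using jkernel_second_moment[OF assms(1,2)] by (simp only:)
qed

definition lattice_pt :: "real \<Rightarrow> (nat \<Rightarrow> int) \<Rightarrow> nat \<Rightarrow> real" where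
  "lattice_pt \<eta> z = (\<lambda>i. \<eta> * of_int (z i))"

text \<open>Going through second moments by Cauchy-Schwarz gives \<open>sqrt d\<close>; adding up
  first moments of the coordinates would give \<open>d\<close>.\<close>

lemma mkernel_first_moment:
  assumes n: "1 \<le> n" and m: "n < m" and \<eta>: "0 \<le> \<eta>"
  shows "(\<Sum>s\<in>zbox d m. mkernel d n m s * enorm d (lattice_pt \<eta> s)) \<le>
    sqrt (real d) * \<eta> * (pi * real m / (2 * real (n + 1)))"
proof -
  let ?K = "mkernel d n m" and ?e = "\<lambda>s. enorm d (lattice_pt \<eta> s)"
  have "(\<Sum>s\<in>zbox d m. ?K s * ?e s)\<^sup>2 = (\<Sum>s\<in>zbox d m. sqrt (?K s) * (sqrt (?K s) * ?e s))\<^sup>2"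
    by (simp add: mult.assoc[symmetric] mkernel_nonneg)
  also have "\<dots> \<le> (\<Sum>s\<in>zbox d m. (sqrt (?K s))\<^sup>2) * (\<Sum>s\<in>zbox d m. (sqrt (?K s) * ?e s)\<^sup>2)"
    by (rule Cauchy_Schwarz_ineq_sum)
  also have "\<dots> = (\<Sum>s\<in>zbox d m. ?K s * (?e s)\<^sup>2)"
    by (simp add: mkernel_nonneg power_mult_distrib mkernel_sum[OF n m])
  also have "\<dots> = \<eta>\<^sup>2 * (\<Sum>i<d. \<Sum>s\<in>zbox d m. ?K s * (real_of_int (s i))\<^sup>2)"
  proof -
    have e: "(?e s)\<^sup>2 = \<eta>\<^sup>2 * (\<Sum>i<d. (real_of_int (s i))\<^sup>2)" for s
      by (simp add: enorm_sq lattice_pt_def power_mult_distrib sum_distrib_left)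
    have "(\<Sum>s\<in>zbox d m. ?K s * (?e s)\<^sup>2) = \<eta>\<^sup>2 * (\<Sum>s\<in>zbox d m. \<Sum>i<d. ?K s * (real_of_int (s i))\<^sup>2)"
      unfolding e sum_distrib_left by (rule sum.cong[OF refl])+ (simp only: mult_ac)
    then show ?thesis by (simp only: sum.swap[of _ "{..<d}"])
  qed
  also have "\<dots> \<le> \<eta>\<^sup>2 * (\<Sum>i<d. (pi * real m / (2 * real (n + 1)))\<^sup>2)"
    by (intro mult_left_mono sum_mono mkernel_second_moment n m) auto
  also have "\<dots> = (sqrt (real d) * \<eta> * (pi * real m / (2 * real (n + 1))))\<^sup>2"
  proof -
    have "\<eta>\<^sup>2 * (real d * X\<^sup>2) = (sqrt (real d) * \<eta> * X)\<^sup>2" for X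
      by (simp add: power_mult_distrib)
    then show ?thesis by (simp only: sum_constant card_lessThan)
  qed
  finally show ?thesis
    by (rule power2_le_imp_le) (use \<eta> pi_gt_zero in auto)
qed

section \<open>Convolutions and differences as Fourier multipliers\<close>

definition mtransform :: "nat \<Rightarrow> nat \<Rightarrow> nat \<Rightarrow> (nat \<Rightarrow> int) \<Rightarrow> complex" where
  "mtransform d n m k = (\<Sum>s\<in>zbox d m. of_real (mkernel d n m s) * character d m k (\<lambda>i. - s i))"

lemma norm_mtransform_le:
  assumes "1 \<le> n" "n < m"
  shows "norm (mtransform d n m k) \<le> 1"
proof -
  have "norm (mtransform d n m k) \<le> (\<Sum>s\<in>zbox d m. mkernel d n m s)"
    unfolding mtransform_def
    by (rule order_trans[OF norm_sum]) (simp add: norm_mult mkernel_nonneg)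
  then show ?thesis using mkernel_sum[OF assms] by simp
qed

lemma mtransform_vanish:
  assumes n: "1 \<le> n" "n < m" and k: "k \<in> zbox d m" and i: "i < d" "int n < \<bar>k i\<bar>"
  shows "mtransform d n m k = 0"
proof -
  have "mtransform d n m k = (\<Sum>s\<in>zbox d m. \<Prod>j<d. of_real (jkernel n m (s j)) * rou m (- k j * s j))"
    unfolding mtransform_def mkernel_def character_def by (simp add: prod.distrib)
  also have "\<dots> = (\<Prod>j<d. \<Sum>s\<in>residues_set m. of_real (jkernel n m s) * rou m (- k j * s))"
    unfolding zbox_def by (subst prod_sum_PiE) auto
  also have "\<dots> = 0"
  proof (rule prod_zero[OF _ bexI[of _ i]])
    have "(\<Sum>s\<in>residues_set m. of_real (jkernel n m s) * rou m (- k i * s)) =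
       cnj (\<Sum>s\<in>residues_set m. of_real (jkernel n m s) * rou m (k i * s))"
      by (simp add: cnj_rou)
    also have "\<dots> = 0"
    proof -
      have ki: "k i \<in> residues_set m" using k i by (auto simp: zbox_def PiE_iff)
      show ?thesis by (simp only: jkernel_vanish[OF n ki i(2)] complex_cnj_zero)
    qed
    finally show "(\<Sum>s\<in>residues_set m. of_real (jkernel n m s) * rou m (- k i * s)) = 0" .
  qed (use i in auto)
  finally show ?thesis .
qed

lemma along_lattice:
  "along (lattice_pt \<eta> z) (lattice_pt \<eta> s) (of_int r) = lattice_pt \<eta> (\<lambda>i. z i + r * s i)"
  by (simp add: along_def lattice_pt_def algebra_simps)

text \<open>A shift multiplies each character by a constant, so the operator is diagonal in the
  characters; its eigenvalues are \<open>1 - mtransform d n m k\<close> because the weights sum to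
  1.\<close>

lemma residual_op_spectral:
  assumes n: "1 \<le> n" "n < m"
    and f: "\<And>z. of_real (f (lattice_pt \<eta> z)) = (\<Sum>k\<in>zbox d m. b k * character d m k z)"
  shows "of_real ((residual_op (zbox d m) (mkernel d n m) (lattice_pt \<eta>) ^^ p) f (lattice_pt \<eta> z)) =
    (\<Sum>k\<in>zbox d m. b k * (1 - mtransform d n m k) ^ p * character d m k z)"
proof (induction p arbitrary: z)
  case 0
  then show ?case using f by simp
next
  case (Suc p)
  let ?R = "residual_op (zbox d m) (mkernel d n m) (lattice_pt \<eta>)"
  let ?b = "\<lambda>k. b k * (1 - mtransform d n m k) ^ p"
  have sh: "along (lattice_pt \<eta> z) (lattice_pt \<eta> s) (-1) = lattice_pt \<eta> (\<lambda>i. z i + - s i)" for s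
    using along_lattice[of \<eta> z s "-1"] by simp
  have "of_real ((?R ^^ Suc p) f (lattice_pt \<eta> z)) =
     (\<Sum>s\<in>zbox d m. of_real (mkernel d n m s) *
       (complex_of_real ((?R ^^ p) f (lattice_pt \<eta> z)) - of_real ((?R ^^ p) f (lattice_pt \<eta> (\<lambda>i. z i + - s i)))))"
    by (simp add: residual_op_def sh)
  also have "\<dots> = (\<Sum>s\<in>zbox d m. of_real (mkernel d n m s) *
       (\<Sum>k\<in>zbox d m. ?b k * character d m k z * (1 - character d m k (\<lambda>i. - s i))))"
    unfolding Suc.IH character_add
    by (simp add: sum_subtractf[symmetric] right_diff_distrib mult.assoc)
  also have "\<dots> = (\<Sum>k\<in>zbox d m. \<Sum>s\<in>zbox d m. of_real (mkernel d n m s) *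
       (?b k * character d m k z * (1 - character d m k (\<lambda>i. - s i))))"
    unfolding sum_distrib_left by (rule sum.swap)
  also have "\<dots> = (\<Sum>k\<in>zbox d m. ?b k * (1 - mtransform d n m k) * character d m k z)"
  proof (rule sum.cong[OF refl])
    fix k
    have "(\<Sum>s\<in>zbox d m. of_real (mkernel d n m s) * (?b k * character d m k z * (1 - character d m k (\<lambda>i. - s i)))) =
       ?b k * character d m k z * (\<Sum>s\<in>zbox d m. of_real (mkernel d n m s) * (1 - character d m k (\<lambda>i. - s i)))"
      unfolding sum_distrib_left by (intro sum.cong refl) (simp only: mult_ac)
    also have "(\<Sum>s\<in>zbox d m. of_real (mkernel d n m s) * (1 - character d m k (\<lambda>i. - s i))) =
        of_real (\<Sum>s\<in>zbox d m. mkernel d n m s) - mtransform d n m k"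
      by (simp add: mtransform_def right_diff_distrib sum_subtractf)
    finally show "(\<Sum>s\<in>zbox d m. of_real (mkernel d n m s) * (?b k * character d m k z * (1 - character d m k (\<lambda>i. - s i)))) =
       ?b k * (1 - mtransform d n m k) * character d m k z"
      unfolding mkernel_sum[OF n] of_real_1 by (simp add: mult_ac)
  qed
  finally show ?case by (simp add: mult_ac)
qed

lemma fdiff_spectral:
  assumes f: "\<And>z. of_real (f (lattice_pt \<eta> z)) = (\<Sum>k\<in>zbox d m. b k * character d m k z)"
  shows "of_real (fdiff (replicate p (lattice_pt \<eta> e)) f (lattice_pt \<eta> z)) =
    (\<Sum>k\<in>zbox d m. b k * (character d m k e - 1) ^ p * character d m k z)"
proof (induction p arbitrary: z)
  case 0
  then show ?case using f by simp
next
  case (Suc p)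
  have sh: "along (lattice_pt \<eta> z) (lattice_pt \<eta> e) 1 = lattice_pt \<eta> (\<lambda>i. z i + e i)"
    using along_lattice[of \<eta> z e 1] by simp
  show ?case
    by (simp add: sh Suc character_add sum_subtractf[symmetric]) (simp add: algebra_simps)
qed


lemma sum_power_le:
  fixes y :: "nat \<Rightarrow> real"
  assumes "\<And>i. i < d \<Longrightarrow> 0 \<le> y i" and p: "0 < p"
  shows "(\<Sum>i<d. y i) ^ p \<le> real d ^ p * (\<Sum>i<d. y i ^ p)"
proof (cases "d = 0")
  case True
  then show ?thesis using p by (simp add: zero_power)
next
  case False
  then have "Max (y ` {..<d}) \<in> y ` {..<d}" by (intro Max_in) auto
  then obtain j where j: "j < d" "y j = Max (y ` {..<d})" by auto
  have "(\<Sum>i<d. y i) \<le> real d * y j"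
    using sum_bounded_above[of "{..<d}" y "y j"] j by auto
  then have "(\<Sum>i<d. y i) ^ p \<le> (real d * y j) ^ p"
    using assms by (intro power_mono sum_nonneg) auto
  also have "\<dots> \<le> real d ^ p * (\<Sum>i<d. y i ^ p)"
    unfolding power_mult_distrib using assms j
    by (intro mult_left_mono member_le_sum[of j _ "\<lambda>i. y i ^ p"]) auto
  finally show ?thesis .
qed

definition freq :: "real \<Rightarrow> (nat \<Rightarrow> int) \<Rightarrow> nat \<Rightarrow> real" where
  "freq L k = (\<lambda>i. 2 * pi * of_int (k i) / L)"

text \<open>A discrete form of the \<open>L2\<close> bound for \<open>p\<close>-th derivatives. The
  \<open>p\<close>-fold difference by one mesh step in coordinate \<open>i\<close> is at most
  \<open>A * \<eta> ^ p\<close> and has the coefficients \<open>a k * (rou m (k i) - 1) ^ p\<close>.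
  As \<open>|k i| \<le> m\<close>, the chord bound gives
  \<open>|rou m (k i) - 1| \<ge> (2 / pi) * \<eta> * |freq L k i|\<close>, so the powers of
  \<open>\<eta>\<close> cancel and the result is uniform in the mesh.\<close>

lemma fdiff_parseval_bound:
  assumes m: "0 < m" and L: "0 < L" and \<eta>: "\<eta> = L / real (2 * m)" and d: "1 \<le> d" and p: "1 \<le> p"
    and f: "\<And>z. of_real (f (lattice_pt \<eta> z)) = (\<Sum>k\<in>zbox d m. a k * character d m k z)"
    and A: "\<And>ts x. length ts = p \<Longrightarrow> \<bar>fdiff ts f x\<bar> \<le> A * prod_list (map (enorm d) ts)"
  shows "(\<Sum>k\<in>zbox d m. (norm (a k))\<^sup>2 * enorm d (freq L k) ^ (2 * p)) \<le>
    real d ^ (p + 1) * ((pi / 2) ^ p * A)\<^sup>2"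
proof -
  have \<eta>0: "0 < \<eta>" using m L by (simp add: \<eta>)
  define e :: "nat \<Rightarrow> nat \<Rightarrow> int" where "e i = (\<lambda>j. if j = i then 1 else 0)" for i
  have en: "enorm d (lattice_pt \<eta> (e i)) = \<eta>" if "i < d" for i
  proof -
    have "(enorm d (lattice_pt \<eta> (e i)))\<^sup>2 = (\<Sum>j<d. if j = i then \<eta>\<^sup>2 else 0)"
      unfolding enorm_sq by (intro sum.cong[OF refl]) (simp add: lattice_pt_def e_def)
    also have "\<dots> = \<eta>\<^sup>2" using that by simp
    finally show ?thesis by (rule power2_eq_imp_eq) (use \<eta>0 in auto)
  qed
  have ce: "character d m k (e i) = rou m (k i)" if "i < d" for k i
  proof -
    have "character d m k (e i) = (\<Prod>j<d. if j = i then rou m (k i) else 1)"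
      unfolding character_def by (intro prod.cong[OF refl]) (simp add: e_def)
    then show ?thesis using that by simp
  qed
  have one: "(\<Sum>k\<in>zbox d m. (norm (a k))\<^sup>2 * ((freq L k i)\<^sup>2) ^ p) \<le> ((pi / 2) ^ p * A)\<^sup>2" if i: "i < d" for i
  proof -
    let ?b = "\<lambda>k. a k * (character d m k (e i) - 1) ^ p"
    have "real ((2 * m) ^ d) * (\<Sum>k\<in>zbox d m. (norm (?b k))\<^sup>2) =
        (\<Sum>z\<in>zbox d m. (norm (\<Sum>k\<in>zbox d m. ?b k * character d m k z))\<^sup>2)"
      by (rule dft_parseval[OF m, symmetric])
    also have "\<dots> \<le> (\<Sum>z\<in>zbox d m. (A * \<eta> ^ p)\<^sup>2)"
    proof (rule sum_mono)
      fix z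
      have "norm (\<Sum>k\<in>zbox d m. ?b k * character d m k z) = \<bar>fdiff (replicate p (lattice_pt \<eta> (e i))) f (lattice_pt \<eta> z)\<bar>"
        by (simp only: fdiff_spectral[OF f, symmetric] norm_of_real)
      also have "\<dots> \<le> A * \<eta> ^ p"
        using A[of "replicate p (lattice_pt \<eta> (e i))" "lattice_pt \<eta> z"] by (simp add: en[OF i] prod_list_replicate)
      finally show "(norm (\<Sum>k\<in>zbox d m. ?b k * character d m k z))\<^sup>2 \<le> (A * \<eta> ^ p)\<^sup>2"
        by (intro power_mono) auto
    qed
    also have "\<dots> = real ((2 * m) ^ d) * (A * \<eta> ^ p)\<^sup>2" by (simp add: card_zbox)
    finally have B: "(\<Sum>k\<in>zbox d m. (norm (?b k))\<^sup>2) \<le> (A * \<eta> ^ p)\<^sup>2"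
      using m by (subst (asm) mult_le_cancel_left_pos) auto
    have "(\<Sum>k\<in>zbox d m. (norm (a k))\<^sup>2 * ((freq L k i)\<^sup>2) ^ p) \<le>
        (\<Sum>k\<in>zbox d m. (pi / 2 / \<eta>) ^ (2 * p) * (norm (?b k))\<^sup>2)"
    proof (rule sum_mono)
      fix k assume k: "k \<in> zbox d m"
      have "- int m \<le> k i" "k i < int m" using k i by (auto simp: zbox_def PiE_iff)
      then have "\<bar>real_of_int (k i)\<bar> \<le> real m" by linarith
      then have "\<bar>2 * pi * of_int (k i) / real (2 * m)\<bar> \<le> pi"
        using m by (simp add: abs_mult field_simps)
      from norm_cis_minus_1_ge[OF this]
      have "2 * \<bar>2 * pi * of_int (k i) / real (2 * m)\<bar> / pi \<le> norm (rou m (k i) - 1)"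
        by (simp only: rou_def)
      moreover have "2 * pi * of_int (k i) / real (2 * m) = freq L k i * \<eta>"
        using L by (simp add: freq_def \<eta>)
      ultimately have "2 * \<bar>freq L k i * \<eta>\<bar> / pi \<le> norm (rou m (k i) - 1)"
        by (simp only:)
      then have "\<bar>freq L k i\<bar> \<le> pi / 2 / \<eta> * norm (rou m (k i) - 1)"
        using \<eta>0 by (simp add: field_simps abs_mult)
      then have "\<bar>freq L k i\<bar> ^ (2 * p) \<le> (pi / 2 / \<eta> * norm (rou m (k i) - 1)) ^ (2 * p)"
        by (intro power_mono) auto
      then have "(norm (a k))\<^sup>2 * \<bar>freq L k i\<bar> ^ (2 * p) \<le>
          (norm (a k))\<^sup>2 * (pi / 2 / \<eta> * norm (rou m (k i) - 1)) ^ (2 * p)"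
        by (intro mult_left_mono) auto
      moreover have "(norm (a k))\<^sup>2 * (pi / 2 / \<eta> * norm (rou m (k i) - 1)) ^ (2 * p) =
          (pi / 2 / \<eta>) ^ (2 * p) * (norm (?b k))\<^sup>2"
        unfolding ce[OF i] norm_mult norm_power power_mult_distrib power_mult[symmetric]
        by (simp only: mult_ac)
      moreover have "\<bar>freq L k i\<bar> ^ (2 * p) = ((freq L k i)\<^sup>2) ^ p"
        by (simp add: power_mult)
      ultimately show "(norm (a k))\<^sup>2 * ((freq L k i)\<^sup>2) ^ p \<le> (pi / 2 / \<eta>) ^ (2 * p) * (norm (?b k))\<^sup>2"
        by simp
    qed
    also have "\<dots> = (pi / 2 / \<eta>) ^ (2 * p) * (\<Sum>k\<in>zbox d m. (norm (?b k))\<^sup>2)"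
      by (rule sum_distrib_left[symmetric])
    also have "\<dots> \<le> (pi / 2 / \<eta>) ^ (2 * p) * (A * \<eta> ^ p)\<^sup>2"
      using B by (intro mult_left_mono) auto
    also have "\<dots> = ((pi / 2) ^ p * A)\<^sup>2"
    proof -
      have "(pi / 2 / \<eta>) ^ (2 * p) = ((pi / 2) ^ p / \<eta> ^ p)\<^sup>2"
        by (simp only: power_divide power_mult[symmetric] mult.commute)
      then have "(pi / 2 / \<eta>) ^ (2 * p) * (A * \<eta> ^ p)\<^sup>2 = ((pi / 2) ^ p / \<eta> ^ p * (A * \<eta> ^ p))\<^sup>2"
        by (simp only: power_mult_distrib)
      also have "(pi / 2) ^ p / \<eta> ^ p * (A * \<eta> ^ p) = (pi / 2) ^ p * A" using \<eta>0 by simp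
      finally show ?thesis .
    qed
    finally show ?thesis .
  qed
  have "(\<Sum>k\<in>zbox d m. (norm (a k))\<^sup>2 * enorm d (freq L k) ^ (2 * p)) \<le>
     (\<Sum>k\<in>zbox d m. (norm (a k))\<^sup>2 * (real d ^ p * (\<Sum>i<d. ((freq L k i)\<^sup>2) ^ p)))"
    unfolding power_mult enorm_sq using p
    by (intro sum_mono mult_left_mono sum_power_le) auto
  also have "\<dots> = real d ^ p * (\<Sum>i<d. \<Sum>k\<in>zbox d m. (norm (a k))\<^sup>2 * ((freq L k i)\<^sup>2) ^ p)"
    by (subst sum.swap) (simp add: sum_distrib_left mult_ac)
  also have "\<dots> \<le> real d ^ p * (\<Sum>i<d. ((pi / 2) ^ p * A)\<^sup>2)"
    by (intro mult_left_mono sum_mono one) auto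
  also have "\<dots> = real d ^ (p + 1) * ((pi / 2) ^ p * A)\<^sup>2" by simp
  finally show ?thesis .
qed

definition fbox :: "nat \<Rightarrow> nat \<Rightarrow> (nat \<Rightarrow> int) set" where
  "fbox d n = PiE {..<d} (\<lambda>_. {- int n..int n})"

lemma finite_fbox [simp]: "finite (fbox d n)"
  unfolding fbox_def by (intro finite_PiE) auto

lemma card_fbox: "card (fbox d n) = (2 * n + 1) ^ d"
proof -
  have "card {- int n..int n} = 2 * n + 1" by simp
  then show ?thesis unfolding fbox_def by (simp add: card_PiE)
qed

lemma fbox_subset: "n < m \<Longrightarrow> fbox d n \<subseteq> zbox d m"
  unfolding fbox_def zbox_def by (intro PiE_mono) auto

text \<open>
  Jackson's inequality. With \<open>J\<close> the convolution with the product kernel, the trigonometric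
  polynomial is \<open>f - (I - J)\<^sup>p f\<close>: each factor \<open>I - J\<close> uses up one order of differences, which
  avoids constants of size \<open>p ^ p\<close>.
\<close>

lemma trig_approximation:
  assumes n: "1 \<le> n" "n < m" and L: "0 < L" and \<eta>: "\<eta> = L / real (2 * m)" and d: "1 \<le> d" and p: "1 \<le> p"
    and per: "\<And>z z'. \<forall>i<d. 2 * int m dvd z i - z' i \<Longrightarrow> f (lattice_pt \<eta> z) = f (lattice_pt \<eta> z')"
    and A: "\<And>ts x. length ts = p \<Longrightarrow> \<bar>fdiff ts f x\<bar> \<le> A * prod_list (map (enorm d) ts)"
    and A0: "0 \<le> A" and C: "\<And>x. \<bar>f x\<bar> \<le> C"
  shows "\<exists>g. (\<forall>z. norm (of_real (f (lattice_pt \<eta> z)) - (\<Sum>k\<in>fbox d n. g k * character d m k z))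
          \<le> A * (sqrt (real d) * L / real (n + 1)) ^ p) \<and>
     (\<forall>k. norm (g k) \<le> (1 + 2 ^ p) * C) \<and>
     (\<Sum>k\<in>fbox d n. (norm (g k))\<^sup>2 * enorm d (freq L k) ^ (2 * p)) \<le>
       (1 + 2 ^ p)\<^sup>2 * (real d ^ (p + 1) * ((pi / 2) ^ p * A)\<^sup>2)"
proof -
  have m: "0 < m" using n by simp
  define F where "F z = complex_of_real (f (lattice_pt \<eta> z))" for z
  define a where "a = dft d m F"
  \<comment> \<open>The multiplier of \<open>I - (I - J) ^ p\<close>. It vanishes wherever
    \<open>mtransform\<close> does, hence outside \<open>fbox d n\<close>; the bound
    \<open>1 + 2 ^ p\<close> comes from \<open>|mtransform| \<le> 1\<close> and is affordable in
    \<open>c ^ p\<close>.\<close>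
  define lam where "lam k = 1 - (1 - mtransform d n m k) ^ p" for k
  define g where "g k = a k * lam k" for k
  have F: "complex_of_real (f (lattice_pt \<eta> z)) = (\<Sum>k\<in>zbox d m. a k * character d m k z)" for z
    using dft_inversion[OF m, of d F z] per by (simp add: F_def a_def)
  have lk: "norm (lam k) \<le> 1 + 2 ^ p" for k
  proof -
    have "norm (1 - mtransform d n m k) \<le> 2"
      using norm_triangle_ineq4[of 1 "mtransform d n m k"] norm_mtransform_le[OF n, of d k] by simp
    then have "norm ((1 - mtransform d n m k) ^ p) \<le> 2 ^ p"
      unfolding norm_power by (intro power_mono) auto
    then show ?thesis
      unfolding lam_def using norm_triangle_ineq4[of 1 "(1 - mtransform d n m k) ^ p"] by simp
  qed
  have C0: "0 \<le> C" using C[of "\<lambda>_. 0"] by linarith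
  have ak: "norm (a k) \<le> C" for k
  proof -
    have "norm (\<Sum>y\<in>zbox d m. F y * character d m k (\<lambda>i. - y i)) \<le> (\<Sum>y\<in>zbox d m. C)"
      by (rule order_trans[OF norm_sum], rule sum_mono) (simp add: norm_mult F_def C)
    also have "\<dots> = real ((2 * m) ^ d) * C" by (simp add: card_zbox)
    finally show ?thesis
      unfolding a_def dft_def norm_divide norm_of_nat using m
      by (simp add: divide_le_eq mult.commute del: of_nat_mult of_nat_power)
  qed
  have "norm (of_real (f (lattice_pt \<eta> z)) - (\<Sum>k\<in>fbox d n. g k * character d m k z))
          \<le> A * (sqrt (real d) * L / real (n + 1)) ^ p" for z
  proof -
    let ?S = "\<Sum>s\<in>zbox d m. mkernel d n m s * enorm d (lattice_pt \<eta> s)"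
    have "(\<Sum>k\<in>fbox d n. g k * character d m k z) = (\<Sum>k\<in>zbox d m. g k * character d m k z)"
    proof (rule sum.mono_neutral_left)
      show "\<forall>k\<in>zbox d m - fbox d n. g k * character d m k z = 0"
      proof
        fix k assume k: "k \<in> zbox d m - fbox d n"
        then obtain i where "i < d" "int n < \<bar>k i\<bar>"
          by (auto simp: fbox_def zbox_def PiE_iff)
        then have "mtransform d n m k = 0" using mtransform_vanish[OF n] k by auto
        then show "g k * character d m k z = 0" by (simp add: g_def lam_def)
      qed
    qed (use fbox_subset[OF n(2)] in auto)
    also have "\<dots> = of_real (f (lattice_pt \<eta> z)) - (\<Sum>k\<in>zbox d m. a k * (1 - mtransform d n m k) ^ p * character d m k z)"
      unfolding F sum_subtractf[symmetric] g_def lam_def by (rule sum.cong[OF refl]) (simp add: algebra_simps)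
    finally have "norm (of_real (f (lattice_pt \<eta> z)) - (\<Sum>k\<in>fbox d n. g k * character d m k z)) =
       \<bar>(residual_op (zbox d m) (mkernel d n m) (lattice_pt \<eta>) ^^ p) f (lattice_pt \<eta> z)\<bar>"
      unfolding residual_op_spectral[OF n F, symmetric] by (simp only: diff_diff_eq2 add_diff_cancel_left' norm_of_real)
    also have "\<dots> \<le> A * ?S ^ p"
      by (rule residual_op_pow_bound) (use A mkernel_nonneg in auto)
    also have "\<dots> \<le> A * (sqrt (real d) * L / real (n + 1)) ^ p"
    proof (intro mult_left_mono power_mono A0)
      have "?S \<le> sqrt (real d) * \<eta> * (pi * real m / (2 * real (n + 1)))"
        by (rule mkernel_first_moment[OF n]) (use L \<eta> in auto)
      also have "\<dots> = sqrt (real d) * L / real (n + 1) * (pi / 4)"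
        using m by (simp add: \<eta> field_simps)
      also have "\<dots> \<le> sqrt (real d) * L / real (n + 1) * 1"
        using L pi_less_4 by (intro mult_left_mono) auto
      finally show "?S \<le> sqrt (real d) * L / real (n + 1)" by simp
      show "0 \<le> ?S" by (intro sum_nonneg mult_nonneg_nonneg mkernel_nonneg) auto
    qed
    finally show ?thesis .
  qed
  moreover have "norm (g k) \<le> (1 + 2 ^ p) * C" for k
    unfolding g_def norm_mult using mult_mono[OF ak lk] C0 by (simp add: mult.commute)
  moreover have "(\<Sum>k\<in>fbox d n. (norm (g k))\<^sup>2 * enorm d (freq L k) ^ (2 * p)) \<le>
       (1 + 2 ^ p)\<^sup>2 * (real d ^ (p + 1) * ((pi / 2) ^ p * A)\<^sup>2)"
  proof -
    have "(\<Sum>k\<in>fbox d n. (norm (g k))\<^sup>2 * enorm d (freq L k) ^ (2 * p)) \<le>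
       (\<Sum>k\<in>fbox d n. (1 + 2 ^ p)\<^sup>2 * ((norm (a k))\<^sup>2 * enorm d (freq L k) ^ (2 * p)))"
    proof (rule sum_mono)
      fix k
      have "(norm (g k))\<^sup>2 \<le> ((1 + 2 ^ p) * norm (a k))\<^sup>2"
        unfolding g_def norm_mult using mult_right_mono[OF lk, of "norm (a k)"]
        by (intro power_mono) (auto simp: mult.commute)
      then have "(norm (g k))\<^sup>2 * enorm d (freq L k) ^ (2 * p) \<le>
          ((1 + 2 ^ p) * norm (a k))\<^sup>2 * enorm d (freq L k) ^ (2 * p)"
        by (rule mult_right_mono) simp
      then show "(norm (g k))\<^sup>2 * enorm d (freq L k) ^ (2 * p) \<le>
          (1 + 2 ^ p)\<^sup>2 * ((norm (a k))\<^sup>2 * enorm d (freq L k) ^ (2 * p))"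
        by (simp only: power_mult_distrib mult.assoc)
    qed
    also have "\<dots> \<le> (\<Sum>k\<in>zbox d m. (1 + 2 ^ p)\<^sup>2 * ((norm (a k))\<^sup>2 * enorm d (freq L k) ^ (2 * p)))"
      by (rule sum_mono2) (use fbox_subset[OF n(2)] in auto)
    also have "\<dots> = (1 + 2 ^ p)\<^sup>2 * (\<Sum>k\<in>zbox d m. (norm (a k))\<^sup>2 * enorm d (freq L k) ^ (2 * p))"
      by (rule sum_distrib_left[symmetric])
    also have "\<dots> \<le> (1 + 2 ^ p)\<^sup>2 * (real d ^ (p + 1) * ((pi / 2) ^ p * A)\<^sup>2)"
      by (rule mult_left_mono[OF fdiff_parseval_bound[OF m L \<eta> d p F A]]) auto
    finally show ?thesis .
  qed
  ultimately show ?thesis by blast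
qed

section \<open>Taylor remainders\<close>

text \<open>Coefficients are indexed by lists, not by multi-indices: every ordering of a mixed
  derivative is counted, so Taylor's formula needs only the factor
  \<open>1 / fact j\<close>.\<close>

primrec hform :: "nat \<Rightarrow> nat \<Rightarrow> (nat list \<Rightarrow> real) \<Rightarrow> (nat \<Rightarrow> real) \<Rightarrow> real" where
  "hform d 0 c x = c []"
| "hform d (Suc j) c x = (\<Sum>i<d. x i * hform d j (\<lambda>I. c (i # I)) x)"

text \<open>Adjacent transpositions generate all permutations. The bound on the length matters
  because symmetry of mixed derivatives is established only below order \<open>p\<close>.\<close>

definition swap_inv :: "nat \<Rightarrow> (nat list \<Rightarrow> real) \<Rightarrow> bool" where
  "swap_inv n c \<longleftrightarrow> (\<forall>J i k I. length J + 2 + length I \<le> n \<longrightarrow> c (J @ i # k # I) = c (J @ k # i # I))"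

lemma swap_inv_Cons: "swap_inv (Suc n) c \<Longrightarrow> swap_inv n (\<lambda>I. c (i # I))"
  unfolding swap_inv_def
proof (intro allI impI)
  fix J I :: "nat list" and a k :: nat
  assume c: "\<forall>J i k I. length J + 2 + length I \<le> Suc n \<longrightarrow> c (J @ i # k # I) = c (J @ k # i # I)"
    and l: "length J + 2 + length I \<le> n"
  show "c (i # J @ a # k # I) = c (i # J @ k # a # I)"
    using c[rule_format, of "i # J" I a k] l by simp
qed

lemma hform_cong:
  "(\<And>I. length I = j \<Longrightarrow> c I = c' I) \<Longrightarrow> hform d j c x = hform d j c' x"
proof (induction j arbitrary: c c')
  case (Suc j)
  show ?case unfolding hform.simps
  proof (rule sum.cong[OF refl])
    fix i
    have "hform d j (\<lambda>I. c (i # I)) x = hform d j (\<lambda>I. c' (i # I)) x"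
      by (rule Suc.IH) (rule Suc.prems, simp)
    then show "x i * hform d j (\<lambda>I. c (i # I)) x = x i * hform d j (\<lambda>I. c' (i # I)) x" by simp
  qed
qed simp

text \<open>Product rule on the outermost factor. Symmetry brings the differentiated index to the
  front, so all \<open>j + 1\<close> positions contribute the same amount.\<close>

lemma DERIV_hform:
  assumes "swap_inv (Suc j) c"
  shows "((\<lambda>s. hform d (Suc j) c (along x v s)) has_real_derivative
    real (Suc j) * (\<Sum>k<d. v k * hform d j (\<lambda>I. c (k # I)) x)) (at 0)"
  using assms
proof (induction j arbitrary: c)
  case 0
  have "((\<lambda>s. \<Sum>i<d. (x i + s * v i) * c [i]) has_real_derivative (\<Sum>k<d. v k * c [k])) (at 0)"
  proof (rule DERIV_sum)
    fix i show "((\<lambda>s. (x i + s * v i) * c [i]) has_real_derivative v i * c [i]) (at 0)"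
      by (auto intro!: derivative_eq_intros)
  qed
  then show ?case by (simp add: along_def)
next
  case (Suc j)
  let ?h = "\<lambda>i. hform d (Suc j) (\<lambda>I. c (i # I))"
  have D: "((\<lambda>s. ?h i (along x v s)) has_real_derivative
     real (Suc j) * (\<Sum>k<d. v k * hform d j (\<lambda>I. c (i # k # I)) x)) (at 0)" for i
    using Suc.IH[OF swap_inv_Cons[OF Suc.prems, of i]] .
  have "((\<lambda>s. \<Sum>i<d. (x i + s * v i) * ?h i (along x v s)) has_real_derivative
      (\<Sum>i<d. v i * ?h i x + x i * (real (Suc j) * (\<Sum>k<d. v k * hform d j (\<lambda>I. c (i # k # I)) x)))) (at 0)"
  proof (rule DERIV_sum)
    fix i
    have "((\<lambda>s. x i + s * v i) has_real_derivative v i) (at 0)"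
      by (auto intro!: derivative_eq_intros)
    from DERIV_mult[OF this D[of i]]
    show "((\<lambda>s. (x i + s * v i) * ?h i (along x v s)) has_real_derivative
      v i * ?h i x + x i * (real (Suc j) * (\<Sum>k<d. v k * hform d j (\<lambda>I. c (i # k # I)) x))) (at 0)"
      by (simp add: algebra_simps del: hform.simps)
  qed
  moreover have "(\<Sum>i<d. v i * ?h i x + x i * (real (Suc j) * (\<Sum>k<d. v k * hform d j (\<lambda>I. c (i # k # I)) x))) =
      real (Suc (Suc j)) * (\<Sum>k<d. v k * ?h k x)"
  proof -
    have sw: "hform d j (\<lambda>I. c (i # k # I)) x = hform d j (\<lambda>I. c (k # i # I)) x" for i k
    proof (rule hform_cong)
      fix I :: "nat list" assume "length I = j"
      then show "c (i # k # I) = c (k # i # I)"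
        using Suc.prems[unfolded swap_inv_def, rule_format, of "[]" I i k] by simp
    qed
    have "(\<Sum>i<d. x i * (\<Sum>k<d. v k * hform d j (\<lambda>I. c (i # k # I)) x)) =
       (\<Sum>i<d. \<Sum>k<d. v k * (x i * hform d j (\<lambda>I. c (k # i # I)) x))"
      unfolding sw sum_distrib_left by (rule sum.cong[OF refl])+ (rule mult.left_commute)
    also have "\<dots> = (\<Sum>k<d. v k * ?h k x)"
      by (subst sum.swap) (simp add: sum_distrib_left)
    finally have e: "(\<Sum>i<d. x i * (\<Sum>k<d. v k * hform d j (\<lambda>I. c (i # k # I)) x)) = (\<Sum>k<d. v k * ?h k x)" .
    have "(\<Sum>i<d. v i * ?h i x + x i * (real (Suc j) * (\<Sum>k<d. v k * hform d j (\<lambda>I. c (i # k # I)) x))) =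
      (\<Sum>i<d. v i * ?h i x) + real (Suc j) * (\<Sum>i<d. x i * (\<Sum>k<d. v k * hform d j (\<lambda>I. c (i # k # I)) x))"
    proof -
      have "(\<Sum>i<d. a i + x i * (R * G i)) = (\<Sum>i<d. a i) + R * (\<Sum>i<d. x i * G i)" for a G and R :: real
        by (simp add: sum.distrib sum_distrib_left mult.left_commute)
      then show ?thesis .
    qed
    then show ?thesis unfolding e by (simp add: algebra_simps del: hform.simps)
  qed
  ultimately show ?case by (simp only: hform.simps(2)[of d "Suc j"]) (simp only: along_def)
qed

definition taylor_poly :: "nat \<Rightarrow> nat \<Rightarrow> (nat list \<Rightarrow> real) \<Rightarrow> (nat \<Rightarrow> real) \<Rightarrow> real" where
  "taylor_poly d n c x = (\<Sum>j<n. hform d j c x / fact j)"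

lemma DERIV_taylor_poly:
  assumes "swap_inv n c"
  shows "((\<lambda>s. taylor_poly d (Suc n) c (along x v s)) has_real_derivative
    (\<Sum>k<d. v k * taylor_poly d n (\<lambda>I. c (k # I)) x)) (at 0)"
proof -
  have D: "((\<lambda>s. \<Sum>j<n. hform d (Suc j) c (along x v s) / fact (Suc j)) has_real_derivative
     (\<Sum>j<n. (\<Sum>k<d. v k * hform d j (\<lambda>I. c (k # I)) x) / fact j)) (at 0)"
  proof (rule DERIV_sum)
    fix j assume "j \<in> {..<n}"
    then have "swap_inv (Suc j) c" using assms by (auto simp: swap_inv_def)
    from DERIV_cdivide[OF DERIV_hform[OF this], of d x v "fact (Suc j)"]
    have "((\<lambda>s. hform d (Suc j) c (along x v s) / fact (Suc j)) has_real_derivative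
       real (Suc j) * (\<Sum>k<d. v k * hform d j (\<lambda>I. c (k # I)) x) / fact (Suc j)) (at 0)" .
    moreover have "real (Suc j) * y / fact (Suc j) = y / fact j" for y :: real
      by (simp add: fact_Suc del: of_nat_Suc)
    ultimately show "((\<lambda>s. hform d (Suc j) c (along x v s) / fact (Suc j)) has_real_derivative
       (\<Sum>k<d. v k * hform d j (\<lambda>I. c (k # I)) x) / fact j) (at 0)" by (simp only:)
  qed
  have E: "taylor_poly d (Suc n) c y = c [] + (\<Sum>j<n. hform d (Suc j) c y / fact (Suc j))" for y
    unfolding taylor_poly_def by (subst sum.lessThan_Suc_shift) simp
  have F: "(\<Sum>j<n. (\<Sum>k<d. v k * hform d j (\<lambda>I. c (k # I)) x) / fact j) =
      (\<Sum>k<d. v k * taylor_poly d n (\<lambda>I. c (k # I)) x)"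
    unfolding taylor_poly_def sum_divide_distrib sum_distrib_left
    by (subst sum.swap) simp
  show ?thesis unfolding E F[symmetric]
    using DERIV_add[OF DERIV_const D, of "c []"] by (simp only: add_0)
qed

lemma taylor_poly_0: "taylor_poly d (Suc n) c (\<lambda>_. 0) = c []"
proof -
  have "taylor_poly d (Suc n) c (\<lambda>_. 0) = c [] + (\<Sum>j<n. hform d (Suc j) c (\<lambda>_. 0) / fact (Suc j))"
    unfolding taylor_poly_def by (subst sum.lessThan_Suc_shift) simp
  then show ?thesis by simp
qed

text \<open>The functions \<open>C * s ^ (r + 1) / fact (r + 1) \<mp> \<phi> s\<close> are
  nondecreasing on \<open>[0, 1]\<close>. This replaces integration of \<open>\<phi>'\<close>, which
  may be discontinuous when it comes from derivatives of top order.\<close>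

lemma growth_from_derivative:
  fixes \<phi> :: "real \<Rightarrow> real"
  assumes D: "\<And>s. (\<phi> has_real_derivative \<phi>' s) (at s)" and \<phi>0: "\<phi> 0 = 0"
    and b: "\<And>s. 0 \<le> s \<Longrightarrow> s \<le> 1 \<Longrightarrow> \<bar>\<phi>' s\<bar> \<le> C * s ^ r / fact r"
  shows "\<bar>\<phi> 1\<bar> \<le> C / fact (Suc r)"
proof -
  have DP: "((\<lambda>s. C * s ^ Suc r / fact (Suc r)) has_real_derivative C * s ^ r / fact r) (at s)" for s :: real
  proof -
    have "((\<lambda>s. C * s ^ Suc r / fact (Suc r)) has_real_derivative C * (real (Suc r) * s ^ r) / fact (Suc r)) (at s)"
      using DERIV_cdivide[OF DERIV_cmult[OF DERIV_pow[of "Suc r" s UNIV]], of C "fact (Suc r)"] by simp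
    moreover have "C * (real (Suc r) * s ^ r) / fact (Suc r) = C * s ^ r / fact r"
      by (simp add: fact_Suc del: of_nat_Suc)
    ultimately show ?thesis by (simp only:)
  qed
  have "\<phi> 1 \<le> C / fact (Suc r)"
  proof -
    have "\<exists>y. ((\<lambda>s. C * s ^ Suc r / fact (Suc r) - \<phi> s) has_real_derivative y) (at s) \<and> 0 \<le> y"
      if s: "0 \<le> s" "s \<le> 1" for s
    proof -
      have "((\<lambda>s. C * s ^ Suc r / fact (Suc r) - \<phi> s) has_real_derivative (C * s ^ r / fact r - \<phi>' s)) (at s)"
        by (rule DERIV_diff[OF DP D])
      moreover have "0 \<le> C * s ^ r / fact r - \<phi>' s" using b[OF s] by linarith
      ultimately show ?thesis by blast
    qed
    then have "C * 0 ^ Suc r / fact (Suc r) - \<phi> 0 \<le> C * 1 ^ Suc r / fact (Suc r) - \<phi> 1"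
      by (rule DERIV_nonneg_imp_nondecreasing[of 0 1, OF zero_le_one])
    then show ?thesis using \<phi>0 by simp
  qed
  moreover have "- \<phi> 1 \<le> C / fact (Suc r)"
  proof -
    have "\<exists>y. ((\<lambda>s. C * s ^ Suc r / fact (Suc r) + \<phi> s) has_real_derivative y) (at s) \<and> 0 \<le> y"
      if s: "0 \<le> s" "s \<le> 1" for s
    proof -
      have "((\<lambda>s. C * s ^ Suc r / fact (Suc r) + \<phi> s) has_real_derivative (C * s ^ r / fact r + \<phi>' s)) (at s)"
        by (rule DERIV_add[OF DP D])
      moreover have "0 \<le> C * s ^ r / fact r + \<phi>' s" using b[OF s] by linarith
      ultimately show ?thesis by blast
    qed
    then have "C * 0 ^ Suc r / fact (Suc r) + \<phi> 0 \<le> C * 1 ^ Suc r / fact (Suc r) + \<phi> 1"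
      by (rule DERIV_nonneg_imp_nondecreasing[of 0 1, OF zero_le_one])
    then show ?thesis using \<phi>0 by simp
  qed
  ultimately show ?thesis by linarith
qed

text \<open>The partial derivatives of one function up to order \<open>p\<close>; the head of the
  list is the derivative taken last. Symmetry is asked strictly below order \<open>p\<close>, where
  the derivatives in the class are themselves differentiable and hence continuous.\<close>

locale jet =
  fixes d p :: nat and U :: "nat list \<Rightarrow> (nat \<Rightarrow> real) \<Rightarrow> real"
  assumes U_deriv: "\<And>I x v. length I < p \<Longrightarrow>
      ((\<lambda>s. U I (along x v s)) has_real_derivative (\<Sum>k<d. v k * U (k # I) x)) (at 0)"
    and U_top: "\<And>I x. length I = p \<Longrightarrow> set I \<subseteq> {..<d} \<Longrightarrow> \<bar>U I x\<bar> \<le> 1"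
    and U_swap: "\<And>J i k I. length J + 2 + length I < p \<Longrightarrow> U (J @ i # k # I) = U (J @ k # i # I)"
begin

text \<open>\<open>U\<close> prepends the latest index, whereas \<open>hform\<close> consumes its
  list from the head. With \<open>rev\<close>, the index that appears when the polynomial is
  differentiated lands next to \<open>I\<close>, so the derivative in coordinate \<open>k\<close> is
  \<open>taylor_part (k # I)\<close>.\<close>

definition taylor_part :: "nat list \<Rightarrow> (nat \<Rightarrow> real) \<Rightarrow> real" where
  "taylor_part I = taylor_poly d (p - length I) (\<lambda>J. U (rev J @ I) (\<lambda>_. 0))"

definition taylor_rem :: "nat list \<Rightarrow> (nat \<Rightarrow> real) \<Rightarrow> real" where
  "taylor_rem I x = U I x - taylor_part I x"

lemma DERIV_taylor_rem:
  assumes "length I < p"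
  shows "((\<lambda>s. taylor_rem I (along x v s)) has_real_derivative (\<Sum>k<d. v k * taylor_rem (k # I) x)) (at 0)"
proof -
  obtain n where n: "p - length I = Suc n" using assms by (metis Suc_diff_Suc)
  let ?c = "\<lambda>J. U (rev J @ I) (\<lambda>_. 0)"
  have "swap_inv n ?c"
    unfolding swap_inv_def
  proof (intro allI impI)
    fix J i k K assume "length (J::nat list) + 2 + length (K::nat list) \<le> n"
    then have "U (rev K @ k # i # (rev J @ I)) = U (rev K @ i # k # (rev J @ I))"
      using n by (intro U_swap) auto
    then show "U (rev (J @ i # k # K) @ I) (\<lambda>_. 0) = U (rev (J @ k # i # K) @ I) (\<lambda>_. 0)" by simp
  qed
  note sw = this
  have A: "((\<lambda>s. U I (along x v s)) has_real_derivative (\<Sum>k<d. v k * U (k # I) x)) (at 0)"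
    by (rule U_deriv[OF assms])
  have B: "((\<lambda>s. taylor_poly d (Suc n) ?c (along x v s)) has_real_derivative
     (\<Sum>k<d. v k * taylor_poly d n (\<lambda>J. ?c (k # J)) x)) (at 0)"
    by (rule DERIV_taylor_poly[OF sw])
  from DERIV_diff[OF A B]
  have "((\<lambda>s. U I (along x v s) - taylor_poly d (Suc n) ?c (along x v s)) has_real_derivative
     (\<Sum>k<d. v k * U (k # I) x) - (\<Sum>k<d. v k * taylor_poly d n (\<lambda>J. ?c (k # J)) x)) (at 0)" .
  moreover have "p - length (k # I) = n" for k :: nat using n by simp
  ultimately show ?thesis unfolding taylor_rem_def taylor_part_def n
    by (simp add: sum_subtractf[symmetric] right_diff_distrib)
qed

text \<open>Descent from the top order along the ray from the origin: a remainder of lower order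
  vanishes at 0, and its derivative along the ray is the combination of the next remainders with
  coefficients \<open>x k\<close>. This is why the sum of the \<open>|x k|\<close> appears; passing
  to \<open>enorm\<close> then costs \<open>sqrt d\<close> per order.\<close>

lemma taylor_rem_bound:
  "length I + r = p \<Longrightarrow> set I \<subseteq> {..<d} \<Longrightarrow> \<bar>taylor_rem I x\<bar> \<le> (\<Sum>i<d. \<bar>x i\<bar>) ^ r / fact r"
proof (induction r arbitrary: I x)
  case 0
  then show ?case using U_top[of I x] by (simp add: taylor_rem_def taylor_part_def taylor_poly_def)
next
  case (Suc r)
  let ?N = "\<Sum>i<d. \<bar>x i\<bar>"
  define \<phi> where "\<phi> s = taylor_rem I (along (\<lambda>_. 0) x s)" for s
  define \<phi>' where "\<phi>' s = (\<Sum>k<d. x k * taylor_rem (k # I) (along (\<lambda>_. 0) x s))" for s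
  have len: "length I < p" "p - length I = Suc r" using Suc.prems by auto
  have D: "(\<phi> has_real_derivative \<phi>' s) (at s)" for s
    unfolding \<phi>_def \<phi>'_def by (rule DERIV_along) (rule DERIV_taylor_rem[OF len(1)])
  have \<phi>0: "\<phi> 0 = 0"
    by (simp add: \<phi>_def taylor_rem_def taylor_part_def len(2) taylor_poly_0)
  have "\<bar>\<phi>' s\<bar> \<le> ?N ^ Suc r * s ^ r / fact r" if s: "0 \<le> s" "s \<le> 1" for s
  proof -
    have "\<bar>\<phi>' s\<bar> \<le> (\<Sum>k<d. \<bar>x k\<bar> * (?N ^ r * s ^ r / fact r))"
      unfolding \<phi>'_def
    proof (rule order_trans[OF sum_abs sum_mono])
      fix k assume k: "k \<in> {..<d}"
      have "\<bar>taylor_rem (k # I) (along (\<lambda>_. 0) x s)\<bar> \<le> (\<Sum>i<d. \<bar>along (\<lambda>_. 0) x s i\<bar>) ^ r / fact r"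
        using Suc.prems k by (intro Suc.IH) auto
      also have "(\<Sum>i<d. \<bar>along (\<lambda>_. 0) x s i\<bar>) = s * ?N"
        using s by (simp add: along_def abs_mult sum_distrib_left)
      finally have "\<bar>taylor_rem (k # I) (along (\<lambda>_. 0) x s)\<bar> \<le> ?N ^ r * s ^ r / fact r"
        by (simp add: power_mult_distrib mult.commute)
      then show "\<bar>x k * taylor_rem (k # I) (along (\<lambda>_. 0) x s)\<bar> \<le> \<bar>x k\<bar> * (?N ^ r * s ^ r / fact r)"
        unfolding abs_mult by (rule mult_left_mono) simp
    qed
    also have "\<dots> = ?N ^ Suc r * s ^ r / fact r"
      unfolding sum_distrib_right[symmetric] by simp
    finally show ?thesis .
  qed
  from growth_from_derivative[OF D \<phi>0 this] show ?case by (simp add: \<phi>_def along_def)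
qed

lemma taylor_rem_bound_enorm:
  assumes "length I + r = p" "set I \<subseteq> {..<d}"
  shows "\<bar>taylor_rem I x\<bar> \<le> (sqrt (real d) * enorm d x) ^ r / fact r"
proof -
  have "(\<Sum>i<d. \<bar>x i\<bar>) ^ r \<le> (sqrt (real d) * enorm d x) ^ r"
    by (intro power_mono sum_abs_le_enorm sum_nonneg) auto
  then show ?thesis using taylor_rem_bound[OF assms, of x]
    by (meson divide_right_mono fact_ge_zero order_trans)
qed

text \<open>Linear combinations make the statement stable under differentiation in an arbitrary direction.\<close>

lemma dbound_taylor_rem_comb:
  assumes "finite S" and "\<And>I. I \<in> S \<Longrightarrow> length I + r = p \<and> set I \<subseteq> {..<d}"
  shows "dbound d r (\<lambda>j x. (\<Sum>I\<in>S. \<bar>w I\<bar>) * (sqrt (real d) ^ r * enorm d x ^ (r - j) / fact (r - j)))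
     (\<lambda>x. \<Sum>I\<in>S. w I * taylor_rem I x)"
  using assms
proof (induction r arbitrary: S w)
  have val: "\<bar>\<Sum>I\<in>S. w I * taylor_rem I x\<bar> \<le> (\<Sum>I\<in>S. \<bar>w I\<bar>) * (sqrt (real d) ^ r * enorm d x ^ (r - 0) / fact (r - 0))"
    if "\<And>I. I \<in> S \<Longrightarrow> length I + r = p \<and> set I \<subseteq> {..<d}" for S w x r
    unfolding sum_distrib_right
  proof (rule order_trans[OF sum_abs sum_mono])
    fix I assume "I \<in> S"
    then have "\<bar>taylor_rem I x\<bar> \<le> (sqrt (real d) * enorm d x) ^ r / fact r"
      using that by (intro taylor_rem_bound_enorm) auto
    then show "\<bar>w I * taylor_rem I x\<bar> \<le> \<bar>w I\<bar> * (sqrt (real d) ^ r * enorm d x ^ (r - 0) / fact (r - 0))"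
      unfolding abs_mult by (intro mult_left_mono) (auto simp: power_mult_distrib)
  qed
  {
    case 0
    then show ?case using val[of S 0 w] by simp
  next
    case (Suc r)
    show ?case unfolding dbound.simps
    proof (intro conjI allI)
      fix x
      show "\<bar>\<Sum>I\<in>S. w I * taylor_rem I x\<bar> \<le> (\<Sum>I\<in>S. \<bar>w I\<bar>) * (sqrt (real d) ^ Suc r * enorm d x ^ (Suc r - 0) / fact (Suc r - 0))"
        by (rule val) (use Suc.prems in auto)
    next
      fix v :: "nat \<Rightarrow> real"
      define S' where "S' = (\<lambda>(k, I). k # I) ` ({..<d} \<times> S)"
      define w' where "w' I = v (hd I) * w (tl I)" for I
      have inj: "inj_on (\<lambda>(k, I). k # I) ({..<d} \<times> S)" by (auto simp: inj_on_def)
      have sum': "(\<Sum>I\<in>S'. F I) = (\<Sum>k<d. \<Sum>I\<in>S. F (k # I))" for F :: "nat list \<Rightarrow> real"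
        unfolding S'_def sum.reindex[OF inj] sum.cartesian_product by (simp add: case_prod_unfold)
      have "((\<lambda>s. \<Sum>I\<in>S. w I * taylor_rem I (along x v s)) has_real_derivative (\<Sum>I\<in>S'. w' I * taylor_rem I x)) (at 0)" for x
      proof -
        have "((\<lambda>s. \<Sum>I\<in>S. w I * taylor_rem I (along x v s)) has_real_derivative
            (\<Sum>I\<in>S. w I * (\<Sum>k<d. v k * taylor_rem (k # I) x))) (at 0)"
        proof (rule DERIV_sum)
          fix I assume "I \<in> S"
          then have "length I < p" using Suc.prems(2) by fastforce
          from DERIV_cmult[OF DERIV_taylor_rem[OF this]]
          show "((\<lambda>s. w I * taylor_rem I (along x v s)) has_real_derivative w I * (\<Sum>k<d. v k * taylor_rem (k # I) x)) (at 0)" .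
        qed
        moreover have "(\<Sum>I\<in>S. w I * (\<Sum>k<d. v k * taylor_rem (k # I) x)) = (\<Sum>I\<in>S'. w' I * taylor_rem I x)"
          unfolding sum' by (subst sum.swap) (simp add: w'_def sum_distrib_left mult_ac)
        ultimately show ?thesis by simp
      qed
      moreover have "dbound d r (\<lambda>j x. enorm d v * ((\<Sum>I\<in>S. \<bar>w I\<bar>) *
          (sqrt (real d) ^ Suc r * enorm d x ^ (Suc r - Suc j) / fact (Suc r - Suc j)))) (\<lambda>x. \<Sum>I\<in>S'. w' I * taylor_rem I x)"
      proof (rule dbound_mono[OF Suc.IH])
        show "finite S'" using Suc.prems(1) by (simp add: S'_def)
        show "length I + r = p \<and> set I \<subseteq> {..<d}" if "I \<in> S'" for I
          using that Suc.prems(2) by (fastforce simp: S'_def)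
        fix j x
        have "(\<Sum>I\<in>S'. \<bar>w' I\<bar>) = (\<Sum>k<d. \<bar>v k\<bar>) * (\<Sum>I\<in>S. \<bar>w I\<bar>)"
          unfolding sum' sum_product by (simp add: w'_def abs_mult)
        also have "\<dots> \<le> sqrt (real d) * enorm d v * (\<Sum>I\<in>S. \<bar>w I\<bar>)"
          by (intro mult_right_mono sum_abs_le_enorm sum_nonneg) auto
        finally have "(\<Sum>I\<in>S'. \<bar>w' I\<bar>) * (sqrt (real d) ^ r * enorm d x ^ (r - j) / fact (r - j)) \<le>
           sqrt (real d) * enorm d v * (\<Sum>I\<in>S. \<bar>w I\<bar>) * (sqrt (real d) ^ r * enorm d x ^ (r - j) / fact (r - j))"
          by (rule mult_right_mono) auto
        then show "(\<Sum>I\<in>S'. \<bar>w' I\<bar>) * (sqrt (real d) ^ r * enorm d x ^ (r - j) / fact (r - j)) \<le>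
          enorm d v * ((\<Sum>I\<in>S. \<bar>w I\<bar>) *
          (sqrt (real d) ^ Suc r * enorm d x ^ (Suc r - Suc j) / fact (Suc r - Suc j)))"
          by (simp add: algebra_simps)
      qed
      ultimately show "\<exists>g. (\<forall>x. ((\<lambda>s. \<Sum>I\<in>S. w I * taylor_rem I (along x v s)) has_real_derivative g x) (at 0)) \<and>
         dbound d r (\<lambda>j x. enorm d v * ((\<Sum>I\<in>S. \<bar>w I\<bar>) *
          (sqrt (real d) ^ Suc r * enorm d x ^ (Suc r - Suc j) / fact (Suc r - Suc j)))) g"
        by (intro exI[of _ "\<lambda>x. \<Sum>I\<in>S'. w' I * taylor_rem I x"]) simp
    qed
  }
qed

lemma dbound_taylor_rem:
  "dbound d p (\<lambda>j x. sqrt (real d) ^ p * enorm d x ^ (p - j) / fact (p - j)) (taylor_rem [])"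
proof -
  have "dbound d p (\<lambda>j x. (\<Sum>I\<in>{[]::nat list}. \<bar>1::real\<bar>) * (sqrt (real d) ^ p * enorm d x ^ (p - j) / fact (p - j)))
     (\<lambda>x. \<Sum>I\<in>{[]}. 1 * taylor_rem I x)"
    by (rule dbound_taylor_rem_comb) auto
  then show ?thesis by simp
qed

end

section \<open>Functions of the Zolotarev class\<close>

text \<open>Membership in the class restricts a function only on \<open>Rd d\<close>, while
  \<open>along\<close> leaves this set by changing coordinates from \<open>d\<close> on. The lifted
  function lives on the whole space and ignores these coordinates.\<close>

definition lift_Rd :: "nat \<Rightarrow> ((nat \<Rightarrow> real) \<Rightarrow> real) \<Rightarrow> (nat \<Rightarrow> real) \<Rightarrow> real" where
  "lift_Rd d f x = f (restrict x {..<d})"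

lemma restrict_in_Rd [simp]: "restrict x {..<d} \<in> Rd d"
  by (auto simp: Rd_def)

lemma restrict_Rd: "x \<in> Rd d \<Longrightarrow> restrict x {..<d} = x"
  unfolding Rd_def by (rule PiE_restrict)

lemma continuous_on_restrict: "continuous_on UNIV (\<lambda>y::nat \<Rightarrow> real. restrict y {..<d})"
proof (rule continuous_on_coordinatewise_then_product)
  fix i
  show "continuous_on UNIV (\<lambda>y::nat \<Rightarrow> real. restrict y {..<d} i)"
    by (cases "i < d") (simp_all add: restrict_def continuous_on_product_coordinates)
qed

lemma continuous_on_along2:
  "continuous_on UNIV (\<lambda>st. along (along x v (fst st)) w (snd st))"
  by (rule continuous_on_coordinatewise_then_product) (auto simp: along_def intro!: continuous_intros)

lemma continuous_on_along: "continuous_on UNIV (\<lambda>s. along x v s)"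
  by (rule continuous_on_coordinatewise_then_product) (auto simp: along_def intro!: continuous_intros)

definition remainder :: "nat \<Rightarrow> ((nat \<Rightarrow> real) \<Rightarrow> real) \<Rightarrow> (nat \<Rightarrow> real) \<Rightarrow> (nat \<Rightarrow> real) \<Rightarrow> (nat \<Rightarrow> real) \<Rightarrow> real" where
  "remainder d f g x y = (f y - f x - einner d g (\<lambda>i. y i - x i)) / enorm d (\<lambda>i. y i - x i)"

lemma enorm_zero [simp]: "enorm d (\<lambda>i. 0) = 0"
  by (simp add: enorm_def L2_set_def)

lemma remainder_tendsto:
  assumes f: "(remainder d f g x \<longlongrightarrow> 0) (at x within Rd d)"
    and h: "(h \<longlongrightarrow> x) F" and hR: "\<And>s. h s \<in> Rd d"
  shows "((\<lambda>s. remainder d f g x (h s)) \<longlongrightarrow> 0) F"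
proof -
  \<comment> \<open>Division by zero gives 0, so the quotient is continuous at \<open>x\<close>
    itself and \<open>h\<close> may take the value \<open>x\<close>.\<close>
  have 0: "remainder d f g x x = 0" by (simp add: remainder_def enorm_zero)
  have "(remainder d f g x \<longlongrightarrow> remainder d f g x x) (at x within Rd d)"
    using f by (simp only: 0)
  then have "(remainder d f g x \<longlongrightarrow> remainder d f g x x) (inf (nhds x) (principal (Rd d)))"
    by (simp only: tendsto_at_within_iff_tendsto_nhds)
  moreover have "filterlim h (inf (nhds x) (principal (Rd d))) F"
    using h hR by (simp add: filterlim_inf filterlim_principal)
  ultimately show ?thesis unfolding 0 by (rule filterlim_compose)
qed

lemma remainder_eq:
  assumes "y \<in> Rd d" "x \<in> Rd d"
  shows "f y = f x + einner d g (\<lambda>i. y i - x i) + enorm d (\<lambda>i. y i - x i) * remainder d f g x y"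
proof (cases "enorm d (\<lambda>i. y i - x i) = 0")
  case True
  then have "y i = x i" if "i < d" for i
    using abs_le_enorm[OF that, of "\<lambda>i. y i - x i"] by simp
  then have "y = x" using assms unfolding Rd_def by (intro PiE_ext) auto
  then show ?thesis by (simp add: einner_def)
qed (simp add: remainder_def)

lemma tendsto_enorm_diff:
  assumes "(h \<longlongrightarrow> x) F"
  shows "((\<lambda>s. enorm d (\<lambda>i. h s i - x i)) \<longlongrightarrow> 0) F"
proof -
  have c: "((\<lambda>s. h s i) \<longlongrightarrow> x i) F" for i
    using continuous_on_tendsto_compose[OF continuous_on_product_coordinates[of i] assms] by simp
  have "((\<lambda>s. sqrt (\<Sum>i<d. (h s i - x i)\<^sup>2)) \<longlongrightarrow> sqrt (\<Sum>i<d. (x i - x i)\<^sup>2)) F"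
    by (intro tendsto_intros c)
  then show ?thesis by (simp add: enorm_def L2_set_def)
qed

lemma tendsto_einner_diff:
  assumes "(h \<longlongrightarrow> x) F"
  shows "((\<lambda>s. einner d g (\<lambda>i. h s i - x i)) \<longlongrightarrow> 0) F"
proof -
  have c: "((\<lambda>s. h s i) \<longlongrightarrow> x i) F" for i
    using continuous_on_tendsto_compose[OF continuous_on_product_coordinates[of i] assms] by simp
  have "((\<lambda>s. \<Sum>i<d. g i * (h s i - x i)) \<longlongrightarrow> (\<Sum>i<d. g i * (x i - x i))) F"
    by (intro tendsto_intros c)
  then show ?thesis by (simp add: einner_def)
qed

lemma continuous_on_lift:
  assumes "\<And>x. x \<in> Rd d \<Longrightarrow> differentiable_Rd d f x"
  shows "continuous_on UNIV (lift_Rd d f)"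
  unfolding continuous_on_def
proof
  fix z :: "nat \<Rightarrow> real"
  let ?x = "restrict z {..<d}" and ?h = "\<lambda>y::nat \<Rightarrow> real. restrict y {..<d}"
  obtain g where g: "(remainder d f g ?x \<longlongrightarrow> 0) (at ?x within Rd d)"
    using assms[of ?x] unfolding differentiable_Rd_def remainder_def by auto
  have h: "(?h \<longlongrightarrow> ?x) (at z)"
    using continuous_on_restrict[of d] by (simp add: continuous_on_def)
  have "((\<lambda>y. f ?x + einner d g (\<lambda>i. ?h y i - ?x i) + enorm d (\<lambda>i. ?h y i - ?x i) * remainder d f g ?x (?h y))
     \<longlongrightarrow> f ?x + 0 + 0 * 0) (at z)"
    by (intro tendsto_intros tendsto_einner_diff[OF h] tendsto_enorm_diff[OF h] remainder_tendsto[OF g h]) simp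
  moreover have "(\<lambda>y. f (?h y)) = (\<lambda>y. f ?x + einner d g (\<lambda>i. ?h y i - ?x i) +
      enorm d (\<lambda>i. ?h y i - ?x i) * remainder d f g ?x (?h y))"
    by (rule ext) (rule remainder_eq[OF restrict_in_Rd restrict_in_Rd])
  ultimately have "((\<lambda>y. f (?h y)) \<longlongrightarrow> f ?x + 0 + 0 * 0) (at z)" by (simp only:)
  then show "(lift_Rd d f \<longlongrightarrow> lift_Rd d f z) (at z within UNIV)"
    by (simp add: lift_Rd_def[abs_def])
qed

lemma DERIV_lift_gradient:
  assumes x: "x \<in> Rd d" and g: "(remainder d f g x \<longlongrightarrow> 0) (at x within Rd d)"
  shows "((\<lambda>s. lift_Rd d f (along x v s)) has_real_derivative einner d g v) (at 0)"
proof -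
  let ?h = "\<lambda>s. restrict (along x v s) {..<d}"
  have hx: "?h 0 = x" using restrict_Rd[OF x] by simp
  have "continuous_on UNIV ?h"
    by (rule continuous_on_compose2[OF continuous_on_restrict continuous_on_along]) auto
  then have "(?h \<longlongrightarrow> ?h 0) (at 0)" unfolding continuous_on_def by blast
  then have h: "(?h \<longlongrightarrow> x) (at 0)" by (simp only: hx)
  have e1: "einner d g (\<lambda>i. ?h s i - x i) = s * einner d g v" for s
    unfolding einner_def sum_distrib_left by (rule sum.cong[OF refl]) (simp add: along_def)
  have e2: "enorm d (\<lambda>i. ?h s i - x i) = \<bar>s\<bar> * enorm d v" for s
    unfolding enorm_scale[symmetric] by (rule enorm_cong) (simp add: along_def)
  have r: "((\<lambda>s. remainder d f g x (?h s)) \<longlongrightarrow> 0) (at 0)"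
    by (rule remainder_tendsto[OF g h]) simp
  have "((\<lambda>s. sgn s * enorm d v * remainder d f g x (?h s)) \<longlongrightarrow> 0) (at 0)"
  proof (rule Lim_null_comparison[where g = "\<lambda>s. enorm d v * \<bar>remainder d f g x (?h s)\<bar>"])
    show "eventually (\<lambda>s. norm (sgn s * enorm d v * remainder d f g x (?h s)) \<le> enorm d v * \<bar>remainder d f g x (?h s)\<bar>) (at 0)"
      by (rule always_eventually) (auto simp: abs_mult abs_sgn_eq)
    show "((\<lambda>s. enorm d v * \<bar>remainder d f g x (?h s)\<bar>) \<longlongrightarrow> 0) (at 0)"
      using tendsto_mult[OF tendsto_const tendsto_rabs[OF r], of "enorm d v"] by simp
  qed
  then have "((\<lambda>s. einner d g v + sgn s * enorm d v * remainder d f g x (?h s)) \<longlongrightarrow> einner d g v) (at 0)"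
    using tendsto_add[OF tendsto_const] by fastforce
  moreover have "eventually (\<lambda>s. einner d g v + sgn s * enorm d v * remainder d f g x (?h s) =
      (lift_Rd d f (along x v (0 + s)) - lift_Rd d f (along x v 0)) / s) (at 0)"
  proof -
    have "einner d g v + sgn s * enorm d v * remainder d f g x (?h s) =
      (lift_Rd d f (along x v (0 + s)) - lift_Rd d f (along x v 0)) / s" if "s \<noteq> 0" for s
    proof -
      have "f (?h s) = f x + einner d g (\<lambda>i. ?h s i - x i) + enorm d (\<lambda>i. ?h s i - x i) * remainder d f g x (?h s)"
        by (rule remainder_eq[OF restrict_in_Rd x])
      then have "f (?h s) - f x = s * einner d g v + \<bar>s\<bar> * enorm d v * remainder d f g x (?h s)"
        unfolding e1 e2 by simp
      moreover have "lift_Rd d f (along x v 0) = f x" "lift_Rd d f (along x v (0 + s)) = f (?h s)"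
        using hx by (simp_all add: lift_Rd_def)
      moreover have "\<bar>s\<bar> = s * sgn s" by (simp add: abs_sgn)
      ultimately show ?thesis using that by (simp add: field_simps)
    qed
    then show ?thesis by (auto simp: eventually_at_filter)
  qed
  ultimately show ?thesis
    unfolding DERIV_def by (rule Lim_transform_eventually)
qed

lemma partial_deriv_eq_gradient:
  assumes x: "x \<in> Rd d" and g: "(remainder d f g x \<longlongrightarrow> 0) (at x within Rd d)" and i: "i < d"
  shows "partial_deriv i f x = g i"
proof -
  let ?e = "\<lambda>j. if j = i then 1 else (0::real)"
  have "lift_Rd d f (along x ?e s) = f (x(i := s + x i))" for s
  proof -
    have "restrict (along x ?e s) {..<d} = x(i := s + x i)"
      using x i unfolding Rd_def by (auto simp: along_def fun_eq_iff restrict_def PiE_iff extensional_def)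
    then show ?thesis by (simp add: lift_Rd_def)
  qed
  moreover have "einner d g ?e = g i"
    using i by (simp add: einner_def if_distrib sum.delta cong: if_cong)
  ultimately have "((\<lambda>s. f (x(i := s + x i))) has_real_derivative g i) (at 0)"
    using DERIV_lift_gradient[OF x g, of ?e] by simp
  then have "((\<lambda>t. f (x(i := t))) has_real_derivative g i) (at (x i))"
    using DERIV_shift[of "\<lambda>t. f (x(i := t))" "g i" 0 "x i"] by simp
  then show ?thesis unfolding partial_deriv_def by (rule DERIV_imp_deriv)
qed

lemma DERIV_lift:
  assumes "\<And>x. x \<in> Rd d \<Longrightarrow> differentiable_Rd d f x"
  shows "((\<lambda>s. lift_Rd d f (along x v s)) has_real_derivative (\<Sum>k<d. v k * lift_Rd d (partial_deriv k f) x)) (at 0)"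
proof -
  let ?x = "restrict x {..<d}"
  obtain g where g: "(remainder d f g ?x \<longlongrightarrow> 0) (at ?x within Rd d)"
    using assms[of ?x] unfolding differentiable_Rd_def remainder_def by auto
  have "lift_Rd d f (along ?x v s) = lift_Rd d f (along x v s)" for s
    unfolding lift_Rd_def by (rule arg_cong[where f = f]) (auto simp: along_def restrict_def fun_eq_iff)
  moreover have "einner d g v = (\<Sum>k<d. v k * lift_Rd d (partial_deriv k f) x)"
    unfolding einner_def lift_Rd_def
    by (rule sum.cong[OF refl]) (simp add: partial_deriv_eq_gradient[OF restrict_in_Rd g])
  ultimately show ?thesis using DERIV_lift_gradient[OF restrict_in_Rd g, of v] by simp
qed

text \<open>Clairaut's theorem. The second difference over the parallelogram with sides
  \<open>h * u\<close> and \<open>h * v\<close> is symmetric in the two directions. Two mean value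
  steps in either order write it as \<open>h * h\<close> times a value of \<open>G\<close>, or of
  \<open>H\<close>, near \<open>x\<close>; continuity concludes as \<open>h\<close> tends to
  0.\<close>

lemma mixed_derivatives_eq:
  fixes F Fi Fk G H :: "(nat \<Rightarrow> real) \<Rightarrow> real"
  assumes Fi: "\<And>x. ((\<lambda>s. F (along x u s)) has_real_derivative Fi x) (at 0)"
    and Fk: "\<And>x. ((\<lambda>s. F (along x v s)) has_real_derivative Fk x) (at 0)"
    and G: "\<And>x. ((\<lambda>s. Fi (along x v s)) has_real_derivative G x) (at 0)"
    and H: "\<And>x. ((\<lambda>s. Fk (along x u s)) has_real_derivative H x) (at 0)"
    and cG: "continuous_on UNIV G" and cH: "continuous_on UNIV H"
  shows "G x = H x"
proof -
  have key: "\<exists>s t. 0 \<le> s \<and> s \<le> h \<and> 0 \<le> t \<and> t \<le> h \<and>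
      F (along (along x u h) v h) - F (along x u h) - F (along x v h) + F x = h * h * G (along (along x u s) v t)"
    if h: "0 < h"
      and Fi: "\<And>x. ((\<lambda>s. F (along x u s)) has_real_derivative Fi x) (at 0)"
      and G: "\<And>x. ((\<lambda>s. Fi (along x v s)) has_real_derivative G x) (at 0)" for h u v Fi G
  proof -
    let ?\<psi> = "\<lambda>s. F (along (along x u s) v h) - F (along x u s)"
    have "(?\<psi> has_real_derivative Fi (along (along x u s) v h) - Fi (along x u s)) (at s)" for s
    proof -
      have "((\<lambda>s. F (along (along x v h) u s)) has_real_derivative Fi (along (along x v h) u s)) (at s)"
        by (rule DERIV_along[OF Fi])
      from DERIV_diff[OF this DERIV_along[OF Fi, of x s]] show ?thesis
        by (simp only: along_commute[of x v h u])
    qed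
    then obtain s where s: "0 < s" "s < h" "?\<psi> h - ?\<psi> 0 = (h - 0) * (Fi (along (along x u s) v h) - Fi (along x u s))"
      using MVT2[OF h, of ?\<psi> "\<lambda>s. Fi (along (along x u s) v h) - Fi (along x u s)"] by blast
    obtain t where t: "0 < t" "t < h" "Fi (along (along x u s) v h) - Fi (along (along x u s) v 0) = (h - 0) * G (along (along x u s) v t)"
      using MVT2[OF h, of "\<lambda>t. Fi (along (along x u s) v t)" "\<lambda>t. G (along (along x u s) v t)"]
        DERIV_along[OF G, of "along x u s"] by blast
    have "?\<psi> h - ?\<psi> 0 = h * h * G (along (along x u s) v t)"
      using s(3) t(3) by simp
    then show ?thesis using s(1,2) t(1,2) by (intro exI[of _ s] exI[of _ t]) simp
  qed
  have "\<forall>n::nat. \<exists>s t s' t'. 0 \<le> s \<and> s \<le> inverse (Suc n) \<and> 0 \<le> t \<and> t \<le> inverse (Suc n) \<and>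
     0 \<le> s' \<and> s' \<le> inverse (Suc n) \<and> 0 \<le> t' \<and> t' \<le> inverse (Suc n) \<and>
     G (along (along x u s) v t) = H (along (along x v s') u t')"
  proof
    fix n :: nat
    let ?h = "inverse (real (Suc n))"
    have h: "0 < ?h" by simp
    obtain s t where 1: "0 \<le> s" "s \<le> ?h" "0 \<le> t" "t \<le> ?h"
      "F (along (along x u ?h) v ?h) - F (along x u ?h) - F (along x v ?h) + F x = ?h * ?h * G (along (along x u s) v t)"
      using key[OF h Fi G] by blast
    obtain s' t' where 2: "0 \<le> s'" "s' \<le> ?h" "0 \<le> t'" "t' \<le> ?h"
      "F (along (along x v ?h) u ?h) - F (along x v ?h) - F (along x u ?h) + F x = ?h * ?h * H (along (along x v s') u t')"
      using key[OF h Fk H] by blast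
    have "?h * ?h * G (along (along x u s) v t) = ?h * ?h * H (along (along x v s') u t')"
      using 1(5) 2(5) unfolding along_commute[of x u ?h v ?h] by linarith
    then have "G (along (along x u s) v t) = H (along (along x v s') u t')" by simp
    then show "\<exists>s t s' t'. 0 \<le> s \<and> s \<le> inverse (Suc n) \<and> 0 \<le> t \<and> t \<le> inverse (Suc n) \<and>
     0 \<le> s' \<and> s' \<le> inverse (Suc n) \<and> 0 \<le> t' \<and> t' \<le> inverse (Suc n) \<and>
     G (along (along x u s) v t) = H (along (along x v s') u t')"
      using 1(1-4) 2(1-4) by blast
  qed
  then obtain s t s' t' where st: "\<And>n. 0 \<le> s n \<and> s n \<le> inverse (Suc n) \<and> 0 \<le> t n \<and> t n \<le> inverse (Suc n) \<and>
     0 \<le> s' n \<and> s' n \<le> inverse (Suc n) \<and> 0 \<le> t' n \<and> t' n \<le> inverse (Suc n) \<and>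
     G (along (along x u (s n)) v (t n)) = H (along (along x v (s' n)) u (t' n))" by metis
  have lim: "r \<longlonglongrightarrow> 0" if "\<And>n. 0 \<le> r n \<and> r n \<le> inverse (real (Suc n))" for r :: "nat \<Rightarrow> real"
    by (rule tendsto_sandwich[OF _ _ tendsto_const LIMSEQ_inverse_real_of_nat]) (use that in auto)
  have conv: "(\<lambda>n. K (along (along x a (r n)) b (r' n))) \<longlonglongrightarrow> K x"
    if "continuous_on UNIV K" "r \<longlonglongrightarrow> 0" "r' \<longlonglongrightarrow> 0" for K r r' a b
  proof -
    have c: "continuous_on UNIV (\<lambda>st. K (along (along x a (fst st)) b (snd st)))"
      by (rule continuous_on_compose2[OF that(1) continuous_on_along2]) auto
    have "(\<lambda>n. (r n, r' n)) \<longlonglongrightarrow> (0, 0)" by (intro tendsto_Pair that)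
    from continuous_on_tendsto_compose[OF c this] show ?thesis by simp
  qed
  have "(\<lambda>n. G (along (along x u (s n)) v (t n))) \<longlonglongrightarrow> G x"
    by (rule conv[OF cG lim lim]) (use st in auto)
  moreover have "(\<lambda>n. H (along (along x v (s' n)) u (t' n))) \<longlonglongrightarrow> H x"
    by (rule conv[OF cH lim lim]) (use st in auto)
  moreover have "(\<lambda>n. G (along (along x u (s n)) v (t n))) = (\<lambda>n. H (along (along x v (s' n)) u (t' n)))"
    using st by (intro ext) blast
  ultimately have "(\<lambda>n. H (along (along x v (s' n)) u (t' n))) \<longlonglongrightarrow> G x" by (simp only:)
  then show ?thesis using LIMSEQ_unique \<open>(\<lambda>n. H (along (along x v (s' n)) u (t' n))) \<longlonglongrightarrow> H x\<close> by blast
qed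

lemma foldr_partial_deriv_cong:
  assumes "\<And>x. x \<in> Rd d \<Longrightarrow> f x = g x" and "set J \<subseteq> {..<d}" and "x \<in> Rd d"
  shows "foldr partial_deriv J f x = foldr partial_deriv J g x"
  using assms(2,3)
proof (induction J arbitrary: x)
  case Nil
  then show ?case using assms(1) by simp
next
  case (Cons i J)
  have "x(i := t) \<in> Rd d" for t
    using Cons.prems by (auto simp: Rd_def PiE_iff extensional_def)
  then have "foldr partial_deriv J f (x(i := t)) = foldr partial_deriv J g (x(i := t))" for t
    using Cons by simp
  then have "(\<lambda>t. foldr partial_deriv J f (x(i := t))) = (\<lambda>t. foldr partial_deriv J g (x(i := t)))"
    by (rule ext)
  then show ?case unfolding foldr.simps o_apply partial_deriv_def[of i] by (simp only:)
qed

lemma times_differentiable_foldr: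
  assumes "times_differentiable d p u" "length I < p" "set I \<subseteq> {..<d}" "x \<in> Rd d"
  shows "differentiable_Rd d (foldr partial_deriv I u) x"
  using assms
proof (induction p arbitrary: u I)
  case (Suc p)
  show ?case
  proof (cases I rule: rev_cases)
    case Nil
    then show ?thesis using Suc.prems by simp
  next
    case (snoc J i)
    then show ?thesis using Suc by simp
  qed
qed simp

text \<open>Lists containing an index outside \<open>{..<d}\<close> get the zero function, so that
  the laws of \<open>jet\<close> hold for all lists without side conditions.\<close>

definition class_jet :: "nat \<Rightarrow> ((nat \<Rightarrow> real) \<Rightarrow> real) \<Rightarrow> nat list \<Rightarrow> (nat \<Rightarrow> real) \<Rightarrow> real" where
  "class_jet d u I = (if set I \<subseteq> {..<d} then lift_Rd d (foldr partial_deriv I u) else (\<lambda>_. 0))"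

lemma class_jet_eq: "set I \<subseteq> {..<d} \<Longrightarrow> x \<in> Rd d \<Longrightarrow> class_jet d u I x = foldr partial_deriv I u x"
  by (simp add: class_jet_def lift_Rd_def restrict_Rd)

lemma class_jet:
  assumes u: "u \<in> zolotarev_class d p"
  shows "jet d p (class_jet d u)"
proof
  have td: "times_differentiable d p u" using u by (simp add: zolotarev_class_def)
  note dif = times_differentiable_foldr[OF td]
  show deriv: "((\<lambda>s. class_jet d u I (along x v s)) has_real_derivative (\<Sum>k<d. v k * class_jet d u (k # I) x)) (at 0)"
    if "length I < p" for I x v
  proof (cases "set I \<subseteq> {..<d}")
    case True
    have cj: "class_jet d u I = lift_Rd d (foldr partial_deriv I u)"
      using True by (simp add: class_jet_def)
    have eq: "(\<Sum>k<d. v k * class_jet d u (k # I) x) = (\<Sum>k<d. v k * lift_Rd d (partial_deriv k (foldr partial_deriv I u)) x)"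
      using True by (intro sum.cong) (auto simp: class_jet_def)
    show ?thesis unfolding cj eq
      by (rule DERIV_lift) (rule dif[OF that True])
  next
    case False
    then show ?thesis by (simp add: class_jet_def)
  qed
  show "\<bar>class_jet d u I x\<bar> \<le> 1" if "length I = p" "set I \<subseteq> {..<d}" for I x
    using u that by (simp add: class_jet_def zolotarev_class_def lift_Rd_def)
  have cont: "continuous_on UNIV (class_jet d u I)" if "length I < p" for I
    using dif[OF that] by (auto simp: class_jet_def intro!: continuous_on_lift)
  show "class_jet d u (J @ i # k # I) = class_jet d u (J @ k # i # I)"
    if l: "length J + 2 + length I < p" for J i k I
  proof (cases "set J \<subseteq> {..<d} \<and> i < d \<and> k < d \<and> set I \<subseteq> {..<d}")
    case True
    let ?e = "\<lambda>i j. if j = i then 1 else (0::real)"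
    have unit: "((\<lambda>s. class_jet d u K (along x (?e j) s)) has_real_derivative class_jet d u (j # K) x) (at 0)"
      if "length K < p" "j < d" for K j x
    proof -
      have "(\<Sum>k<d. ?e j k * class_jet d u (k # K) x) = (\<Sum>k<d. if k = j then class_jet d u (j # K) x else 0)"
        by (rule sum.cong) auto
      then show ?thesis using deriv[OF that(1), of x "?e j"] that(2) by simp
    qed
    \<comment> \<open>The swapped derivatives act right after those in \<open>I\<close>. The
      derivatives in \<open>J\<close> are then applied to two functions that agree on
      \<open>Rd d\<close>.\<close>
    have "class_jet d u (i # k # I) x = class_jet d u (k # i # I) x" for x
      by (rule mixed_derivatives_eq[where F = "class_jet d u I" and Fi = "class_jet d u (k # I)"
            and Fk = "class_jet d u (i # I)" and u = "?e k" and v = "?e i"])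
        (use l True in \<open>auto intro!: unit cont\<close>)
    then have "foldr partial_deriv (i # k # I) u x = foldr partial_deriv (k # i # I) u x" if "x \<in> Rd d" for x
      using class_jet_eq[OF _ that, of "i # k # I" u] class_jet_eq[OF _ that, of "k # i # I" u] True by simp
    then have "foldr partial_deriv J (foldr partial_deriv (i # k # I) u) x =
        foldr partial_deriv J (foldr partial_deriv (k # i # I) u) x" if "x \<in> Rd d" for x
      using True that by (intro foldr_partial_deriv_cong) auto
    then show ?thesis using True by (auto simp: class_jet_def lift_Rd_def fun_eq_iff)
  next
    case False
    then show ?thesis by (auto simp: class_jet_def)
  qed
qed

lemma differentiable_Rd_coordinate:
  assumes D: "(h has_real_derivative D) (at (x 0))"
  shows "differentiable_Rd 1 (\<lambda>x. h (x 0)) x"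
proof -
  define r where "r t = (h t - h (x 0) - D * (t - x 0)) / \<bar>t - x 0\<bar>" for t
  have "(r \<longlongrightarrow> r (x 0)) (at (x 0))"
    using D unfolding r_def[abs_def] by (simp add: has_field_derivative_def has_derivative_at_within)
      (simp add: divide_inverse mult.commute)
  then have "(r \<longlongrightarrow> r (x 0)) (nhds (x 0))"
    by (rule tendsto_at_iff_tendsto_nhds[THEN iffD1])
  moreover have "((\<lambda>y::nat \<Rightarrow> real. y 0) \<longlongrightarrow> x 0) (at x within Rd 1)"
    using continuous_on_product_coordinates[of "0::nat"]
    by (auto simp: continuous_on_def intro: tendsto_within_subset)
  ultimately have "((\<lambda>y. r (y 0)) \<longlongrightarrow> r (x 0)) (at x within Rd 1)"
    by (rule filterlim_compose)
  then show ?thesis unfolding differentiable_Rd_def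
    by (intro exI[of _ "\<lambda>_. D"]) (simp add: einner_def enorm_def L2_set_def r_def)
qed

text \<open>The test functions used on the line, cosines and powers, have explicit derivatives of
  all orders; naming this chain replaces computing iterated partial derivatives.\<close>

lemma chain_in_zolotarev_class:
  fixes h :: "nat \<Rightarrow> real \<Rightarrow> real"
  assumes D: "\<And>j t. (h j has_real_derivative h (Suc j) t) (at t)" and b: "\<And>t. \<bar>h p t\<bar> \<le> 1"
  shows "(\<lambda>x. h 0 (x 0)) \<in> zolotarev_class 1 p"
proof -
  have pd: "partial_deriv 0 (\<lambda>x. h j (x 0)) = (\<lambda>x. h (Suc j) (x 0))" for j
    unfolding partial_deriv_def using DERIV_imp_deriv[OF D[of j]] by (simp add: fun_eq_iff)
  have "times_differentiable 1 n (\<lambda>x. h j (x 0))" for n j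
  proof (induction n arbitrary: j)
    case (Suc n)
    show ?case unfolding times_differentiable.simps
      using Suc differentiable_Rd_coordinate[OF D] by (simp add: pd del: One_nat_def)
  qed simp
  moreover have "foldr partial_deriv is (\<lambda>x. h j (x 0)) = (\<lambda>x. h (j + length is) (x 0))"
    if "set is \<subseteq> {..<1}" for "is" j
    using that by (induction "is") (auto simp: pd)
  ultimately show ?thesis using b by (auto simp: zolotarev_class_def)
qed

section \<open>Moments and one-dimensional marginals\<close>

locale moment_prob = prob_space M for M :: "(nat \<Rightarrow> real) measure" +
  fixes d :: nat and q b :: real
  assumes sets_M: "sets M = sets (borel_Rd d)"
    and q_pos: "0 < q" and b_nonneg: "0 \<le> b"
    and moment: "(\<integral>\<^sup>+ x. ennreal (enorm d x powr q) \<partial>M) \<le> ennreal (b powr q)"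
begin

lemma space_M: "space M = Rd d"
  using sets_eq_imp_space_eq[OF sets_M] by (simp add: borel_Rd_def space_PiM Rd_def)

lemma measurable_coord: "i < d \<Longrightarrow> (\<lambda>x. x i) \<in> borel_measurable M"
  unfolding measurable_cong_sets[OF sets_M refl] borel_Rd_def
  by (rule measurable_component_singleton) simp

lemma measurable_einner: "(\<lambda>x. einner d x y) \<in> borel_measurable M"
  unfolding einner_def by (intro borel_measurable_sum borel_measurable_times measurable_coord) auto

lemma measurable_enorm: "enorm d \<in> borel_measurable M"
proof -
  have "(\<lambda>x. sqrt (\<Sum>i<d. (x i)\<^sup>2)) \<in> borel_measurable M"
    by (rule measurable_compose[OF _ borel_measurable_sqrt])
      (intro borel_measurable_sum borel_measurable_power measurable_coord, auto)
  then show ?thesis by (simp add: enorm_def[abs_def] L2_set_def)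
qed

lemma measurable_continuous:
  fixes F :: "(nat \<Rightarrow> real) \<Rightarrow> real"
  assumes "continuous_on UNIV F"
  shows "F \<in> borel_measurable M"
proof -
  have "(\<lambda>x. restrict x {..<d}) \<in> borel_measurable M"
  proof (rule measurable_coordinatewise_then_product)
    fix i show "(\<lambda>x. restrict x {..<d} i) \<in> borel_measurable M"
      by (cases "i < d") (simp_all add: measurable_coord)
  qed
  moreover have "F \<in> borel_measurable borel"
    using assms by (rule borel_measurable_continuous_onI)
  ultimately have "(\<lambda>x. F (restrict x {..<d})) \<in> borel_measurable M"
    by (rule measurable_compose)
  then show ?thesis
    by (rule measurable_cong[THEN iffD1, rotated]) (simp add: space_M restrict_Rd)
qed

lemma integrable_moment: "integrable M (\<lambda>x. enorm d x powr q)"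
  and integral_moment: "(\<integral>x. enorm d x powr q \<partial>M) \<le> b powr q"
proof -
  have m: "(\<lambda>x. enorm d x powr q) \<in> borel_measurable M"
  proof -
    note measurable_enorm[measurable]
    show ?thesis by measurable
  qed
  have fin: "(\<integral>\<^sup>+ x. ennreal (norm (enorm d x powr q)) \<partial>M) < \<infinity>"
    using moment by (simp add: le_less_trans)
  show "integrable M (\<lambda>x. enorm d x powr q)"
    by (rule integrableI_bounded[OF m fin])
  have "ennreal (\<integral>x. enorm d x powr q \<partial>M) \<le> ennreal (b powr q)"
    using moment by (subst nn_integral_eq_integral[symmetric]) (auto intro: integrableI_bounded[OF m fin])
  then show "(\<integral>x. enorm d x powr q \<partial>M) \<le> b powr q" by simp
qed

lemma power_le_one_plus_powr:
  assumes "0 \<le> t" "real k \<le> q"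
  shows "t ^ k \<le> 1 + t powr q"
proof (cases "t \<le> 1")
  case True
  then have "t ^ k \<le> 1" using assms by (simp add: power_le_one)
  then show ?thesis by (meson add_increasing2 powr_ge_zero)
next
  case False
  then have "t ^ k = t powr real k" by (simp add: powr_realpow)
  also have "\<dots> \<le> t powr q" using False assms by (intro powr_mono) auto
  finally show ?thesis by simp
qed

lemma integrable_of_growth:
  assumes g: "g \<in> borel_measurable M" and k: "real k \<le> q" and le: "\<And>x. \<bar>g x\<bar> \<le> C * enorm d x ^ k"
  shows "integrable M (g :: _ \<Rightarrow> real)"
proof (rule Bochner_Integration.integrable_bound)
  show "integrable M (\<lambda>x. \<bar>C\<bar> * (1 + enorm d x powr q))"
    using integrable_moment by (intro integrable_mult_right Bochner_Integration.integrable_add) auto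
  show "AE x in M. norm (g x) \<le> norm (\<bar>C\<bar> * (1 + enorm d x powr q))"
  proof (rule AE_I2)
    fix x
    have "\<bar>g x\<bar> \<le> \<bar>C\<bar> * enorm d x ^ k"
      using le[of x] by (rule order_trans) (simp add: mult_right_mono)
    also have "\<dots> \<le> \<bar>C\<bar> * (1 + enorm d x powr q)"
      using k by (intro mult_left_mono power_le_one_plus_powr) auto
    finally show "norm (g x) \<le> norm (\<bar>C\<bar> * (1 + enorm d x powr q))" by simp
  qed
qed (rule g)

lemma measurable_marginal_map: "(\<lambda>x. \<lambda>i\<in>{..<1}. einner d x \<theta>) \<in> measurable M (borel_Rd 1)"
  unfolding borel_Rd_def by (rule measurable_restrict) (rule measurable_einner)

lemma integral_marginal:
  fixes h :: "real \<Rightarrow> real"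
  assumes "h \<in> borel_measurable borel"
  shows "(\<integral>y. h (y 0) \<partial>marginal d \<theta> M) = (\<integral>x. h (einner d x \<theta>) \<partial>M)"
proof -
  have "(\<lambda>y::nat \<Rightarrow> real. y 0) \<in> borel_measurable (borel_Rd 1)"
    unfolding borel_Rd_def by (rule measurable_component_singleton) simp
  then have "(\<lambda>y. h (y 0)) \<in> borel_measurable (borel_Rd 1)"
    using assms by (rule measurable_compose)
  from integral_distr[OF measurable_marginal_map this] show ?thesis
    by (simp add: marginal_def)
qed

end

text \<open>\<open>Z\<close> is any finite bound rather than the supremum itself. Finiteness is what
  forces moments to agree, and the freedom to enlarge \<open>Z\<close> later makes it
  positive.\<close>

locale zol_pair = P: moment_prob \<mu> d q b + Q: moment_prob \<nu> d q b
  for \<mu> \<nu> :: "(nat \<Rightarrow> real) measure" and d :: nat and q b :: real +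
  fixes p :: nat and Z :: real
  assumes p_pos: "1 \<le> p" and d_pos: "1 \<le> d" and p_less_q: "real p < q" and Z_nonneg: "0 \<le> Z"
    and Z: "\<And>\<theta>. \<theta> \<in> usphere d \<Longrightarrow> zolotarev 1 p (marginal d \<theta> \<mu>) (marginal d \<theta> \<nu>) \<le> ennreal Z"
begin

definition \<Lambda> :: "((nat \<Rightarrow> real) \<Rightarrow> real) \<Rightarrow> real" where
  "\<Lambda> g = (\<integral>x. g x \<partial>\<mu>) - (\<integral>x. g x \<partial>\<nu>)"

lemma chain_bound:
  fixes h :: "nat \<Rightarrow> real \<Rightarrow> real"
  assumes D: "\<And>j t. (h j has_real_derivative h (Suc j) t) (at t)" and b: "\<And>t. \<bar>h p t\<bar> \<le> 1"
    and \<theta>: "\<theta> \<in> usphere d"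
  shows "\<bar>\<Lambda> (\<lambda>x. h 0 (einner d x \<theta>))\<bar> \<le> Z"
proof -
  have "continuous_on UNIV (h 0)"
    using D by (auto intro!: DERIV_continuous_on intro: has_field_derivative_at_within)
  then have m: "h 0 \<in> borel_measurable borel" by (rule borel_measurable_continuous_onI)
  have "ennreal \<bar>\<Lambda> (\<lambda>x. h 0 (einner d x \<theta>))\<bar> =
      ennreal \<bar>(\<integral>y. h 0 (y 0) \<partial>marginal d \<theta> \<mu>) - (\<integral>y. h 0 (y 0) \<partial>marginal d \<theta> \<nu>)\<bar>"
    unfolding \<Lambda>_def P.integral_marginal[OF m] Q.integral_marginal[OF m] ..
  also have "\<dots> \<le> zolotarev 1 p (marginal d \<theta> \<mu>) (marginal d \<theta> \<nu>)"
    unfolding zolotarev_def by (rule SUP_upper[OF chain_in_zolotarev_class[OF D b]])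
  also have "\<dots> \<le> ennreal Z" by (rule Z[OF \<theta>])
  finally show ?thesis using Z_nonneg by simp
qed

definition direction :: "(nat \<Rightarrow> real) \<Rightarrow> nat \<Rightarrow> real" where
  "direction \<xi> = (\<lambda>i\<in>{..<d}. \<xi> i / enorm d \<xi>)"

lemma direction_usphere: "enorm d \<xi> \<noteq> 0 \<Longrightarrow> direction \<xi> \<in> usphere d"
proof -
  assume n: "enorm d \<xi> \<noteq> 0"
  have "enorm d (direction \<xi>) = enorm d (\<lambda>i. (1 / enorm d \<xi>) * \<xi> i)"
    by (rule enorm_cong) (simp add: direction_def)
  also have "\<dots> = 1" unfolding enorm_scale using n by simp
  finally show ?thesis by (simp add: usphere_def direction_def)
qed

lemma einner_direction: "enorm d \<xi> \<noteq> 0 \<Longrightarrow> einner d x \<xi> = enorm d \<xi> * einner d x (direction \<xi>)"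
  by (simp add: einner_def direction_def sum_distrib_left)

lemma einner_zero: "enorm d \<xi> = 0 \<Longrightarrow> einner d x \<xi> = 0"
  using abs_einner_le[of d x \<xi>] by simp

lemma \<Lambda>_const [simp]: "\<Lambda> (\<lambda>_. c) = 0"
  by (simp add: \<Lambda>_def P.prob_space Q.prob_space)

lemma trig_bound: "\<bar>\<Lambda> (\<lambda>x. cos (einner d x \<xi> + a))\<bar> \<le> Z * enorm d \<xi> ^ p"
proof (cases "enorm d \<xi> = 0")
  case True
  then have "(\<lambda>x. cos (einner d x \<xi> + a)) = (\<lambda>_. cos a)" by (simp add: einner_zero)
  then show ?thesis using Z_nonneg by simp
next
  case False
  define \<tau> where "\<tau> = enorm d \<xi>"
  have \<tau>: "0 < \<tau>" using False by (simp add: \<tau>_def order.not_eq_order_implies_strict)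
  \<comment> \<open>Each differentiation multiplies by \<open>\<tau>\<close> and advances the phase
    by \<open>pi / 2\<close>; division by \<open>\<tau> ^ p\<close> normalizes the
    \<open>p\<close>-th derivative to be bounded by 1.\<close>
  define h where "h j t = \<tau> ^ j / \<tau> ^ p * cos (\<tau> * t + a + real j * (pi / 2))" for j t
  have D: "(h j has_real_derivative h (Suc j) t) (at t)" for j t
  proof -
    have ceq: "cos (\<tau> * t + a + real (Suc j) * (pi / 2)) = - sin (\<tau> * t + a + real j * (pi / 2))"
    proof -
      have e: "\<tau> * t + a + real (Suc j) * (pi / 2) = (\<tau> * t + a + real j * (pi / 2)) + pi / 2"
        by (simp add: algebra_simps add_divide_distrib)
      show ?thesis unfolding e cos_add by simp
    qed
    have "((\<lambda>t. K * cos (\<tau> * t + a + c)) has_real_derivative K * (- sin (\<tau> * t + a + c) * \<tau>)) (at t)" for K c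
      by (auto intro!: derivative_eq_intros)
    from this[of "\<tau> ^ j / \<tau> ^ p" "real j * (pi / 2)"] show ?thesis
      unfolding h_def ceq by (simp add: mult_ac)
  qed
  have "\<bar>\<Lambda> (\<lambda>x. h 0 (einner d x (direction \<xi>)))\<bar> \<le> Z"
    by (rule chain_bound[where h = h, OF D]) (use \<tau> False in \<open>auto simp: h_def abs_mult intro: direction_usphere\<close>)
  moreover have "h 0 (einner d x (direction \<xi>)) = cos (einner d x \<xi> + a) / \<tau> ^ p" for x
    using einner_direction[OF False, of x] by (simp add: h_def \<tau>_def)
  ultimately have "\<bar>\<Lambda> (\<lambda>x. cos (einner d x \<xi> + a))\<bar> / \<tau> ^ p \<le> Z"
    using \<tau> by (simp add: \<Lambda>_def diff_divide_distrib[symmetric])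
  then show ?thesis using \<tau> by (simp add: \<tau>_def field_simps)
qed

definition agree :: "((nat \<Rightarrow> real) \<Rightarrow> real) \<Rightarrow> bool" where
  "agree g \<longleftrightarrow> integrable \<mu> g \<and> integrable \<nu> g \<and> \<Lambda> g = 0"

lemma agree_sum:
  assumes "\<And>i. i \<in> A \<Longrightarrow> agree (f i)"
  shows "agree (\<lambda>x. \<Sum>i\<in>A. f i x)"
  using assms by (simp add: agree_def \<Lambda>_def Bochner_Integration.integral_sum)

lemma agree_cmult: "agree f \<Longrightarrow> agree (\<lambda>x. c * f x)"
  by (simp add: agree_def \<Lambda>_def)

text \<open>A power of degree below \<open>p\<close> has vanishing \<open>p\<close>-th derivative,
  so all its multiples are admissible test functions. A number whose multiples are all bounded by
  \<open>Z\<close> is 0.\<close>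

lemma power_moment:
  assumes k: "k < p"
  shows "\<Lambda> (\<lambda>x. einner d x \<theta> ^ k) = 0"
proof (cases "enorm d \<theta> = 0")
  case True
  then have "(\<lambda>x. einner d x \<theta> ^ k) = (\<lambda>_. 0 ^ k)" by (simp add: einner_zero)
  then show ?thesis by simp
next
  case False
  let ?u = "direction \<theta>"
  have "\<bar>s * \<Lambda> (\<lambda>x. einner d x ?u ^ k)\<bar> \<le> Z" for s
  proof -
    define h where "h j t = (if j \<le> k then s * (fact k / fact (k - j)) * t ^ (k - j) else 0)" for j and t :: real
    have D: "(h j has_real_derivative h (Suc j) t) (at t)" for j t
    proof (cases "j < k")
      case True
      then obtain r where r: "k - j = Suc r" by (metis Suc_diff_Suc)
      then have "k - Suc j = r" by simp
      have "((\<lambda>t. s * (fact k / fact (Suc r)) * t ^ Suc r) has_real_derivative s * (fact k / fact (Suc r)) * (real (Suc r) * t ^ r)) (at t)"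
        using DERIV_cmult[OF DERIV_pow[of "Suc r" t UNIV], of "s * (fact k / fact (Suc r))"]
        by (simp del: fact_Suc of_nat_Suc power_Suc)
      moreover have "s * (fact k / fact (Suc r)) * (real (Suc r) * t ^ r) = s * (fact k / fact r) * t ^ r"
        by (simp add: fact_Suc del: of_nat_Suc)
      moreover have "h j = (\<lambda>t. s * (fact k / fact (Suc r)) * t ^ Suc r)"
        using True r by (simp add: h_def fun_eq_iff del: fact_Suc power_Suc)
      moreover have "h (Suc j) t = s * (fact k / fact r) * t ^ r"
        using True \<open>k - Suc j = r\<close> by (simp add: h_def)
      ultimately show ?thesis by (simp only:)
    next
      case False
      then show ?thesis by (cases "j = k") (simp_all add: h_def[abs_def])
    qed
    have "\<bar>\<Lambda> (\<lambda>x. h 0 (einner d x ?u))\<bar> \<le> Z"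
      by (rule chain_bound[where h = h, OF D]) (use k False in \<open>auto simp: h_def intro: direction_usphere\<close>)
    then show ?thesis by (simp add: h_def \<Lambda>_def right_diff_distrib)
  qed
  then have "\<Lambda> (\<lambda>x. einner d x ?u ^ k) = 0"
  proof -
    let ?L = "\<Lambda> (\<lambda>x. einner d x ?u ^ k)"
    assume *: "\<And>s. \<bar>s * ?L\<bar> \<le> Z"
    show "?L = 0"
    proof (rule ccontr)
      assume "?L \<noteq> 0"
      then show False using *[of "(Z + 1) / ?L"] Z_nonneg by simp
    qed
  qed
  moreover have "\<Lambda> (\<lambda>x. einner d x \<theta> ^ k) = enorm d \<theta> ^ k * \<Lambda> (\<lambda>x. einner d x ?u ^ k)"
    by (simp add: einner_direction[OF False] power_mult_distrib \<Lambda>_def right_diff_distrib)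
  ultimately show ?thesis by simp
qed

section \<open>Agreement of mixed moments of order less than \<open>p\<close>\<close>

definition monomial :: "nat list \<Rightarrow> (nat \<Rightarrow> real) \<Rightarrow> real" where
  "monomial I x = prod_list (map x I)"

lemma integrable_monomial:
  assumes "set I \<subseteq> {..<d}" "m + length I \<le> p"
  shows "integrable \<mu> (\<lambda>x. einner d x \<theta> ^ m * monomial I x)" "integrable \<nu> (\<lambda>x. einner d x \<theta> ^ m * monomial I x)"
proof -
  have meas: "(\<lambda>x. einner d x \<theta> ^ m * monomial I x) \<in> borel_measurable M"
    if "\<And>i. i < d \<Longrightarrow> (\<lambda>x. x i) \<in> borel_measurable M" "(\<lambda>x. einner d x \<theta>) \<in> borel_measurable M" for M
  proof -
    have "monomial I \<in> borel_measurable M"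
      using assms(1) that(1) by (induction I) (auto simp: monomial_def[abs_def])
    then show ?thesis using that by (intro borel_measurable_times borel_measurable_power)
  qed
  have mo: "\<bar>monomial I x\<bar> \<le> enorm d x ^ length I" for x
    using assms(1)
  proof (induction I)
    case (Cons i I)
    have "\<bar>x i\<bar> * \<bar>monomial I x\<bar> \<le> enorm d x * enorm d x ^ length I"
      using Cons by (intro mult_mono abs_le_enorm) auto
    then show ?case by (simp add: monomial_def abs_mult)
  qed (simp add: monomial_def)
  have le: "\<bar>einner d x \<theta> ^ m * monomial I x\<bar> \<le> enorm d \<theta> ^ m * enorm d x ^ (m + length I)" for x
  proof -
    have "\<bar>einner d x \<theta>\<bar> ^ m * \<bar>monomial I x\<bar> \<le> (enorm d x * enorm d \<theta>) ^ m * enorm d x ^ length I"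
      using mo abs_einner_le by (intro mult_mono power_mono) auto
    then show ?thesis by (simp add: abs_mult power_abs power_mult_distrib power_add mult_ac)
  qed
  have q: "real (m + length I) \<le> q" using assms(2) p_less_q by linarith
  show "integrable \<mu> (\<lambda>x. einner d x \<theta> ^ m * monomial I x)"
    by (rule P.integrable_of_growth[OF meas q le]) (auto intro: P.measurable_coord P.measurable_einner)
  show "integrable \<nu> (\<lambda>x. einner d x \<theta> ^ m * monomial I x)"
    by (rule Q.integrable_of_growth[OF meas q le]) (auto intro: Q.measurable_coord Q.measurable_einner)
qed

text \<open>
  Polarization: perturbing \<open>\<theta>\<close> in the \<open>i\<close>-th coordinate gives a polynomial in the perturbation that
  vanishes identically; its linear coefficient replaces one factor \<open>\<langle>x, \<theta>\<rangle>\<close> by \<open>x\<^sub>i\<close>.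
\<close>

lemma mixed_moment:
  "set I \<subseteq> {..<d} \<Longrightarrow> m + length I < p \<Longrightarrow> \<Lambda> (\<lambda>x. einner d x \<theta> ^ m * monomial I x) = 0"
proof (induction I arbitrary: m \<theta>)
  case Nil
  then show ?case using power_moment[of m \<theta>] by (simp add: monomial_def)
next
  case (Cons i I)
  let ?c = "\<lambda>k. real (Suc m choose k) * \<Lambda> (\<lambda>x. einner d x \<theta> ^ (Suc m - k) * monomial (replicate k i @ I) x)"
  have "(\<Sum>k\<le>Suc m. ?c k * s ^ k) = 0" for s
  proof -
    define \<theta>' where "\<theta>' = (\<lambda>j. \<theta> j + (if j = i then s else 0))"
    have e: "einner d x \<theta>' = s * x i + einner d x \<theta>" for x
    proof -
      have "einner d x \<theta>' = (\<Sum>j<d. x j * \<theta> j + (if j = i then s * x i else 0))"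
        unfolding einner_def \<theta>'_def by (intro sum.cong refl) (simp add: algebra_simps)
      then show ?thesis using Cons.prems(1) by (simp add: sum.distrib einner_def)
    qed
    have ex: "einner d x \<theta>' ^ Suc m * monomial I x =
        (\<Sum>k\<le>Suc m. (real (Suc m choose k) * s ^ k) * (einner d x \<theta> ^ (Suc m - k) * monomial (replicate k i @ I) x))" for x
      unfolding e binomial_ring sum_distrib_right
      by (intro sum.cong refl) (simp add: monomial_def power_mult_distrib prod_list_replicate mult_ac map_replicate)
    have int: "integrable \<mu> (\<lambda>x. (real (Suc m choose k) * s ^ k) * (einner d x \<theta> ^ (Suc m - k) * monomial (replicate k i @ I) x))"
      "integrable \<nu> (\<lambda>x. (real (Suc m choose k) * s ^ k) * (einner d x \<theta> ^ (Suc m - k) * monomial (replicate k i @ I) x))"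
      if "k \<in> {..Suc m}" for k
      using that Cons.prems by (auto intro!: integrable_mult_right integrable_monomial)
    have "0 = \<Lambda> (\<lambda>x. einner d x \<theta>' ^ Suc m * monomial I x)"
      using Cons.prems by (subst Cons.IH) auto
    also have "\<dots> = (\<Sum>k\<le>Suc m. (real (Suc m choose k) * s ^ k) * \<Lambda> (\<lambda>x. einner d x \<theta> ^ (Suc m - k) * monomial (replicate k i @ I) x))"
      unfolding \<Lambda>_def ex using int
      by (simp add: Bochner_Integration.integral_sum sum_subtractf right_diff_distrib del: sum.atMost_Suc power_Suc binomial_Suc_Suc)
    finally show ?thesis by (simp add: mult_ac del: sum.atMost_Suc power_Suc binomial_Suc_Suc)
  qed
  then have "\<forall>s. (\<Sum>k\<le>Suc m. ?c k * s ^ k) = 0" by (rule allI)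
  then have "\<forall>k\<le>Suc m. ?c k = 0" by (rule polyfun_eq_0[THEN iffD1])
  moreover have "1 \<le> Suc m" by simp
  ultimately have "?c 1 = 0" by (elim allE impE)
  then show ?case by (simp del: of_nat_Suc)
qed

text \<open>The additional monomial collects the coordinates that \<open>hform\<close> splits off,
  which keeps the induction within one statement.\<close>

lemma agree_hform:
  "set J \<subseteq> {..<d} \<Longrightarrow> j + length J < p \<Longrightarrow> agree (\<lambda>x. hform d j c x * monomial J x)"
proof (induction j arbitrary: c J)
  case 0
  have "agree (monomial J)"
  proof -
    have "0 + length J \<le> p" using 0 by simp
    then show ?thesis
      using integrable_monomial[OF 0(1), of 0 "\<lambda>_. 0"] mixed_moment[OF 0(1), of 0 "\<lambda>_. 0"] 0(2)
      by (simp add: agree_def)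
  qed
  then have "agree (\<lambda>x. c [] * monomial J x)" by (rule agree_cmult)
  then show ?case by simp
next
  case (Suc j)
  have "agree (\<lambda>x. \<Sum>i<d. hform d j (\<lambda>I. c (i # I)) x * monomial (i # J) x)"
    by (intro agree_sum Suc.IH) (use Suc.prems in auto)
  then show ?case by (simp add: monomial_def sum_distrib_left sum_distrib_right mult_ac)
qed

lemma agree_taylor_poly: "agree (taylor_poly d p c)"
proof -
  have "agree (\<lambda>x. \<Sum>j<p. (1 / fact j) * (hform d j c x * monomial [] x))"
    by (rule agree_sum, rule agree_cmult, rule agree_hform) auto
  then show ?thesis by (simp add: taylor_poly_def[abs_def] monomial_def)
qed

end

section \<open>Estimates for periodic functions\<close>

lemma power_div_fact_le_exp: "0 \<le> x \<Longrightarrow> x ^ n / fact n \<le> exp x" for x :: real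
proof -
  assume x: "0 \<le> x"
  have "(\<Sum>i\<in>{n}. inverse (fact i) * x ^ i) \<le> (\<Sum>i. inverse (fact i) * x ^ i)"
    by (rule sum_le_suminf) (use x summable_exp[of x] in auto)
  also have "\<dots> = exp x" by (simp add: exp_def scaleR_conv_of_real)
  finally show ?thesis by (simp add: divide_inverse mult.commute)
qed

lemma bconv_mono:
  assumes "\<And>l. l \<le> j \<Longrightarrow> 0 \<le> a l \<and> a l \<le> a' l" "\<And>l. l \<le> j \<Longrightarrow> 0 \<le> b l \<and> b l \<le> b' l"
  shows "bconv a b j \<le> bconv a' b' j"
  unfolding bconv_def
proof (rule sum_mono)
  fix l assume "l \<in> {..j}"
  then show "real (j choose l) * a l * b (j - l) \<le> real (j choose l) * a' l * b' (j - l)"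
    using assms(1)[of l] assms(2)[of "j - l"] by (intro mult_mono mult_nonneg_nonneg) auto
qed

text \<open>The steep cutoff produces the powers \<open>p ^ (p - l)\<close>, and the factorials of
  the Taylor bounds cancel them: \<open>p ^ k / fact k \<le> exp p \<le> 3 ^ p\<close>. The
  remaining binomial sum is \<open>(1 + 17) ^ p\<close>, and \<open>18 * 3 = 54\<close>.\<close>

lemma bconv_growth:
  fixes s E D :: real
  assumes sE: "s * E = 17 * real p" and D: "0 \<le> D"
  shows "bconv (\<lambda>l. D * s ^ (p - l) / fact (p - l)) (\<lambda>l. E ^ l) p \<le> 54 ^ p * D"
proof -
  have "bconv (\<lambda>l. D * s ^ (p - l) / fact (p - l)) (\<lambda>l. E ^ l) p =
      (\<Sum>l\<le>p. D * (real (p choose l) * 17 ^ (p - l) * (real p ^ (p - l) / fact (p - l))))"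
    unfolding bconv_def
  proof (rule sum.cong[OF refl])
    fix l
    have "s ^ (p - l) * E ^ (p - l) = 17 ^ (p - l) * real p ^ (p - l)"
      by (simp only: power_mult_distrib[symmetric] sE)
    then have "D * real (p choose l) / fact (p - l) * (s ^ (p - l) * E ^ (p - l)) =
       D * real (p choose l) / fact (p - l) * (17 ^ (p - l) * real p ^ (p - l))" by (simp only:)
    then show "real (p choose l) * (D * s ^ (p - l) / fact (p - l)) * E ^ (p - l) =
       D * (real (p choose l) * 17 ^ (p - l) * (real p ^ (p - l) / fact (p - l)))"
      by (simp add: mult_ac)
  qed
  also have "\<dots> \<le> (\<Sum>l\<le>p. D * (real (p choose l) * 17 ^ (p - l) * 3 ^ p))"
  proof (intro sum_mono mult_left_mono D)
    fix l
    have "real p ^ (p - l) / fact (p - l) \<le> exp (real p)" by (rule power_div_fact_le_exp) simp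
    also have "\<dots> = exp 1 ^ p" by (simp add: exp_of_nat_mult[symmetric])
    also have "\<dots> \<le> 3 ^ p" using exp_le by (intro power_mono) auto
    finally show "real p ^ (p - l) / fact (p - l) \<le> 3 ^ p" .
  qed auto
  also have "\<dots> = D * (\<Sum>l\<le>p. real (p choose l) * 1 ^ l * 17 ^ (p - l)) * 3 ^ p"
    unfolding sum_distrib_left sum_distrib_right by (intro sum.cong refl) simp
  also have "(\<Sum>l\<le>p. real (p choose l) * 1 ^ l * 17 ^ (p - l)) = 18 ^ p"
    unfolding binomial_ring[symmetric] by simp
  also have "D * 18 ^ p * 3 ^ p = 54 ^ p * D"
    by (simp add: power_mult_distrib[symmetric] mult.assoc) 
  finally show ?thesis .
qed

lemma dbound_lower_le: "dbound d n a f \<Longrightarrow> m \<le> n \<Longrightarrow> dbound d m a f"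
  by (induction n) (auto simp: le_Suc_eq intro: dbound_lower simp del: dbound.simps(2))

lemma dbound_lipschitz:
  assumes "dbound d n a f" "1 \<le> n" "\<And>x. a 1 x \<le> B"
  shows "\<bar>f y - f x\<bar> \<le> B * enorm d (\<lambda>i. y i - x i)"
proof -
  have "dbound d (length [\<lambda>i. y i - x i]) a f"
    using dbound_lower_le[OF assms(1), of 1] assms(2) by simp
  from fdiff_bound[OF this, of B x] assms(3) show ?thesis
    by (simp add: along_def)
qed

lemma continuous_of_lipschitz:
  fixes f :: "(nat \<Rightarrow> real) \<Rightarrow> real"
  assumes lip: "\<And>x y. \<bar>f y - f x\<bar> \<le> B * enorm d (\<lambda>i. y i - x i)"
  shows "continuous_on UNIV f"
  unfolding continuous_on_def
proof
  fix x :: "nat \<Rightarrow> real"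
  have "((\<lambda>y. f y - f x) \<longlongrightarrow> 0) (at x within UNIV)"
  proof (rule Lim_null_comparison[where g = "\<lambda>y. B * enorm d (\<lambda>i. y i - x i)"])
    show "eventually (\<lambda>y. norm (f y - f x) \<le> B * enorm d (\<lambda>i. y i - x i)) (at x within UNIV)"
      using lip by simp
    show "((\<lambda>y. B * enorm d (\<lambda>i. y i - x i)) \<longlongrightarrow> 0) (at x within UNIV)"
      using tendsto_mult[OF tendsto_const tendsto_enorm_diff[OF tendsto_ident_at[of x UNIV], of d], of B] by simp
  qed
  then show "(f \<longlongrightarrow> f x) (at x within UNIV)" by (simp add: LIM_zero_iff)
qed

lemma wrap_small:
  assumes "\<And>i. i < d \<Longrightarrow> \<bar>x i\<bar> < L / 2"
  shows "wrap d L x = x"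
proof -
  have "round (x i / L) = 0" if "i < d" for i
  proof (rule round_unique')
    have "0 < L" using assms[OF that] by linarith
    then show "\<bar>x i / L - of_int 0\<bar> < 1 / 2" using assms[OF that] by (simp add: field_simps)
  qed
  then show ?thesis by (auto simp: wrap_def)
qed

lemma wrap_periodic:
  assumes "0 < L" "i < d" "x i = x' i + L * of_int n"
  shows "wrap d L x i = wrap d L x' i"
proof -
  have "x i / L = x' i / L + of_int n" using assms by (simp add: field_simps)
  then have "round (x i / L) = round (x' i / L) + n"
    by (simp add: round_def floor_add_int[symmetric] add.commute add.left_commute)
  then show ?thesis using assms by (simp add: wrap_def algebra_simps)
qed

text \<open>The sharp claim is the one on differences. The Lipschitz constant \<open>B\<close> stays
  unspecified because it serves only for continuity and for the rounding error, which disappears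
  with the mesh.\<close>

lemma (in jet) truncation:
  assumes p: "1 \<le> p" and R: "0 < R"
  shows "\<exists>f B. (\<forall>ts x. length ts = p \<longrightarrow> \<bar>fdiff ts f x\<bar> \<le> (54 * sqrt (real d)) ^ p * prod_list (map (enorm d) ts)) \<and>
    (\<forall>x. enorm d x \<le> R \<longrightarrow> f x = taylor_rem [] x) \<and> (\<forall>x. \<bar>f x\<bar> \<le> (2 * sqrt (real d) * R) ^ p) \<and>
    (\<forall>x x'. (\<forall>i<d. \<exists>n::int. x i = x' i + 8 * R * of_int n) \<longrightarrow> f x = f x') \<and>
    (\<forall>x y. \<bar>f y - f x\<bar> \<le> B * enorm d (\<lambda>i. y i - x i))"
proof -
  let ?D = "sqrt (real d) ^ p"
  \<comment> \<open>The cutoff \<open>G 0 (|x|^2 / R^2)\<close> vanishes once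
    \<open>|x|^2 \<ge> 3 * R^2\<close>, hence beyond \<open>2 * R\<close>, and the period
    \<open>8 * R\<close> exceeds \<open>2 * s\<close> as periodization demands. \<open>E\<close> is
    the constant of \<open>dbound_radial\<close> for the derivative scale
    \<open>2 * p / R^2\<close>; it equals \<open>17 * p / s\<close>.\<close>
  define s where "s = 2 * R"
  define L where "L = 8 * R"
  define E where "E = 2 * (2 * real p / R\<^sup>2) * s + real p / s"
  have s: "0 < s" "2 * s < L" using R by (auto simp: s_def L_def)
  have E0: "0 \<le> E" using s by (simp add: E_def)
  have sE: "s * E = 17 * real p" using R by (simp add: E_def s_def field_simps power2_eq_square)
  \<comment> \<open>\<open>p\<close> averages over windows of length \<open>1 / p\<close> move the
    end of the plateau from 2 to exactly 1, so the cutoff is 1 on the ball of radius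
    \<open>R\<close>.\<close>
  have "0 < 1 / real p" using p by simp
  then obtain G where "smooth_step (1 / real p) p G" using smooth_step_exists by blast
  then have G1: "\<And>m t. m < p \<Longrightarrow> (G m has_real_derivative G (Suc m) t) (at t)"
    and G2: "\<And>m t. m \<le> p \<Longrightarrow> \<bar>G m t\<bar> \<le> (2 * real p) ^ m"
    and G3: "\<And>m t. m \<le> p \<Longrightarrow> t \<ge> 3 \<Longrightarrow> G m t = 0"
    and G4: "\<And>t. t \<le> 1 \<Longrightarrow> G 0 t = 1"
    and G5: "\<And>t. 0 \<le> G 0 t" "\<And>t. G 0 t \<le> 1"
    using p unfolding smooth_step_def by simp_all
  define H where "H m t = G m (t / R\<^sup>2) / (R\<^sup>2) ^ m" for m t
  have H1: "(H m has_real_derivative H (Suc m) t) (at t)" if "m < p" for m t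
  proof -
    have "((\<lambda>t. t / R\<^sup>2) has_real_derivative 1 / R\<^sup>2) (at t)"
      by (rule DERIV_cdivide[OF DERIV_ident])
    from DERIV_cdivide[OF DERIV_chain2[OF G1[OF that] this], of "(R\<^sup>2) ^ m"]
    show ?thesis unfolding H_def by simp
  qed
  have H2: "\<bar>H m t\<bar> \<le> (2 * real p / R\<^sup>2) ^ m" if "m \<le> p" for m t
    using divide_right_mono[OF G2[OF that, of "t / R\<^sup>2"], of "(R\<^sup>2) ^ m"]
    by (simp add: H_def power_divide abs_divide)
  have H3: "H m t = 0" if "m \<le> p" "s\<^sup>2 < t" for m t
  proof -
    have "3 * R\<^sup>2 \<le> t" using that(2) by (simp add: s_def power_mult_distrib) (smt (verit) zero_le_power2)
    then have "3 \<le> t / R\<^sup>2" using R by (simp add: field_simps)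
    then show ?thesis using G3[OF that(1)] by (simp add: H_def)
  qed
  have chi: "dbound d p (\<lambda>j x. if enorm d x \<le> s then (2 * real p / R\<^sup>2) ^ 0 * E ^ j else 0) (\<lambda>x. H 0 ((enorm d x)\<^sup>2))"
    by (rule dbound_radial[where G = H and p = p and B = "2 * real p / R\<^sup>2" and s = s and m = 0, OF H1 H2 H3 s(1) _ E_def]) auto
  define w where "w x = taylor_rem [] x * H 0 ((enorm d x)\<^sup>2)" for x
  define c where "c j x = bconv (\<lambda>j. ?D * enorm d x ^ (p - j) / fact (p - j)) (\<lambda>j. if enorm d x \<le> s then (2 * real p / R\<^sup>2) ^ 0 * E ^ j else 0) j" for j x
  define cs where "cs j = bconv (\<lambda>l. ?D * s ^ (p - l) / fact (p - l)) (\<lambda>l. E ^ l) j" for j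
  have w: "dbound d p c w"
    unfolding w_def[abs_def] c_def[abs_def] by (rule dbound_mult[OF dbound_taylor_rem chi])
  have c0: "c j x = 0" if "s < enorm d x" for j x
    using that by (simp add: c_def bconv_def)
  have cs0: "0 \<le> cs j" for j
    unfolding cs_def bconv_def using s E0 by (intro sum_nonneg mult_nonneg_nonneg divide_nonneg_nonneg) auto
  have cle: "c j x \<le> cs j" for j x
  proof (cases "enorm d x \<le> s")
    case True
    then show ?thesis unfolding c_def cs_def using E0
      by (intro bconv_mono) (auto intro!: divide_right_mono mult_left_mono power_mono)
  next
    case False
    then show ?thesis using c0[of x j] cs0[of j] by simp
  qed
  have csp: "cs p \<le> (54 * sqrt (real d)) ^ p"
    unfolding cs_def power_mult_distrib by (rule bconv_growth[OF sE]) simp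
  define f where "f x = w (wrap d L x)" for x
  have f: "dbound d p (\<lambda>j x. c j (wrap d L x)) f"
    unfolding f_def[abs_def] by (rule dbound_wrap[OF w _ s]) (use c0 in auto)
  have "\<bar>fdiff ts f x\<bar> \<le> (54 * sqrt (real d)) ^ p * prod_list (map (enorm d) ts)" if "length ts = p" for ts x
  proof (rule fdiff_bound[where a = "\<lambda>j x. c j (wrap d L x)"])
    show "dbound d (length ts) (\<lambda>j x. c j (wrap d L x)) f" unfolding that by (rule f)
    show "c (length ts) (wrap d L x) \<le> (54 * sqrt (real d)) ^ p" for x
      unfolding that by (rule order_trans[OF cle csp])
  qed
  moreover have "f x = taylor_rem [] x" if "enorm d x \<le> R" for x
  proof -
    have "wrap d L x = x"
    proof (rule wrap_small)
      fix i assume "i < d"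
      from abs_le_enorm[OF this, of x] show "\<bar>x i\<bar> < L / 2" using that R by (simp add: L_def)
    qed
    moreover have "H 0 ((enorm d x)\<^sup>2) = 1"
      unfolding H_def using G4[of "(enorm d x)\<^sup>2 / R\<^sup>2"] that R power_mono[OF that, of 2] by (simp add: field_simps)
    ultimately show ?thesis by (simp add: f_def w_def)
  qed
  moreover have "\<bar>f x\<bar> \<le> (2 * sqrt (real d) * R) ^ p" for x
  proof -
    have "\<bar>w y\<bar> \<le> (2 * sqrt (real d) * R) ^ p" for y
    proof (cases "enorm d y \<le> s")
      case True
      have "\<bar>taylor_rem [] y\<bar> \<le> (sqrt (real d) * enorm d y) ^ p / fact p"
        by (rule taylor_rem_bound_enorm) auto
      also have "\<dots> \<le> (sqrt (real d) * enorm d y) ^ p / 1"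
        by (rule divide_left_mono) (auto simp: fact_ge_1)
      also have "\<dots> \<le> (2 * sqrt (real d) * R) ^ p"
      proof -
        have "sqrt (real d) * enorm d y \<le> sqrt (real d) * s" using True by (intro mult_left_mono) auto
        also have "\<dots> = 2 * sqrt (real d) * R" by (simp add: s_def)
        finally show ?thesis by (simp add: power_mono)
      qed
      finally have "\<bar>taylor_rem [] y\<bar> * \<bar>H 0 ((enorm d y)\<^sup>2)\<bar> \<le> (2 * sqrt (real d) * R) ^ p * 1"
        using G5 R by (intro mult_mono) (auto simp: H_def)
      then show ?thesis by (simp add: w_def abs_mult)
    next
      case False
      then have "s\<^sup>2 < (enorm d y)\<^sup>2" using s by (intro power_strict_mono) auto
      then show ?thesis using H3[of 0] R by (simp add: w_def)
    qed
    then show ?thesis by (simp add: f_def)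
  qed
  moreover have "f x = f x'" if "\<forall>i<d. \<exists>n::int. x i = x' i + 8 * R * of_int n" for x x'
  proof -
    have "wrap d L x i = wrap d L x' i" if "i < d" for i
      using wrap_periodic[of L i d x x'] that \<open>\<forall>i<d. \<exists>n::int. x i = x' i + 8 * R * of_int n\<close> R
      by (auto simp: L_def)
    then have "enorm d (\<lambda>i. wrap d L x i - wrap d L x' i) = enorm d (\<lambda>i. 0)"
      by (intro enorm_cong) simp
    \<comment> \<open>The wrapped points may still differ in coordinates from \<open>d\<close> on.
      The Lipschitz bound is stated in a seminorm blind to these, so it yields equal values.\<close>
    moreover have "\<bar>w (wrap d L x) - w (wrap d L x')\<bar> \<le> cs 1 * enorm d (\<lambda>i. wrap d L x i - wrap d L x' i)"
      by (rule dbound_lipschitz[OF w p cle])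
    ultimately show ?thesis by (simp add: f_def)
  qed
  moreover have "\<bar>f y - f x\<bar> \<le> cs 1 * enorm d (\<lambda>i. y i - x i)" for x y
    by (rule dbound_lipschitz[OF f p cle])
  ultimately show ?thesis by blast
qed

section \<open>Rounding to the lattice\<close>

definition round_lattice :: "nat \<Rightarrow> real \<Rightarrow> (nat \<Rightarrow> real) \<Rightarrow> nat \<Rightarrow> int" where
  "round_lattice d \<eta> x = (\<lambda>i. if i < d then \<lfloor>x i / \<eta>\<rfloor> else 0)"

lemma enorm_round_le:
  assumes "0 < \<eta>"
  shows "enorm d (\<lambda>i. lattice_pt \<eta> (round_lattice d \<eta> x) i - x i) \<le> real d * \<eta>"
proof -
  have "\<bar>lattice_pt \<eta> (round_lattice d \<eta> x) i - x i\<bar> \<le> \<eta>" if "i < d" for i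
  proof -
    have "\<eta> * of_int \<lfloor>x i / \<eta>\<rfloor> \<le> x i" "x i \<le> \<eta> * of_int \<lfloor>x i / \<eta>\<rfloor> + \<eta>"
      using floor_divide_lower[OF assms, of "x i"] floor_divide_upper[OF assms, of "x i"]
      by (simp_all add: algebra_simps)
    then show ?thesis using that by (simp add: lattice_pt_def round_lattice_def)
  qed
  then have "(\<Sum>i<d. \<bar>lattice_pt \<eta> (round_lattice d \<eta> x) i - x i\<bar>) \<le> (\<Sum>i<d. \<eta>)"
    by (intro sum_mono) auto
  then show ?thesis using enorm_le_sum_abs[of d "\<lambda>i. lattice_pt \<eta> (round_lattice d \<eta> x) i - x i"] by simp
qed

lemma prod_cis: "(\<Prod>i<d. cis (a i)) = cis (\<Sum>i<d. a i)" for d :: nat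
  by (induction d) (simp_all add: cis_mult)

lemma character_cis:
  assumes "0 < L" "0 < m" "\<eta> = L / real (2 * m)"
  shows "character d m k z = cis (einner d (lattice_pt \<eta> z) (freq L k))"
  unfolding character_def rou_def prod_cis einner_def lattice_pt_def freq_def using assms
  by (intro arg_cong[where f = cis] sum.cong refl) (simp add: field_simps)

lemma norm_cis_diff_le: "norm (cis a - cis b) \<le> \<bar>a - b\<bar>"
proof -
  have "cis a - cis b = cis b * (cis (a - b) - 1)"
    by (simp add: right_diff_distrib cis_mult)
  then have "norm (cis a - cis b) = 2 * \<bar>sin ((a - b) / 2)\<bar>"
    by (simp add: norm_mult norm_cis_minus_1)
  also have "\<dots> \<le> 2 * \<bar>(a - b) / 2\<bar>" using abs_sin_x_le_abs_x[of "(a - b) / 2"] by linarith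
  finally show ?thesis by simp
qed

lemma norm_add_diff_le:
  fixes a b c :: "'a::real_normed_vector"
  assumes "norm a \<le> A" "norm b \<le> B"
  shows "norm (c + (a - b)) \<le> norm c + (A + B)"
  using assms norm_triangle_ineq[of c "a - b"] norm_triangle_ineq4[of a b] by linarith

context moment_prob
begin

lemma measurable_round: "(\<lambda>x. lattice_pt \<eta> (round_lattice d \<eta> x)) \<in> borel_measurable M"
proof (rule measurable_coordinatewise_then_product)
  fix i
  show "(\<lambda>x. lattice_pt \<eta> (round_lattice d \<eta> x) i) \<in> borel_measurable M"
  proof (cases "i < d")
    case True
    have "(\<lambda>t::real. \<eta> * real_of_int \<lfloor>t / \<eta>\<rfloor>) \<in> borel_measurable borel" by measurable
    from measurable_compose[OF measurable_coord[OF True] this]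
    have "(\<lambda>x. \<eta> * real_of_int \<lfloor>x i / \<eta>\<rfloor>) \<in> borel_measurable M" .
    then show ?thesis using True unfolding lattice_pt_def round_lattice_def by simp
  next
    case False
    then show ?thesis by (simp add: lattice_pt_def round_lattice_def)
  qed
qed

lemma integrable_bounded:
  fixes F :: "(nat \<Rightarrow> real) \<Rightarrow> 'b::{banach, second_countable_topology}"
  assumes "F \<in> borel_measurable M" "\<And>x. norm (F x) \<le> C"
  shows "integrable M F"
  by (rule integrable_const_bound[of _ C]) (use assms in auto)

lemma integral_close:
  fixes F G :: "(nat \<Rightarrow> real) \<Rightarrow> 'b::{banach, second_countable_topology}"
  assumes "integrable M F" "integrable M G" "\<And>x. norm (F x - G x) \<le> C"
  shows "norm (integral\<^sup>L M F - integral\<^sup>L M G) \<le> C"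
proof -
  have "norm (integral\<^sup>L M F - integral\<^sup>L M G) = norm (\<integral>x. F x - G x \<partial>M)"
    using assms by simp
  also have "\<dots> \<le> (\<integral>x. norm (F x - G x) \<partial>M)" by (rule integral_norm_bound)
  also have "\<dots> \<le> (\<integral>x. C \<partial>M)"
    by (rule integral_mono) (use assms in auto)
  finally show ?thesis by (simp add: prob_space)
qed

lemma measurable_cis_einner: "(\<lambda>x. cis (einner d x \<xi>)) \<in> borel_measurable M"
proof -
  have "cis \<in> borel_measurable borel"
    by (rule borel_measurable_continuous_onI) (auto intro: continuous_intros)
  then show ?thesis by (rule measurable_compose[OF measurable_einner])
qed

lemma measurable_cis_einner_round:
  "(\<lambda>x. cis (einner d (lattice_pt \<eta> (round_lattice d \<eta> x)) \<xi>)) \<in> borel_measurable M"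
proof -
  have "continuous_on UNIV (\<lambda>x::nat \<Rightarrow> real. cis (einner d x \<xi>))"
    unfolding einner_def by (intro continuous_intros) (auto intro: continuous_on_product_coordinates)
  then have "(\<lambda>x::nat \<Rightarrow> real. cis (einner d x \<xi>)) \<in> borel_measurable borel"
    by (rule borel_measurable_continuous_onI)
  then show ?thesis by (rule measurable_compose[OF measurable_round])
qed

lemma integrable_cis_einner: "integrable M (\<lambda>x. cis (einner d x \<xi>))"
  by (rule integrable_bounded[where C = 1, OF measurable_cis_einner]) simp

lemma integrable_cis_einner_round:
  "integrable M (\<lambda>x. cis (einner d (lattice_pt \<eta> (round_lattice d \<eta> x)) \<xi>))"
  by (rule integrable_bounded[where C = 1, OF measurable_cis_einner_round]) simp

end

context zol_pair
begin

definition \<Phi> :: "((nat \<Rightarrow> real) \<Rightarrow> complex) \<Rightarrow> complex" where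
  "\<Phi> g = (\<integral>x. g x \<partial>\<mu>) - (\<integral>x. g x \<partial>\<nu>)"

lemma \<Phi>_cis_bound: "norm (\<Phi> (\<lambda>x. cis (einner d x \<xi>))) \<le> 2 * Z * enorm d \<xi> ^ p"
proof -
  have i: "integrable \<mu> (\<lambda>x. cis (einner d x \<xi>))" "integrable \<nu> (\<lambda>x. cis (einner d x \<xi>))"
    by (rule P.integrable_cis_einner, rule Q.integrable_cis_einner)
  have "Re (\<Phi> (\<lambda>x. cis (einner d x \<xi>))) = \<Lambda> (\<lambda>x. cos (einner d x \<xi> + 0))"
    using integral_Re[OF i(1)] integral_Re[OF i(2)] by (simp add: \<Phi>_def \<Lambda>_def)
  \<comment> \<open>\<open>cos (t - pi / 2) = sin t\<close>, so the bound for shifted cosines serves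
    the imaginary part too.\<close>
  moreover have "Im (\<Phi> (\<lambda>x. cis (einner d x \<xi>))) = \<Lambda> (\<lambda>x. cos (einner d x \<xi> + - (pi / 2)))"
    using integral_Im[OF i(1)] integral_Im[OF i(2)] by (simp add: \<Phi>_def \<Lambda>_def cos_diff)
  ultimately show ?thesis
    using cmod_le[of "\<Phi> (\<lambda>x. cis (einner d x \<xi>))"] trig_bound[of \<xi> 0] trig_bound[of \<xi> "- (pi / 2)"] by linarith
qed

lemma \<Phi>_round_bound:
  assumes \<eta>: "0 < \<eta>"
  shows "norm (\<Phi> (\<lambda>x. cis (einner d (lattice_pt \<eta> (round_lattice d \<eta> x)) \<xi>))) \<le>
    2 * Z * enorm d \<xi> ^ p + 2 * (enorm d \<xi> * (real d * \<eta>))"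
proof -
  let ?c = "\<lambda>x. cis (einner d x \<xi>)" and ?r = "\<lambda>x. lattice_pt \<eta> (round_lattice d \<eta> x)"
  have le: "norm (?c (?r x) - ?c x) \<le> enorm d \<xi> * (real d * \<eta>)" for x
  proof -
    have "norm (?c (?r x) - ?c x) \<le> \<bar>einner d (?r x) \<xi> - einner d x \<xi>\<bar>" by (rule norm_cis_diff_le)
    also have "einner d (?r x) \<xi> - einner d x \<xi> = einner d (\<lambda>i. ?r x i - x i) \<xi>"
      by (simp add: einner_def left_diff_distrib sum_subtractf)
    also have "\<bar>\<dots>\<bar> \<le> enorm d (\<lambda>i. ?r x i - x i) * enorm d \<xi>" by (rule abs_einner_le)
    also have "\<dots> \<le> real d * \<eta> * enorm d \<xi>" by (intro mult_right_mono enorm_round_le \<eta>) auto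
    finally show ?thesis by (simp add: mult.commute)
  qed
  have 1: "norm ((\<integral>x. ?c (?r x) \<partial>\<mu>) - (\<integral>x. ?c x \<partial>\<mu>)) \<le> enorm d \<xi> * (real d * \<eta>)"
    by (rule P.integral_close) (rule P.integrable_cis_einner_round, rule P.integrable_cis_einner, rule le)
  have 2: "norm ((\<integral>x. ?c (?r x) \<partial>\<nu>) - (\<integral>x. ?c x \<partial>\<nu>)) \<le> enorm d \<xi> * (real d * \<eta>)"
    by (rule Q.integral_close) (rule Q.integrable_cis_einner_round, rule Q.integrable_cis_einner, rule le)
  have e: "\<Phi> (\<lambda>x. ?c (?r x)) = \<Phi> ?c + (((\<integral>x. ?c (?r x) \<partial>\<mu>) - (\<integral>x. ?c x \<partial>\<mu>)) - ((\<integral>x. ?c (?r x) \<partial>\<nu>) - (\<integral>x. ?c x \<partial>\<nu>)))"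
  proof -
    have "u - v = (u' - v') + ((u - u') - (v - v'))" for u v u' v' :: complex by simp
    then show ?thesis unfolding \<Phi>_def .
  qed
  have "norm (\<Phi> (\<lambda>x. ?c (?r x))) \<le> norm (\<Phi> ?c) + (enorm d \<xi> * (real d * \<eta>) + enorm d \<xi> * (real d * \<eta>))"
    unfolding e by (rule norm_add_diff_le[OF 1 2])
  then show ?thesis using \<Phi>_cis_bound[of \<xi>] by linarith
qed

text \<open>\<open>f\<close> is compared with its value at the rounded point, and there with the
  polynomial from \<open>trig_approximation\<close>, whose coefficients depend on the mesh while
  their bounds do not. The weights \<open>enorm d (freq L k) ^ p\<close> coming from
  \<open>trig_bound\<close> are those of the Parseval bound, so Cauchy-Schwarz costs only the number
  of frequencies.\<close>

lemma periodic_estimate: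
  assumes A: "\<And>ts x. length ts = p \<Longrightarrow> \<bar>fdiff ts f x\<bar> \<le> A * prod_list (map (enorm d) ts)" and A0: "0 \<le> A"
    and C: "\<And>x. \<bar>f x\<bar> \<le> C"
    and per: "\<And>x x'. \<forall>i<d. \<exists>n::int. x i = x' i + L * of_int n \<Longrightarrow> f x = f x'" and L: "0 < L"
    and lip: "\<And>x y. \<bar>f y - f x\<bar> \<le> B * enorm d (\<lambda>i. y i - x i)"
    and n: "1 \<le> n"
  shows "\<bar>\<Lambda> f\<bar> \<le> 2 * (A * (sqrt (real d) * L / real (n + 1)) ^ p) +
    2 * Z * (1 + 2 ^ p) * sqrt (real ((2 * n + 1) ^ d) * real d ^ (p + 1)) * (pi / 2) ^ p * A"
proof -
  let ?E1 = "A * (sqrt (real d) * L / real (n + 1)) ^ p"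
  let ?E3 = "2 * Z * (1 + 2 ^ p) * sqrt (real ((2 * n + 1) ^ d) * real d ^ (p + 1)) * (pi / 2) ^ p * A"
  \<comment> \<open>\<open>K\<close> collects all errors proportional to the mesh. It does not
    depend on \<open>m\<close>, so they vanish in the limit, and with them \<open>B\<close> and
    \<open>C\<close>.\<close>
  define K where "K = (\<Sum>k\<in>fbox d n. (1 + 2 ^ p) * C * (2 * (enorm d (freq L k) * real d))) + 2 * \<bar>B\<bar> * real d"
  have C0: "0 \<le> C" using C[of "\<lambda>_. 0"] by linarith
  have cont: "continuous_on UNIV f" by (rule continuous_of_lipschitz[OF lip])
  have fb: "f \<in> borel_measurable borel" using cont by (rule borel_measurable_continuous_onI)
  have main: "\<bar>\<Lambda> f\<bar> \<le> 2 * ?E1 + ?E3 + K * (L / real (2 * m))" if m: "n < m" for m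
  proof -
    define \<eta> where "\<eta> = L / real (2 * m)"
    have \<eta>: "0 < \<eta>" using L m by (simp add: \<eta>_def)
    let ?r = "\<lambda>x. lattice_pt \<eta> (round_lattice d \<eta> x)"
    have perz: "f (lattice_pt \<eta> z) = f (lattice_pt \<eta> z')" if "\<forall>i<d. 2 * int m dvd z i - z' i" for z z'
    proof (rule per, intro allI impI)
      fix i assume "i < d"
      then have "2 * int m dvd z i - z' i" using that by simp
      then obtain t where "z i - z' i = 2 * int m * t" by (elim dvdE)
      then have "z i = z' i + 2 * int m * t" by simp
      then have "real_of_int (z i) = real_of_int (z' i) + real (2 * m) * real_of_int t" by simp
      then have "lattice_pt \<eta> z i = lattice_pt \<eta> z' i + L * of_int t"
        using m by (simp add: lattice_pt_def \<eta>_def field_simps)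
      then show "\<exists>n::int. lattice_pt \<eta> z i = lattice_pt \<eta> z' i + L * of_int n" by blast
    qed
    obtain g where g1: "\<And>z. norm (of_real (f (lattice_pt \<eta> z)) - (\<Sum>k\<in>fbox d n. g k * character d m k z)) \<le> ?E1"
      and g2: "\<And>k. norm (g k) \<le> (1 + 2 ^ p) * C"
      and g3: "(\<Sum>k\<in>fbox d n. (norm (g k))\<^sup>2 * enorm d (freq L k) ^ (2 * p)) \<le>
       (1 + 2 ^ p)\<^sup>2 * (real d ^ (p + 1) * ((pi / 2) ^ p * A)\<^sup>2)"
      using trig_approximation[OF n m L \<eta>_def d_pos p_pos perz A A0 C] by blast
    let ?c = "\<lambda>k x. cis (einner d (?r x) (freq L k))"
    have ch: "character d m k (round_lattice d \<eta> x) = ?c k x" for k x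
      by (rule character_cis[OF L _ \<eta>_def]) (use m in simp)
    let ?T = "\<lambda>x. \<Sum>k\<in>fbox d n. g k * ?c k x"
    have ci: "integrable \<mu> (?c k)" "integrable \<nu> (?c k)" for k
      by (rule P.integrable_cis_einner_round, rule Q.integrable_cis_einner_round)
    have Ti: "integrable \<mu> ?T" "integrable \<nu> ?T" using ci by auto
    have fi: "integrable \<mu> (\<lambda>x. f (?r x))" "integrable \<nu> (\<lambda>x. f (?r x))"
      by (rule P.integrable_bounded[where C = C, OF measurable_compose[OF P.measurable_round fb]], simp add: C)
        (rule Q.integrable_bounded[where C = C, OF measurable_compose[OF Q.measurable_round fb]], simp add: C)
    have f0: "integrable \<mu> f" "integrable \<nu> f"
      by (rule P.integrable_bounded[where C = C, OF P.measurable_continuous[OF cont]], simp add: C)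
        (rule Q.integrable_bounded[where C = C, OF Q.measurable_continuous[OF cont]], simp add: C)
    have fT: "norm (complex_of_real (f (?r x)) - ?T x) \<le> ?E1" for x
      using g1[of "round_lattice d \<eta> x"] by (simp only: ch)
    have fr: "norm (f (?r x) - f x) \<le> \<bar>B\<bar> * real d * \<eta>" for x
    proof -
      have "\<bar>f (?r x) - f x\<bar> \<le> B * enorm d (\<lambda>i. ?r x i - x i)" by (rule lip)
      also have "\<dots> \<le> \<bar>B\<bar> * (real d * \<eta>)"
        by (intro mult_mono enorm_round_le \<eta>) auto
      finally show ?thesis by simp
    qed
    have "\<bar>\<Lambda> f\<bar> \<le> \<bar>\<Lambda> (\<lambda>x. f (?r x))\<bar> + 2 * (\<bar>B\<bar> * real d * \<eta>)"
      using P.integral_close[OF fi(1) f0(1) fr] Q.integral_close[OF fi(2) f0(2) fr]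
      unfolding \<Lambda>_def real_norm_def by linarith
    also have "\<bar>\<Lambda> (\<lambda>x. f (?r x))\<bar> \<le> 2 * ?E1 + norm (\<Phi> ?T)"
    proof -
      have gen: "u - v = (u' - v') + ((u - u') - (v - v'))" for u v u' v' :: complex by simp
      let ?a = "(\<integral>x. complex_of_real (f (?r x)) \<partial>\<mu>) - (\<integral>x. ?T x \<partial>\<mu>)"
      let ?b = "(\<integral>x. complex_of_real (f (?r x)) \<partial>\<nu>) - (\<integral>x. ?T x \<partial>\<nu>)"
      have a: "norm ?a \<le> ?E1"
        by (rule P.integral_close[OF _ Ti(1) fT]) (use fi in simp)
      have b: "norm ?b \<le> ?E1"
        by (rule Q.integral_close[OF _ Ti(2) fT]) (use fi in simp)
      have e: "complex_of_real (\<Lambda> (\<lambda>x. f (?r x))) = \<Phi> ?T + (?a - ?b)"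
        unfolding \<Lambda>_def \<Phi>_def of_real_diff integral_of_real[OF fi(1), symmetric]
          integral_of_real[OF fi(2), symmetric] by (rule gen)
      have "\<bar>\<Lambda> (\<lambda>x. f (?r x))\<bar> = norm (\<Phi> ?T + (?a - ?b))"
        unfolding e[symmetric] norm_of_real ..
      also have "\<dots> \<le> norm (\<Phi> ?T) + (?E1 + ?E1)"
        by (rule norm_add_diff_le[OF a b])
      finally show ?thesis by simp
    qed
    also have "norm (\<Phi> ?T) \<le> ?E3 + (K - 2 * \<bar>B\<bar> * real d) * \<eta>"
    proof -
      have "\<Phi> ?T = (\<Sum>k\<in>fbox d n. g k * \<Phi> (?c k))"
        unfolding \<Phi>_def using ci
        by (simp add: Bochner_Integration.integral_sum sum_subtractf right_diff_distrib)
      then have "norm (\<Phi> ?T) \<le> (\<Sum>k\<in>fbox d n. norm (g k) * norm (\<Phi> (?c k)))"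
        by (simp only: norm_mult[symmetric] norm_sum)
      also have "\<dots> \<le> (\<Sum>k\<in>fbox d n. norm (g k) * (2 * Z * enorm d (freq L k) ^ p) +
          (1 + 2 ^ p) * C * (2 * (enorm d (freq L k) * (real d * \<eta>))))"
      proof (rule sum_mono)
        fix k
        have "norm (g k) * norm (\<Phi> (?c k)) \<le> norm (g k) * (2 * Z * enorm d (freq L k) ^ p + 2 * (enorm d (freq L k) * (real d * \<eta>)))"
          by (rule mult_left_mono[OF \<Phi>_round_bound[OF \<eta>]]) simp
        also have "\<dots> = norm (g k) * (2 * Z * enorm d (freq L k) ^ p) + norm (g k) * (2 * (enorm d (freq L k) * (real d * \<eta>)))"
          by (rule distrib_left)
        also have "\<dots> \<le> norm (g k) * (2 * Z * enorm d (freq L k) ^ p) + (1 + 2 ^ p) * C * (2 * (enorm d (freq L k) * (real d * \<eta>)))"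
          by (rule add_left_mono[OF mult_right_mono[OF g2]]) (use \<eta> in simp)
        finally show "norm (g k) * norm (\<Phi> (?c k)) \<le> norm (g k) * (2 * Z * enorm d (freq L k) ^ p) +
          (1 + 2 ^ p) * C * (2 * (enorm d (freq L k) * (real d * \<eta>)))" .
      qed
      also have "\<dots> = 2 * Z * (\<Sum>k\<in>fbox d n. norm (g k) * enorm d (freq L k) ^ p) + (K - 2 * \<bar>B\<bar> * real d) * \<eta>"
        unfolding K_def sum.distrib by (simp add: sum_distrib_left sum_distrib_right mult_ac)
      also have "\<dots> \<le> ?E3 + (K - 2 * \<bar>B\<bar> * real d) * \<eta>"
      proof -
        have "(\<Sum>k\<in>fbox d n. norm (g k) * enorm d (freq L k) ^ p)\<^sup>2 = (\<Sum>k\<in>fbox d n. 1 * (norm (g k) * enorm d (freq L k) ^ p))\<^sup>2"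
          by simp
        also have "\<dots> \<le> (\<Sum>k\<in>fbox d n. 1\<^sup>2) * (\<Sum>k\<in>fbox d n. (norm (g k) * enorm d (freq L k) ^ p)\<^sup>2)"
          by (rule Cauchy_Schwarz_ineq_sum)
        also have "(\<Sum>k\<in>fbox d n. (norm (g k) * enorm d (freq L k) ^ p)\<^sup>2) = (\<Sum>k\<in>fbox d n. (norm (g k))\<^sup>2 * enorm d (freq L k) ^ (2 * p))"
          by (simp add: power_mult_distrib power_mult[symmetric] mult.commute[of p])
        also have "(\<Sum>k\<in>fbox d n. 1\<^sup>2) * \<dots> \<le> real ((2 * n + 1) ^ d) * ((1 + 2 ^ p)\<^sup>2 * (real d ^ (p + 1) * ((pi / 2) ^ p * A)\<^sup>2))"
          by (rule mult_mono) (use g3 in \<open>auto simp: card_fbox intro: sum_nonneg\<close>)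
        also have "\<dots> = ((1 + 2 ^ p) * sqrt (real ((2 * n + 1) ^ d) * real d ^ (p + 1)) * ((pi / 2) ^ p * A))\<^sup>2"
        proof -
          have key: "X * (Y\<^sup>2 * (W * U\<^sup>2)) = (Y * sqrt (X * W) * U)\<^sup>2" if "0 \<le> X" "0 \<le> W" for X Y W U :: real
            using that by (simp add: power_mult_distrib)
          show ?thesis by (rule key) auto
        qed
        finally have "(\<Sum>k\<in>fbox d n. norm (g k) * enorm d (freq L k) ^ p) \<le>
           (1 + 2 ^ p) * sqrt (real ((2 * n + 1) ^ d) * real d ^ (p + 1)) * ((pi / 2) ^ p * A)"
          by (rule power2_le_imp_le) (use A0 in \<open>auto intro!: mult_nonneg_nonneg\<close>)
        then have "2 * Z * (\<Sum>k\<in>fbox d n. norm (g k) * enorm d (freq L k) ^ p) \<le>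
           2 * Z * ((1 + 2 ^ p) * sqrt (real ((2 * n + 1) ^ d) * real d ^ (p + 1)) * ((pi / 2) ^ p * A))"
          by (rule mult_left_mono) (use Z_nonneg in simp)
        then show ?thesis by (simp only: mult.assoc add_le_cancel_right)
      qed
      finally show ?thesis .
    qed
    finally have "\<bar>\<Lambda> f\<bar> \<le> 2 * ?E1 + (?E3 + (K - 2 * \<bar>B\<bar> * real d) * \<eta>) + 2 * (\<bar>B\<bar> * real d * \<eta>)"
      by (simp only: add.assoc add_le_cancel_left)
    moreover have "(K - 2 * \<bar>B\<bar> * real d) * \<eta> + 2 * (\<bar>B\<bar> * real d * \<eta>) = K * \<eta>"
      by (simp add: algebra_simps)
    ultimately show ?thesis unfolding \<eta>_def[symmetric] by linarith
  qed
  have lim: "(\<lambda>m. 2 * ?E1 + ?E3 + K * (L / real (2 * m))) \<longlonglongrightarrow> 2 * ?E1 + ?E3 + K * 0"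
  proof -
    have "(\<lambda>m. L / 2 * inverse (real m)) \<longlonglongrightarrow> L / 2 * 0"
      by (rule tendsto_mult[OF tendsto_const lim_inverse_n])
    moreover have "(\<lambda>m. L / 2 * inverse (real m)) = (\<lambda>m. L / real (2 * m))"
      by (rule ext) (simp add: inverse_eq_divide)
    ultimately have "(\<lambda>m. L / real (2 * m)) \<longlonglongrightarrow> 0" by (simp only: mult_zero_right)
    from tendsto_add[OF tendsto_const tendsto_mult[OF tendsto_const this]] show ?thesis .
  qed
  have "\<bar>\<Lambda> f\<bar> \<le> 2 * ?E1 + ?E3 + K * 0"
    by (rule LIMSEQ_le_const[OF lim]) (use main in \<open>auto intro!: exI[of _ "Suc n"]\<close>)
  then show ?thesis by simp
qed

end

section \<open>The main estimate\<close>

lemma (in moment_prob) abs_integral_le_moment: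
  fixes f :: "(nat \<Rightarrow> real) \<Rightarrow> real"
  assumes f: "integrable M f" and K: "0 \<le> K" and le: "\<And>x. \<bar>f x\<bar> \<le> C + K * enorm d x powr q"
  shows "\<bar>\<integral>x. f x \<partial>M\<bar> \<le> C + K * b powr q"
proof -
  have "\<bar>\<integral>x. f x \<partial>M\<bar> \<le> (\<integral>x. C + K * enorm d x powr q \<partial>M)"
    by (rule order_trans[OF integral_abs_bound]) (rule integral_mono, use f integrable_moment le in auto)
  also have "\<dots> = C + K * (\<integral>x. enorm d x powr q \<partial>M)"
    using integrable_moment by (simp add: prob_space)
  also have "\<dots> \<le> C + K * b powr q"
    using integral_moment K by (simp add: mult_left_mono)
  finally show ?thesis .
qed

lemma (in moment_prob) measurable_class:
  assumes u: "u \<in> zolotarev_class d p" and p: "1 \<le> p"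
  shows "class_jet d u [] \<in> borel_measurable M" "u \<in> borel_measurable M"
proof -
  have "times_differentiable d p u" using u by (simp add: zolotarev_class_def)
  from times_differentiable_foldr[OF this, of "[]"] p have "continuous_on UNIV (lift_Rd d u)"
    by (intro continuous_on_lift) auto
  then show m: "class_jet d u [] \<in> borel_measurable M"
    by (simp add: class_jet_def measurable_continuous)
  have "u x = class_jet d u [] x" if "x \<in> space M" for x
    using that by (simp add: class_jet_def lift_Rd_def space_M restrict_Rd)
  with m show "u \<in> borel_measurable M" by (simp cong: measurable_cong)
qed

context zol_pair
begin

lemma difference_bound:
  assumes i: "integrable \<mu> f" "integrable \<nu> f" "integrable \<mu> g" "integrable \<nu> g"
    and K: "0 \<le> K" and le: "\<And>x. \<bar>f x - g x\<bar> \<le> K * enorm d x powr q"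
  shows "\<bar>\<Lambda> f\<bar> \<le> \<bar>\<Lambda> g\<bar> + 2 * K * b powr q"
proof -
  have "\<bar>\<integral>x. f x - g x \<partial>\<mu>\<bar> \<le> 0 + K * b powr q"
    by (rule P.abs_integral_le_moment[OF _ K]) (use i le in auto)
  moreover have "\<bar>\<integral>x. f x - g x \<partial>\<nu>\<bar> \<le> 0 + K * b powr q"
    by (rule Q.abs_integral_le_moment[OF _ K]) (use i le in auto)
  moreover have "(\<integral>x. f x - g x \<partial>\<mu>) = (\<integral>x. f x \<partial>\<mu>) - (\<integral>x. g x \<partial>\<mu>)"
    "(\<integral>x. f x - g x \<partial>\<nu>) = (\<integral>x. f x \<partial>\<nu>) - (\<integral>x. g x \<partial>\<nu>)" using i by simp_all
  ultimately show ?thesis unfolding \<Lambda>_def by linarith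
qed

text \<open>The first estimate uses moments alone and serves when the balanced error would not be
  small. The second is the sum of the three errors before optimization in \<open>R\<close> and
  \<open>n\<close>.\<close>

lemma class_estimates:
  assumes u: "u \<in> zolotarev_class d p" and b: "0 < b"
  shows "\<bar>\<Lambda> u\<bar> \<le> 4 * (sqrt (real d) * b) ^ p"
    and "0 < R \<Longrightarrow> 1 \<le> n \<Longrightarrow> \<bar>\<Lambda> u\<bar> \<le> 4 * (2 * sqrt (real d) * R) ^ p * (b powr q / R powr q) +
      (2 * ((54 * sqrt (real d)) ^ p * (sqrt (real d) * (8 * R) / real (n + 1)) ^ p) +
       2 * Z * (1 + 2 ^ p) * sqrt (real ((2 * n + 1) ^ d) * real d ^ (p + 1)) * (pi / 2) ^ p * (54 * sqrt (real d)) ^ p)"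
proof -
  interpret J: jet d p "class_jet d u" by (rule class_jet[OF u])
  let ?V = "J.taylor_rem []" and ?D = "sqrt (real d)"
  have T: "agree (J.taylor_part [])"
    using agree_taylor_poly[of "\<lambda>J. class_jet d u (rev J @ []) (\<lambda>_. 0)"] by (simp add: J.taylor_part_def[abs_def])
  have Vg: "\<bar>?V x\<bar> \<le> (?D * enorm d x) ^ p" for x
  proof -
    have "\<bar>?V x\<bar> \<le> (?D * enorm d x) ^ p / fact p" by (rule J.taylor_rem_bound_enorm) auto
    also have "\<dots> \<le> (?D * enorm d x) ^ p / 1" by (rule divide_left_mono) (auto simp: fact_ge_1)
    finally show ?thesis by simp
  qed
  have Vg': "\<bar>?V x\<bar> \<le> ?D ^ p * enorm d x ^ p" for x using Vg[of x] by (simp add: power_mult_distrib)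
  have pq: "real p \<le> q" using p_less_q by simp
  have Vi: "integrable \<mu> ?V" "integrable \<nu> ?V"
  proof -
    have TI: "integrable \<mu> (J.taylor_part [])" "integrable \<nu> (J.taylor_part [])" using T by (simp_all add: agree_def)
    have m: "?V \<in> borel_measurable \<mu>" "?V \<in> borel_measurable \<nu>"
      unfolding J.taylor_rem_def[abs_def]
      by (rule borel_measurable_diff[OF P.measurable_class(1)[OF u p_pos] borel_measurable_integrable[OF TI(1)]])
        (rule borel_measurable_diff[OF Q.measurable_class(1)[OF u p_pos] borel_measurable_integrable[OF TI(2)]])
    show "integrable \<mu> ?V" by (rule P.integrable_of_growth[OF m(1) pq Vg'])
    show "integrable \<nu> ?V" by (rule Q.integrable_of_growth[OF m(2) pq Vg'])
  qed
  have \<Lambda>u: "\<Lambda> u = \<Lambda> ?V"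
  proof -
    have e: "u x = ?V x + J.taylor_part [] x" if "x \<in> Rd d" for x
      using that by (simp add: J.taylor_rem_def class_jet_eq)
    have "(\<integral>x. u x \<partial>\<mu>) = (\<integral>x. ?V x + J.taylor_part [] x \<partial>\<mu>)"
      by (rule Bochner_Integration.integral_cong) (simp_all add: e P.space_M)
    moreover have "(\<integral>x. u x \<partial>\<nu>) = (\<integral>x. ?V x + J.taylor_part [] x \<partial>\<nu>)"
      by (rule Bochner_Integration.integral_cong) (simp_all add: e Q.space_M)
    ultimately show ?thesis using T Vi by (simp add: agree_def \<Lambda>_def)
  qed
  show "\<bar>\<Lambda> u\<bar> \<le> 4 * (?D * b) ^ p"
  proof -
    \<comment> \<open>Splitting at \<open>enorm d x = b\<close>. Each of the two terms integrates to
      at most \<open>b ^ p\<close>, and two measures give the factor 4.\<close>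
    have pw: "enorm d x ^ p \<le> b ^ p * (1 + enorm d x powr q / b powr q)" for x
    proof -
      have "(enorm d x / b) ^ p \<le> 1 + (enorm d x / b) powr q"
        using b pq by (intro P.power_le_one_plus_powr) auto
      then show ?thesis using b by (simp add: power_divide powr_divide field_simps)
    qed
    have le: "\<bar>?V x\<bar> \<le> (?D * b) ^ p + (?D * b) ^ p / b powr q * enorm d x powr q" for x
    proof -
      have "?D ^ p * enorm d x ^ p \<le> ?D ^ p * (b ^ p * (1 + enorm d x powr q / b powr q))"
        by (rule mult_left_mono[OF pw]) simp
      with Vg'[of x] have "\<bar>?V x\<bar> \<le> ?D ^ p * (b ^ p * (1 + enorm d x powr q / b powr q))"
        by (rule order_trans)
      then show ?thesis by (simp add: power_mult_distrib algebra_simps)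
    qed
    have "0 \<le> (?D * b) ^ p / b powr q" using b by simp
    note P.abs_integral_le_moment[OF Vi(1) this le] Q.abs_integral_le_moment[OF Vi(2) this le]
    moreover have "(?D * b) ^ p / b powr q * b powr q = (?D * b) ^ p" using b by simp
    ultimately show ?thesis unfolding \<Lambda>u unfolding \<Lambda>_def by linarith
  qed
  assume R: "0 < R" and n: "1 \<le> n"
  obtain f where "\<exists>B. (\<forall>ts x. length ts = p \<longrightarrow> \<bar>fdiff ts f x\<bar> \<le> (54 * ?D) ^ p * prod_list (map (enorm d) ts)) \<and>
    (\<forall>x. enorm d x \<le> R \<longrightarrow> f x = ?V x) \<and> (\<forall>x. \<bar>f x\<bar> \<le> (2 * ?D * R) ^ p) \<and>
    (\<forall>x x'. (\<forall>i<d. \<exists>n::int. x i = x' i + 8 * R * of_int n) \<longrightarrow> f x = f x') \<and>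
    (\<forall>x y. \<bar>f y - f x\<bar> \<le> B * enorm d (\<lambda>i. y i - x i))"
    using J.truncation[OF p_pos R] ..
  then obtain B where F: "(\<forall>ts x. length ts = p \<longrightarrow> \<bar>fdiff ts f x\<bar> \<le> (54 * ?D) ^ p * prod_list (map (enorm d) ts)) \<and>
    (\<forall>x. enorm d x \<le> R \<longrightarrow> f x = ?V x) \<and> (\<forall>x. \<bar>f x\<bar> \<le> (2 * ?D * R) ^ p) \<and>
    (\<forall>x x'. (\<forall>i<d. \<exists>n::int. x i = x' i + 8 * R * of_int n) \<longrightarrow> f x = f x') \<and>
    (\<forall>x y. \<bar>f y - f x\<bar> \<le> B * enorm d (\<lambda>i. y i - x i))" ..
  have f1: "\<And>ts x. length ts = p \<Longrightarrow> \<bar>fdiff ts f x\<bar> \<le> (54 * ?D) ^ p * prod_list (map (enorm d) ts)"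
    and f2: "\<And>x. enorm d x \<le> R \<Longrightarrow> f x = ?V x" and f3: "\<And>x. \<bar>f x\<bar> \<le> (2 * ?D * R) ^ p"
    and f4: "\<And>x x'. \<forall>i<d. \<exists>n::int. x i = x' i + 8 * R * of_int n \<Longrightarrow> f x = f x'"
    and f5: "\<And>x y. \<bar>f y - f x\<bar> \<le> B * enorm d (\<lambda>i. y i - x i)"
    using F by blast+
  have fc: "continuous_on UNIV f" by (rule continuous_of_lipschitz[OF f5])
  have fi: "integrable \<mu> f" "integrable \<nu> f"
    by (rule P.integrable_bounded[where C = "(2 * ?D * R) ^ p", OF P.measurable_continuous[OF fc]], simp add: f3)
      (rule Q.integrable_bounded[where C = "(2 * ?D * R) ^ p", OF Q.measurable_continuous[OF fc]], simp add: f3)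
  \<comment> \<open>Outside the ball, with \<open>t = enorm d x / R > 1\<close>, both functions are
    at most \<open>(2 * ?D * R) ^ p * t ^ p\<close>, and
    \<open>t ^ p \<le> t powr q\<close>.\<close>
  let ?K = "2 * (2 * ?D * R) ^ p / R powr q"
  have "\<bar>?V x - f x\<bar> \<le> ?K * enorm d x powr q" for x
  proof (cases "enorm d x \<le> R")
    case True
    then show ?thesis using f2[OF True] R by simp
  next
    case False
    define t where "t = enorm d x / R"
    have t: "1 < t" "enorm d x = R * t" using False R by (simp_all add: t_def)
    have "\<bar>?V x\<bar> \<le> (2 * ?D * R) ^ p * t ^ p"
    proof -
      have "(?D * enorm d x) ^ p \<le> (2 * ?D * R * t) ^ p"
        unfolding t(2) using R t(1) by (intro power_mono) auto
      then show ?thesis using Vg[of x] by (simp add: power_mult_distrib)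
    qed
    moreover have "\<bar>f x\<bar> \<le> (2 * ?D * R) ^ p * t ^ p"
    proof -
      have "(2 * ?D * R) ^ p * 1 \<le> (2 * ?D * R) ^ p * t ^ p"
        using R t by (intro mult_left_mono one_le_power) auto
      then show ?thesis using f3[of x] by simp
    qed
    moreover have "t ^ p \<le> t powr q"
    proof -
      have "t ^ p = t powr real p" using t by (simp add: powr_realpow)
      also have "\<dots> \<le> t powr q" using t pq by (intro powr_mono) auto
      finally show ?thesis .
    qed
    moreover have "t powr q = enorm d x powr q / R powr q"
      using R by (simp add: t_def powr_divide)
    ultimately have "\<bar>?V x\<bar> + \<bar>f x\<bar> \<le> 2 * ((2 * ?D * R) ^ p * (enorm d x powr q / R powr q))"
      using mult_left_mono[of "t ^ p" "t powr q" "(2 * ?D * R) ^ p"] R by simp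
    then show ?thesis by simp
  qed
  then have "\<bar>\<Lambda> ?V\<bar> \<le> \<bar>\<Lambda> f\<bar> + 2 * ?K * b powr q"
    using R by (intro difference_bound Vi fi) auto
  moreover have "\<bar>\<Lambda> f\<bar> \<le> 2 * ((54 * ?D) ^ p * (?D * (8 * R) / real (n + 1)) ^ p) +
       2 * Z * (1 + 2 ^ p) * sqrt (real ((2 * n + 1) ^ d) * real d ^ (p + 1)) * (pi / 2) ^ p * (54 * ?D) ^ p"
    by (rule periodic_estimate[OF f1 _ f3 f4 _ f5 n]) (use R in auto)
  moreover have "2 * ?K * b powr q = 4 * (2 * ?D * R) ^ p * (b powr q / R powr q)" by simp
  ultimately show "\<bar>\<Lambda> u\<bar> \<le> 4 * (2 * ?D * R) ^ p * (b powr q / R powr q) +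
      (2 * ((54 * ?D) ^ p * (?D * (8 * R) / real (n + 1)) ^ p) +
       2 * Z * (1 + 2 ^ p) * sqrt (real ((2 * n + 1) ^ d) * real d ^ (p + 1)) * (pi / 2) ^ p * (54 * ?D) ^ p)"
    unfolding \<Lambda>u by linarith
qed

end

lemma sqrt_power_eq_powr:
  assumes "0 < a"
  shows "sqrt (a ^ n) = a powr (real n / 2)"
proof -
  have "sqrt (a ^ n) = (a powr real n) powr (1 / 2)"
    using assms by (simp add: powr_half_sqrt powr_realpow)
  also have "\<dots> = a powr (real n * (1 / 2))" by (rule powr_powr)
  finally show ?thesis by simp
qed

text \<open>
  The parameter \<open>y\<close> is the common size of the three error terms, up to the factor
  \<open>(\<surd>d b)\<^sup>p\<close>; the hypothesis on \<open>Z\<close> is the definition of \<open>y\<close> solved for \<open>Z\<close>.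
\<close>

lemma balance:
  fixes b q y :: real and d p :: nat
  assumes d: "1 \<le> d" and p: "1 \<le> p" and q: "real p < q" and b: "0 < b" and y: "0 < y" "y < 1"
    and \<beta>: "\<beta> = 2 / (2 + real d * q / (real p * (q - real p)))"
    and Z: "Z = b ^ p * (y / (12 * sqrt (real d)) ^ p) powr (1 / \<beta>)"
  shows "\<exists>R n. 0 < R \<and> 1 \<le> n \<and> (2 * sqrt (real d) * R) ^ p * (b powr q / R powr q) = (2 * sqrt (real d) * b) ^ p * y \<and>
    (sqrt (real d) * (8 * R) / real (n + 1)) ^ p \<le> (8 * b) ^ p * y \<and>
    Z * sqrt (real ((2 * n + 1) ^ d) * real d ^ (p + 1)) \<le> b ^ p * y"
proof -
  define D where "D = sqrt (real d)"
  \<comment> \<open>\<open>R\<close> solves \<open>(R / b) powr (p - q) = y\<close>, and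
    \<open>n\<close> is the least integer above \<open>x\<close>, where
    \<open>D * R / x = b * y powr (1 / p)\<close>. Counting frequencies then costs
    \<open>y powr (- d * g / 2)\<close>, which is the origin of
    \<open>1 / \<beta> = 1 + d * g / 2\<close>.\<close>
  define e where "e = 1 / (q - real p)"
  define g where "g = 1 / real p + e"
  define \<tau> where "\<tau> = y powr (- e)"
  define R where "R = b * \<tau>"
  define x where "x = D * y powr (- g)"
  define n where "n = nat \<lceil>x\<rceil>"
  have D1: "1 \<le> D" using d by (simp add: D_def)
  have pr: "0 < real p" using p by simp
  have e0: "0 < e" using q by (simp add: e_def)
  have g0: "0 < g" unfolding g_def using e0 pr by (intro add_pos_pos divide_pos_pos) auto
  have \<tau>0: "0 < \<tau>" using y by (simp add: \<tau>_def)
  have R: "0 < R" using b \<tau>0 by (simp add: R_def)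
  have gq: "g = q / (real p * (q - real p))"
    using q pr by (simp add: g_def e_def field_simps)
  have pg: "1 \<le> real p * g" using e0 pr by (simp add: g_def distrib_left)
  have \<beta>': "1 / \<beta> = 1 + real d * g / 2"
  proof -
    have "real d * q / (real p * (q - real p)) = real d * g" by (simp add: gq)
    then show ?thesis unfolding \<beta> by (simp add: add_divide_distrib)
  qed
  have yg: "1 \<le> y powr (- g)"
    using y g0 powr_mono'[of "- g" 0 y] by simp
  have x1: "1 \<le> x" using mult_mono[OF D1 yg] D1 by (simp add: x_def)
  have n1: "1 \<le> n" "x \<le> real n" "real n \<le> 2 * x" using x1 unfolding n_def by linarith+
  have A: "(2 * D * R) ^ p * (b powr q / R powr q) = (2 * D * b) ^ p * y"
  proof -
    have "\<tau> ^ p / \<tau> powr q = \<tau> powr (real p - q)"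
      using \<tau>0 by (simp add: powr_diff powr_realpow)
    also have "\<dots> = y powr (- e * (real p - q))" by (simp add: \<tau>_def powr_powr)
    also have "- e * (real p - q) = 1" using q by (simp add: e_def field_simps)
    finally have t: "\<tau> ^ p / \<tau> powr q = y" using y by simp
    have "b powr q / R powr q = 1 / \<tau> powr q" using b \<tau>0 by (simp add: R_def powr_mult)
    then have "(2 * D * R) ^ p * (b powr q / R powr q) = (2 * D * b) ^ p * (\<tau> ^ p / \<tau> powr q)"
      by (simp add: R_def power_mult_distrib)
    then show ?thesis by (simp only: t)
  qed
  have B: "(D * (8 * R) / real (n + 1)) ^ p \<le> (8 * b) ^ p * y"
  proof -
    have "D * (8 * R) / real (n + 1) \<le> D * (8 * R) / x"
      using n1 x1 D1 R by (intro divide_left_mono) auto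
    also have "\<dots> = 8 * b * (y powr (- e) / y powr (- g))" using D1 by (simp add: x_def R_def \<tau>_def)
    also have "y powr (- e) / y powr (- g) = y powr (1 / real p)"
      by (simp add: powr_diff[symmetric] g_def)
    finally have "(D * (8 * R) / real (n + 1)) ^ p \<le> (8 * b * y powr (1 / real p)) ^ p"
      using D1 R by (intro power_mono) auto
    also have "\<dots> = (8 * b) ^ p * (y powr (1 / real p)) ^ p" by (simp only: power_mult_distrib)
    also have "(y powr (1 / real p)) ^ p = y"
      using y pr by (simp add: powr_realpow[symmetric] powr_powr)
    finally show ?thesis .
  qed
  have C: "Z * sqrt (real ((2 * n + 1) ^ d) * real d ^ (p + 1)) \<le> b ^ p * y"
  proof -
    have "real (2 * n + 1) \<le> 6 * x" using n1 by linarith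
    then have "real (2 * n + 1) ^ d \<le> (6 * x) ^ d" by (rule power_mono) simp
    then have "sqrt (real ((2 * n + 1) ^ d)) \<le> sqrt ((6 * x) ^ d)"
      by (simp only: of_nat_power real_sqrt_le_iff)
    also have "\<dots> = (6 * x) powr (real d / 2)"
      by (rule sqrt_power_eq_powr) (use x1 in simp)
    also have "\<dots> = (6 * D) powr (real d / 2) * y powr (- g * (real d / 2))"
      using D1 by (simp add: x_def powr_mult powr_powr mult.assoc[symmetric])
    finally have s1: "sqrt (real ((2 * n + 1) ^ d)) \<le> (6 * D) powr (real d / 2) * y powr (- g * (real d / 2))" .
    have s2: "sqrt (real d ^ (p + 1)) = D ^ p * D" by (simp add: D_def real_sqrt_power real_sqrt_mult)
    have z: "Z = b ^ p * (y * y powr (real d * g / 2) * (12 * D) powr (- (real p + real d / 2 * (real p * g))))"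
    proof -
      have "(y / (12 * D) ^ p) powr (1 / \<beta>) = y powr (1 + real d * g / 2) / ((12 * D) powr real p) powr (1 + real d * g / 2)"
        unfolding \<beta>' using y D1 by (simp add: powr_divide powr_realpow)
      also have "\<dots> = y * y powr (real d * g / 2) * (12 * D) powr (- (real p + real d / 2 * (real p * g)))"
      proof -
        have "((12 * D) powr real p) powr (1 + real d * g / 2) = (12 * D) powr (real p + real d / 2 * (real p * g))"
          unfolding powr_powr by (rule arg_cong[where f = "\<lambda>t. (12 * D) powr t"]) (simp add: algebra_simps)
        moreover have "y powr (1 + real d * g / 2) = y * y powr (real d * g / 2)"
          using y by (simp add: powr_add)
        ultimately show ?thesis by (simp only: powr_minus_divide) simp
      qed
      finally show ?thesis by (simp only: Z D_def)
    qed
    \<comment> \<open>As \<open>p * g \<ge> 1\<close>, the exponent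
      \<open>p / \<beta> = p + (d / 2) * p * g\<close> is at least \<open>p + d / 2\<close>. This
      provides one factor for the \<open>D ^ p\<close> from Parseval and one for the
      \<open>(6 * D) powr (d / 2)\<close> from counting frequencies.\<close>
    have m: "(12 * D) powr (- (real p + real d / 2 * (real p * g))) \<le> (12 * D) powr (- real p) * (12 * D) powr (- (real d / 2))"
    proof -
      have "real d / 2 * 1 \<le> real d / 2 * (real p * g)" using pg by (intro mult_left_mono) auto
      then have "(12 * D) powr (- (real p + real d / 2 * (real p * g))) \<le> (12 * D) powr (- real p + - (real d / 2))"
        using D1 by (intro powr_mono) auto
      then show ?thesis by (simp only: powr_add)
    qed
    have c1: "(12 * D) powr (- real p) * D ^ p \<le> 1"
    proof -
      have "(12 * D) powr (- real p) * D ^ p = 1 / 12 ^ p"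
        using D1 by (simp add: powr_minus_divide powr_realpow power_mult_distrib)
      then show ?thesis by simp
    qed
    \<comment> \<open>The constant 12 is twice the 6 in \<open>2 * n + 1 \<le> 6 * x\<close>: the
      surplus \<open>2 powr (- d / 2)\<close> absorbs the extra \<open>sqrt d\<close>, since
      \<open>d \<le> 2 ^ d\<close>.\<close>
    have c2: "(12 * D) powr (- (real d / 2)) * (6 * D) powr (real d / 2) * D \<le> 1"
    proof -
      have "(12 * D) powr (- (real d / 2)) * (6 * D) powr (real d / 2) = 1 / 2 powr (real d / 2)"
      proof -
        have "(12 * D) powr (real d / 2) = 2 powr (real d / 2) * (6 * D) powr (real d / 2)"
          using D1 powr_mult[of 2 "6 * D" "real d / 2"] by simp
        then show ?thesis using D1 by (simp add: powr_minus_divide)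
      qed
      moreover have "D \<le> 2 powr (real d / 2)"
      proof -
        have "real d \<le> 2 ^ d" using of_nat_less_two_power[of d] by (metis less_imp_le of_nat_less_iff of_nat_numeral of_nat_power)
        then have "D \<le> sqrt (2 ^ d)" by (simp add: D_def)
        also have "\<dots> = 2 powr (real d / 2)"
          by (rule sqrt_power_eq_powr) simp
        finally show ?thesis .
      qed
      ultimately show ?thesis by simp
    qed
    have "Z * sqrt (real ((2 * n + 1) ^ d) * real d ^ (p + 1)) = Z * (sqrt (real ((2 * n + 1) ^ d)) * (D ^ p * D))"
      by (simp only: real_sqrt_mult s2)
    also have "\<dots> \<le> Z * ((6 * D) powr (real d / 2) * y powr (- g * (real d / 2)) * (D ^ p * D))"
      using s1 D1 b by (intro mult_left_mono mult_right_mono) (auto simp: Z)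
    also have "\<dots> \<le> b ^ p * (y * y powr (real d * g / 2) * ((12 * D) powr (- real p) * (12 * D) powr (- (real d / 2)))) *
        ((6 * D) powr (real d / 2) * y powr (- g * (real d / 2)) * (D ^ p * D))"
      unfolding z using m y b D1 by (intro mult_right_mono mult_left_mono) auto
    also have "\<dots> = b ^ p * y * (y powr (real d * g / 2) * y powr (- g * (real d / 2))) *
        (((12 * D) powr (- real p) * D ^ p) * ((12 * D) powr (- (real d / 2)) * (6 * D) powr (real d / 2) * D))"
      by (simp only: mult_ac)
    also have "y powr (real d * g / 2) * y powr (- g * (real d / 2)) = 1"
      using y by (simp add: powr_add[symmetric] algebra_simps)
    also have "b ^ p * y * 1 * (((12 * D) powr (- real p) * D ^ p) * ((12 * D) powr (- (real d / 2)) * (6 * D) powr (real d / 2) * D)) \<le> b ^ p * y * 1 * (1 * 1)"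
      using c1 c2 y b D1 by (intro mult_left_mono mult_mono) auto
    finally show ?thesis by simp
  qed
  from R n1(1) A B C show ?thesis unfolding D_def by blast
qed

lemma (in zol_pair) class_bound:
  assumes u: "u \<in> zolotarev_class d p" and b: "0 < b" and Z0: "0 < Z"
    and \<beta>: "\<beta> = 2 / (2 + real d * q / (real p * (q - real p)))"
  shows "\<bar>\<Lambda> u\<bar> \<le> (51840 * real d) ^ p * b powr (real p * (1 - \<beta>)) * Z powr \<beta>"
proof -
  let ?D = "sqrt (real d)"
  define y where "y = (12 * ?D) ^ p * (Z / b ^ p) powr \<beta>"
  have d1: "1 \<le> ?D" using d_pos by simp
  have y0: "0 < y" using Z0 b d1 by (simp add: y_def)
  have \<beta>0: "0 < \<beta>" unfolding \<beta> using p_less_q by (intro divide_pos_pos add_pos_nonneg) auto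
  have D2: "?D ^ p * ?D ^ p = real d ^ p" by (simp add: power_mult_distrib[symmetric])
  have target: "b ^ p * (Z / b ^ p) powr \<beta> = b powr (real p * (1 - \<beta>)) * Z powr \<beta>"
  proof -
    have "(b ^ p) powr \<beta> = b powr (real p * \<beta>)" using b by (simp add: powr_realpow[symmetric] powr_powr)
    moreover have "b powr (real p * (1 - \<beta>)) = b ^ p / b powr (real p * \<beta>)"
      using b by (simp add: right_diff_distrib powr_diff powr_realpow)
    ultimately show ?thesis using b Z0 by (simp add: powr_divide)
  qed
  \<comment> \<open>\<open>51840 = 4320 * 12\<close>; the two factors \<open>?D ^ p\<close>, one
    from the class and one inside \<open>y\<close>, combine to \<open>d ^ p\<close>.\<close>
  have fin: "(4320 * ?D * b) ^ p * y = (51840 * real d) ^ p * b powr (real p * (1 - \<beta>)) * Z powr \<beta>"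
  proof -
    have "(4320 * ?D * b) ^ p * y = (4320 ^ p * 12 ^ p) * (?D ^ p * ?D ^ p) * (b ^ p * (Z / b ^ p) powr \<beta>)"
      unfolding y_def power_mult_distrib by (simp only: mult_ac)
    also have "(4320 ^ p * 12 ^ p :: real) = 51840 ^ p" by (simp add: power_mult_distrib[symmetric])
    finally show ?thesis unfolding D2 target by (simp only: power_mult_distrib mult.assoc)
  qed
  have "\<bar>\<Lambda> u\<bar> \<le> (4320 * ?D * b) ^ p * y"
  proof (cases "y < 1")
    \<comment> \<open>For \<open>y \<ge> 1\<close> the estimate from moments alone suffices.\<close>
    case False
    have "4 * (?D * b) ^ p \<le> 4320 ^ p * (?D * b) ^ p"
      using p_pos power_increasing[of 1 p "4320::real"] b d1 by (intro mult_right_mono) auto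
    also have "\<dots> \<le> 4320 ^ p * (?D * b) ^ p * y"
      using False b d1 mult_left_mono[of 1 y "4320 ^ p * (?D * b) ^ p"] by simp
    finally show ?thesis using class_estimates(1)[OF u b] by (simp add: power_mult_distrib mult_ac)
  next
    case True
    have "Z = b ^ p * (y / (12 * ?D) ^ p) powr (1 / \<beta>)"
    proof -
      have "y / (12 * ?D) ^ p = (Z / b ^ p) powr \<beta>" using d1 by (simp add: y_def)
      then have "(y / (12 * ?D) ^ p) powr (1 / \<beta>) = (Z / b ^ p)"
        using \<beta>0 Z0 b by (simp add: powr_powr)
      then show ?thesis using b by simp
    qed
    from balance[OF d_pos p_pos p_less_q b y0 True \<beta> this]
    obtain R n where R: "0 < R" and n: "1 \<le> n"
      and A: "(2 * ?D * R) ^ p * (b powr q / R powr q) = (2 * ?D * b) ^ p * y"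
      and B: "(?D * (8 * R) / real (n + 1)) ^ p \<le> (8 * b) ^ p * y"
      and C: "Z * sqrt (real ((2 * n + 1) ^ d) * real d ^ (p + 1)) \<le> b ^ p * y" by blast
    let ?X = "?D ^ p * b ^ p * y"
    have X0: "0 \<le> ?X" using b y0 by simp
    have a: "4 * (2 * ?D * R) ^ p * (b powr q / R powr q) = 4 * 2 ^ p * ?X"
    proof -
      have "4 * (2 * ?D * R) ^ p * (b powr q / R powr q) = 4 * ((2 * ?D * b) ^ p * y)"
        by (simp only: mult.assoc[of 4] A)
      then show ?thesis by (simp only: power_mult_distrib mult.assoc mult.left_commute)
    qed
    have bb: "2 * ((54 * ?D) ^ p * (?D * (8 * R) / real (n + 1)) ^ p) \<le> 2 * 432 ^ p * ?X"
    proof -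
      have "(54 * ?D) ^ p * (?D * (8 * R) / real (n + 1)) ^ p \<le> (54 * ?D) ^ p * ((8 * b) ^ p * y)"
        by (rule mult_left_mono[OF B]) simp
      also have "\<dots> = (54 ^ p * 8 ^ p) * ?X" by (simp only: power_mult_distrib mult_ac)
      also have "(54 ^ p * 8 ^ p :: real) = 432 ^ p" by (simp add: power_mult_distrib[symmetric])
      finally show ?thesis by simp
    qed
    have cc: "2 * Z * (1 + 2 ^ p) * sqrt (real ((2 * n + 1) ^ d) * real d ^ (p + 1)) * (pi / 2) ^ p * (54 * ?D) ^ p
        \<le> 4 * 216 ^ p * ?X"
    proof -
      define S where "S = sqrt (real ((2 * n + 1) ^ d) * real d ^ (p + 1))"
      define W where "W = (pi / 2) ^ p"
      have W: "0 \<le> W" "W \<le> 2 ^ p"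
        unfolding W_def using pi_less_4 by (auto intro!: power_mono)
      have h1: "(1 + 2 ^ p) * W \<le> (2 * 2 ^ p) * 2 ^ p"
        by (rule mult_mono) (use W in auto)
      have h2: "(54 * ?D) ^ p * (Z * S) \<le> (54 * ?D) ^ p * (b ^ p * y)"
        unfolding S_def by (rule mult_left_mono[OF C]) simp
      have "((1 + 2 ^ p) * W) * ((54 * ?D) ^ p * (Z * S)) \<le> ((2 * 2 ^ p) * 2 ^ p) * ((54 * ?D) ^ p * (b ^ p * y))"
        by (rule mult_mono[OF h1 h2]) (use Z0 in \<open>auto simp: S_def\<close>)
      also have "\<dots> = 2 * (2 ^ p * 2 ^ p * 54 ^ p) * ?X"
        by (simp add: power_mult_distrib)
      also have "(2 ^ p * 2 ^ p * 54 ^ p :: real) = 216 ^ p" by (simp add: power_mult_distrib[symmetric])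
      finally have le: "((1 + 2 ^ p) * W) * ((54 * ?D) ^ p * (Z * S)) \<le> 2 * 216 ^ p * ?X" .
      have eq: "2 * Z * (1 + 2 ^ p) * S * W * (54 * ?D) ^ p = 2 * (((1 + 2 ^ p) * W) * ((54 * ?D) ^ p * (Z * S)))"
        by simp
      show ?thesis unfolding S_def[symmetric] W_def[symmetric] eq using le by linarith
    qed
    \<comment> \<open>\<open>432 = 54 * 8\<close> belongs to Jackson's error,
      \<open>216 = 2 * 2 * 54\<close> to the Fourier term, using
      \<open>1 + 2 ^ p \<le> 2 * 2 ^ p\<close> and \<open>pi / 2 \<le> 2\<close>. The coefficients
      add up to 10, and \<open>10 \<le> 10 ^ p\<close>.\<close>
    have "4 * 2 ^ p + 2 * 432 ^ p + 4 * 216 ^ p \<le> (4320::real) ^ p"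
    proof -
      have "(2::real) ^ p \<le> 432 ^ p" "(216::real) ^ p \<le> 432 ^ p" by (intro power_mono; simp)+
      then have "4 * 2 ^ p + 2 * 432 ^ p + 4 * 216 ^ p \<le> 10 * (432::real) ^ p" by linarith
      also have "\<dots> \<le> 10 ^ p * 432 ^ p"
        using p_pos power_increasing[of 1 p "10::real"] by (intro mult_right_mono) auto
      also have "\<dots> = 4320 ^ p" by (simp add: power_mult_distrib[symmetric])
      finally show ?thesis .
    qed
    then have "(4 * 2 ^ p + 2 * 432 ^ p + 4 * 216 ^ p) * ?X \<le> 4320 ^ p * ?X"
      by (rule mult_right_mono[OF _ X0])
    moreover have "4320 ^ p * ?X = (4320 * ?D * b) ^ p * y" by (simp only: power_mult_distrib mult.assoc)
    ultimately show ?thesis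
      using class_estimates(2)[OF u b R n] a bb cc unfolding distrib_right by linarith
  qed
  then show ?thesis unfolding fin .
qed

text \<open>The moment condition with \<open>b = 0\<close> concentrates both measures at the origin.
  The case is separate because balancing divides by \<open>b\<close>.\<close>

lemma zolotarev_degenerate:
  assumes "moment_prob \<mu> d q 0" "moment_prob \<nu> d q 0" and p: "1 \<le> p"
  shows "zolotarev d p \<mu> \<nu> = 0"
proof -
  interpret P: moment_prob \<mu> d q 0 by fact
  interpret Q: moment_prob \<nu> d q 0 by fact
  have main: "(\<integral>x. u x \<partial>M) = u (\<lambda>i\<in>{..<d}. 0)"
    if "moment_prob M d q 0" and u: "u \<in> zolotarev_class d p" for M u
  proof -
    interpret M: moment_prob M d q 0 by fact
    have "AE x in M. ennreal (enorm d x powr q) = 0"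
    proof -
      have "(\<lambda>x. ennreal (enorm d x powr q)) \<in> borel_measurable M"
        using M.integrable_moment by (intro measurable_compose[OF _ measurable_ennreal]) auto
      moreover have "(\<integral>\<^sup>+ x. ennreal (enorm d x powr q) \<partial>M) = 0" using M.moment by simp
      ultimately show ?thesis by (simp only: nn_integral_0_iff_AE)
    qed
    then have "AE x in M. u x = u (\<lambda>i\<in>{..<d}. 0)"
    proof (rule AE_mp, intro AE_I2 impI)
      fix x assume x: "x \<in> space M" and "ennreal (enorm d x powr q) = 0"
      then have "enorm d x = 0" by (simp add: ennreal_eq_0_iff)
      then have "x i = 0" if "i < d" for i using abs_le_enorm[OF that, of x] by simp
      then have "x = (\<lambda>i\<in>{..<d}. 0)"
        using x unfolding M.space_M Rd_def by (intro PiE_ext[of x "{..<d}" "\<lambda>_. UNIV"]) auto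
      then show "u x = u (\<lambda>i\<in>{..<d}. 0)" by simp
    qed
    then have "(\<integral>x. u x \<partial>M) = (\<integral>x. u (\<lambda>i\<in>{..<d}. 0) \<partial>M)"
      by (intro integral_cong_AE) (use M.measurable_class(2)[OF u p] in auto)
    then show ?thesis by (simp add: M.prob_space)
  qed
  show ?thesis unfolding zolotarev_def
    using main[OF assms(1)] main[OF assms(2)] by (simp add: SUP_eq_const bot_ennreal[symmetric] SUP_bot_conv)
qed

theorem theorem1p2:
  shows "\<exists>c::real. c > 0 \<and>
    (\<forall>(d::nat) (p::nat) (q::real) (b::real) (\<mu>::(nat \<Rightarrow> real) measure) (\<nu>::(nat \<Rightarrow> real) measure).
      d \<ge> 1 \<longrightarrow> p \<ge> 1 \<longrightarrow> q > real p \<longrightarrow> b \<ge> 0 \<longrightarrow>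
      prob_space \<mu> \<longrightarrow> sets \<mu> = sets (borel_Rd d) \<longrightarrow>
      prob_space \<nu> \<longrightarrow> sets \<nu> = sets (borel_Rd d) \<longrightarrow>
      (\<integral>\<^sup>+ x. ennreal (enorm d x powr q) \<partial>\<mu>) \<le> ennreal (b powr q) \<longrightarrow>
      (\<integral>\<^sup>+ x. ennreal (enorm d x powr q) \<partial>\<nu>) \<le> ennreal (b powr q) \<longrightarrow>
      (let \<beta> = 2 / (2 + real d * q / (real p * (q - real p))) in
        zolotarev d p \<mu> \<nu> \<le>
          ennreal ((c * real d) ^ p * b powr (real p * (1 - \<beta>))) *
          (SUP \<theta>\<in>usphere d. ennpowr (zolotarev 1 p (marginal d \<theta> \<mu>) (marginal d \<theta> \<nu>)) \<beta>)))"
proof (intro exI[of _ "51840::real"] conjI allI impI)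
  fix d p :: nat and q b :: real and \<mu> \<nu> :: "(nat \<Rightarrow> real) measure"
  assume d: "d \<ge> 1" and p: "p \<ge> 1" and q: "q > real p" and b: "b \<ge> 0"
    and \<mu>: "prob_space \<mu>" "sets \<mu> = sets (borel_Rd d)" and \<nu>: "prob_space \<nu>" "sets \<nu> = sets (borel_Rd d)"
    and m\<mu>: "(\<integral>\<^sup>+ x. ennreal (enorm d x powr q) \<partial>\<mu>) \<le> ennreal (b powr q)"
    and m\<nu>: "(\<integral>\<^sup>+ x. ennreal (enorm d x powr q) \<partial>\<nu>) \<le> ennreal (b powr q)"
  define \<beta> where "\<beta> = 2 / (2 + real d * q / (real p * (q - real p)))"
  define K where "K = (51840 * real d) ^ p * b powr (real p * (1 - \<beta>))"
  define Y where "Y = (SUP \<theta>\<in>usphere d. ennpowr (zolotarev 1 p (marginal d \<theta> \<mu>) (marginal d \<theta> \<nu>)) \<beta>)"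
  have mp: "moment_prob \<mu> d q b" "moment_prob \<nu> d q b"
    using \<mu> \<nu> m\<mu> m\<nu> b p q by (auto simp: moment_prob_def moment_prob_axioms_def)
  have \<beta>0: "0 < \<beta>" unfolding \<beta>_def using q by (intro divide_pos_pos add_pos_nonneg) auto
  have "zolotarev d p \<mu> \<nu> \<le> ennreal K * Y"
  proof (cases "b = 0")
    case True
    then show ?thesis using zolotarev_degenerate[of \<mu> d q \<nu> p] mp p by simp
  next
    case False
    then have b: "0 < b" using b by simp
    have K: "0 < K" using b d by (simp add: K_def)
    show ?thesis
    proof (cases "Y = \<infinity>")
      case True
      then show ?thesis using K by (simp add: ennreal_mult_top)
    next
      case False
      then obtain y where y: "0 \<le> y" "Y = ennreal y" by (cases Y) auto
      have "\<bar>(\<integral>x. u x \<partial>\<mu>) - (\<integral>x. u x \<partial>\<nu>)\<bar> \<le> K * y" if u: "u \<in> zolotarev_class d p" for u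
      proof (rule field_le_epsilon)
        fix \<epsilon> :: real assume \<epsilon>: "0 < \<epsilon>"
        \<comment> \<open>The slack makes \<open>Z\<close> positive even when all marginals have
          distance 0, as \<open>class_bound\<close> requires. The supremum runs over powers with
          exponent \<open>\<beta>\<close>, hence the exponent \<open>1 / \<beta>\<close> in
          \<open>Z\<close>.\<close>
        define y' where "y' = y + \<epsilon> / K"
        define Z where "Z = y' powr (1 / \<beta>)"
        have y': "0 < y'" "y \<le> y'" using y \<epsilon> K by (auto simp: y'_def add_nonneg_pos)
        have "zolotarev 1 p (marginal d \<theta> \<mu>) (marginal d \<theta> \<nu>) \<le> ennreal Z" if \<theta>: "\<theta> \<in> usphere d" for \<theta>
        proof -
          let ?z = "zolotarev 1 p (marginal d \<theta> \<mu>) (marginal d \<theta> \<nu>)"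
          have le: "ennpowr ?z \<beta> \<le> ennreal y"
            unfolding y(2)[symmetric] Y_def by (rule SUP_upper[OF \<theta>])
          then have nf: "?z \<noteq> \<infinity>" by (auto simp: ennpowr_def top_unique)
          then have "enn2real ?z powr \<beta> \<le> y'"
            using le y y' by (simp add: ennpowr_def)
          then have "(enn2real ?z powr \<beta>) powr (1 / \<beta>) \<le> Z"
            unfolding Z_def using \<beta>0 by (intro powr_mono2) auto
          then have "enn2real ?z \<le> Z" using \<beta>0 by (simp add: powr_powr)
          then have "ennreal (enn2real ?z) \<le> ennreal Z" by (rule ennreal_leI)
          then show ?thesis using nf by (simp add: less_top)
        qed
        then interpret zol_pair \<mu> \<nu> d q b p Z
          using mp d p q by (auto simp: zol_pair_def zol_pair_axioms_def Z_def)
        have "\<bar>\<Lambda> u\<bar> \<le> K * Z powr \<beta>"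
          unfolding K_def by (rule class_bound[OF u b _ \<beta>_def]) (use y' in \<open>simp add: Z_def\<close>)
        also have "Z powr \<beta> = y'" using y' \<beta>0 by (simp add: Z_def powr_powr)
        also have "K * y' = K * y + \<epsilon>" using K by (simp add: y'_def distrib_left)
        finally show "\<bar>(\<integral>x. u x \<partial>\<mu>) - (\<integral>x. u x \<partial>\<nu>)\<bar> \<le> K * y + \<epsilon>" by (simp add: \<Lambda>_def)
      qed
      then have "zolotarev d p \<mu> \<nu> \<le> ennreal (K * y)"
        unfolding zolotarev_def by (intro SUP_least ennreal_leI)
      then show ?thesis using K y by (simp add: ennreal_mult)
    qed
  qed
  then show "let \<beta> = 2 / (2 + real d * q / (real p * (q - real p))) in
        zolotarev d p \<mu> \<nu> \<le>
          ennreal ((51840 * real d) ^ p * b powr (real p * (1 - \<beta>))) *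
          (SUP \<theta>\<in>usphere d. ennpowr (zolotarev 1 p (marginal d \<theta> \<mu>) (marginal d \<theta> \<nu>)) \<beta>)"
    unfolding Let_def K_def Y_def \<beta>_def .
qed simp

end
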